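(* Let $(K_n)_{n\in\mathbb{N}}$ be a sequence of convex bodies with $K_n\subseteq\mathbb{R}^n$, and let $\mu_{K_n}$ denote the uniform probability measure on $K_n$. If $$\frac1n\,\mathbb{E}_{\mu_{K_n}}\left[\Lambda_{K_n}^*\right]\longrightarrow+\infty\qquad(n\to\infty),$$ then the sequence $(\mu_{K_n})_{n\in\mathbb{N}}$ exhibits a sharp threshold for random convex hulls around $\left(\mathbb{E}_{\mu_{K_n}}[\Lambda_{K_n}^*]\right)_{n\in\mathbb{N}}$.
   Context: A convex body in $\mathbb{R}^n$ is a compact convex set with non-empty interior. For a Borel probability measure $\mu$ on $\mathbb{R}^n$, $\Lambda_\mu(\theta)=\log\int e^{\langle\theta,x\rangle}\,d\mu(x)$ and $\Lambda_\mu^*(x)=\sup_{\theta\in\mathbb{R}^n}\{\langle\theta,x\rangle-\Lambda_\mu(\theta)\}$ (Cramér transform); $\Lambda_{K}^*=\Lambda_{\mu_{K}}^*$. Sharp threshold: given a Borel probability measure $\mu$ on $\mathbb{R}^n$, for a positive integer $N$ let $P_N=\operatorname{conv}\{X_1,\ldots,X_N\}$ with $X_1,\ldots,X_N$ independent with law $\mu$, and let $\mathbb{E}_{\mu^N}$ be the expectation over $(X_1,\ldots,X_N)$. For $\delta>0$ set $$\varrho_1(\mu,\delta)=\sup\{r>0:\mathbb{E}_{\mu^N}[\mu(P_N)]\leq\delta\text{ for every }N\leq e^r\},\qquad \varrho_2(\mu,\delta)=\inf\{r>0:\mathbb{E}_{\mu^N}[\mu(P_N)]\geq1-\delta\text{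 for every }N\geq e^r\}.$$ A sequence $(\mu_n)$ of probability measures $\mu_n$ on $\mathbb{R}^n$ exhibits a sharp threshold (for random convex hulls) around a sequence $(T_n)$ of positive numbers if there is a sequence $(\delta_n)$ of positive numbers with $\delta_n\to0$ such that for every $\varepsilon\in(0,1)$ there is $n_0(\varepsilon)$ with $\varrho_1(\mu_n,\delta_n)\geq(1-\varepsilon)T_n$ and $\varrho_2(\mu_n,\delta_n)\leq(1+\varepsilon)T_n$ for all $n\geq n_0(\varepsilon)$. *)

theory Defs
  imports "HOL-Probability.Probability" "HOL-Library.Function_Algebras"
begin

(* Pointwise vector space structure on functions, so that the library's convex and hull apply
   to points of R^n given by coordinate functions. *)

instantiation "fun" :: (type, real_vector) real_vector
begin

definition scaleR_fun_def: "scaleR c f = (\<lambda>x. c *\<^sub>R f x)"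

instance
  by standard (simp_all add: scaleR_fun_def plus_fun_def scaleR_add_right scaleR_add_left)

end

(* R^n for a variable n: coordinate functions on {..<n} in the library's extensional
   representation, i.e. the value is undefined at every index >= n.  This is the space of
   the product measure below and the carrier of the product topology powertop_real {..<n}.
   It is not a linear subspace of nat => real, but it is an affine one
   (u * undefined + v * undefined = undefined whenever u + v = 1), which is why convexity and
   convex hulls taken in nat => real are the usual ones of R^n. *)

definition Rn :: "nat \<Rightarrow> (nat \<Rightarrow> real) set" where
  "Rn n = {..<n} \<rightarrow>\<^sub>E UNIV"

lemma convex_Rn: "convex (Rn n)"
  by (auto simp: convex_def Rn_def PiE_iff extensional_def scaleR_fun_def plus_fun_def
      simp flip: distrib_right)

lemma convex_hull_subset_Rn: "X \<subseteq> Rn n \<Longrightarrow> convex hull X \<subseteq> Rn n"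
  by (simp add: convex_Rn hull_minimal)

definition lborel_Rn :: "nat \<Rightarrow> (nat \<Rightarrow> real) measure" where
  "lborel_Rn n = (\<Pi>\<^sub>M i\<in>{..<n}. lborel)"

definition inner_Rn :: "nat \<Rightarrow> (nat \<Rightarrow> real) \<Rightarrow> (nat \<Rightarrow> real) \<Rightarrow> real" where
  "inner_Rn n x y = (\<Sum>i<n. x i * y i)"

definition convex_body :: "nat \<Rightarrow> (nat \<Rightarrow> real) set \<Rightarrow> bool" where
  "convex_body n K \<longleftrightarrow>
     compactin (powertop_real {..<n}) K \<and> convex K \<and> (powertop_real {..<n}) interior_of K \<noteq> {}"

definition borel_prob_Rn :: "nat \<Rightarrow> (nat \<Rightarrow> real) measure \<Rightarrow> bool" where
  "borel_prob_Rn n \<mu> \<longleftrightarrow> prob_space \<mu> \<and> sets \<mu> = sets (\<Pi>\<^sub>M i\<in>{..<n}. borel)"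

definition uniform_on :: "nat \<Rightarrow> (nat \<Rightarrow> real) set \<Rightarrow> (nat \<Rightarrow> real) measure" where
  "uniform_on n K = uniform_measure (lborel_Rn n) K"

definition log_laplace :: "nat \<Rightarrow> (nat \<Rightarrow> real) measure \<Rightarrow> (nat \<Rightarrow> real) \<Rightarrow> ereal" where
  "log_laplace n \<mu> \<theta> =
     (if integrable \<mu> (\<lambda>x. exp (inner_Rn n \<theta> x))
      then ereal (ln (\<integral>x. exp (inner_Rn n \<theta> x) \<partial>\<mu>)) else \<infinity>)"

definition cramer :: "nat \<Rightarrow> (nat \<Rightarrow> real) measure \<Rightarrow> (nat \<Rightarrow> real) \<Rightarrow> ereal" where
  "cramer n \<mu> x = (SUP \<theta>\<in>Rn n. ereal (inner_Rn n \<theta> x) - log_laplace n \<mu> \<theta>)"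

(* The Cramer transform of a probability measure is nonnegative (take \<theta> = 0), so the truncation
   of negative values in e2ennreal is never active. *)
definition expect_cramer :: "nat \<Rightarrow> (nat \<Rightarrow> real) measure \<Rightarrow> ennreal" where
  "expect_cramer n \<mu> = (\<integral>\<^sup>+x. e2ennreal (cramer n \<mu> x) \<partial>\<mu>)"

definition expect_hull :: "(nat \<Rightarrow> real) measure \<Rightarrow> nat \<Rightarrow> real" where
  "expect_hull \<mu> N =
     (\<integral>X. measure \<mu> (convex hull (X ` {1..N})) \<partial>(\<Pi>\<^sub>M j\<in>{1..N}. \<mu>))"

(* Extended real values: the supremum is infinite for an unbounded set of r, and the infimum of
   the empty set is infinite. *)
definition rho1 :: "(nat \<Rightarrow> real) measure \<Rightarrow> real \<Rightarrow> ereal" where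
  "rho1 \<mu> \<delta> =
     Sup (ereal ` {r. r > 0 \<and> (\<forall>N::nat. 1 \<le> N \<and> real N \<le> exp r \<longrightarrow> expect_hull \<mu> N \<le> \<delta>)})"

definition rho2 :: "(nat \<Rightarrow> real) measure \<Rightarrow> real \<Rightarrow> ereal" where
  "rho2 \<mu> \<delta> =
     Inf (ereal ` {r. r > 0 \<and> (\<forall>N::nat. 1 \<le> N \<and> real N \<ge> exp r \<longrightarrow> expect_hull \<mu> N \<ge> 1 - \<delta>)})"

(* Sequences are indexed by n >= 1; the entries at n = 0 are irrelevant. *)
definition sharp_threshold :: "(nat \<Rightarrow> (nat \<Rightarrow> real) measure) \<Rightarrow> (nat \<Rightarrow> real) \<Rightarrow> bool" where
  "sharp_threshold \<mu> T \<longleftrightarrow>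
     (\<forall>n\<ge>1. borel_prob_Rn n (\<mu> n)) \<and> (\<forall>n\<ge>1. T n > 0) \<and>
     (\<exists>\<delta>::nat \<Rightarrow> real. (\<forall>n\<ge>1. \<delta> n > 0) \<and> \<delta> \<longlonglongrightarrow> 0 \<and>
        (\<forall>\<epsilon>. 0 < \<epsilon> \<and> \<epsilon> < 1 \<longrightarrow>
          (\<exists>n0. \<forall>n\<ge>n0. rho1 (\<mu> n) (\<delta> n) \<ge> ereal ((1 - \<epsilon>) * T n) \<and>
                       rho2 (\<mu> n) (\<delta> n) \<le> ereal ((1 + \<epsilon>) * T n))))"

end

theory Submission
  imports Defs
begin

text \<open>
  Write \<open>L\<close> for the Cramer transform of the uniform measure \<open>\<mu>\<close> on a convex body \<open>K\<close> in dimension \<open>n\<close>,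
  \<open>T\<close> for its mean, \<open>V c\<close> for the probability that \<open>L\<close> is at most \<open>c\<close>, and \<open>a = T / n\<close>, which tends to
  infinity.  The theorem holds because \<open>L\<close> fluctuates on the scale \<open>n\<close> only, which is negligible
  against \<open>T\<close>, and because a point \<open>x\<close> starts to be captured by the random polytope when the number of
  sample points passes \<open>exp (L x)\<close>, up to factors that are negligible in the exponent.

  \<^emph>\<open>Concentration.\<close>  Contracting \<open>K\<close> by the factor \<open>s\<close> towards one of its points \<open>z\<close> maps \<open>K\<close> into itself
  and costs a factor \<open>s ^ n\<close> of volume; hence \<open>L (s x + (1 - s) z) \<le> L x + n ln (1 / s)\<close>
  (\<open>level_mix\<close>).  So the sublevel set at height \<open>c + n ln (1 / s)\<close> contains the Minkowski combination of the
  sublevel set at height \<open>c\<close> and of \<open>K\<close>, and the multiplicative Brunn--Minkowski inequality gives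
  \<open>V c powr s \<le> V (c + n ln (1 / s))\<close> (\<open>V_powr\<close>).  The right tail of \<open>L\<close> therefore decays like
  \<open>exp (- r / n)\<close> beyond any height that is reached with positive probability (\<open>V_tail\<close>).  Integrating
  this tail bounds the mean and, read backwards, forces \<open>V\<close> to be exponentially small below \<open>T\<close>
  (\<open>V_lower_tail\<close>); Markov's inequality together with the tail shows that \<open>V\<close> is close to 1 above \<open>T\<close>.

  \<^emph>\<open>Too few points.\<close>  If \<open>x\<close> is in the hull of the sample, every half-space that contains \<open>x\<close> contains a
  sample point, so Chernoff's inequality bounds the probability by \<open>N exp (- L x)\<close>
  (\<open>prob_in_hull_le\<close>, \<open>expect_hull_le\<close>).

  \<^emph>\<open>Enough points.\<close>  Conversely, half-space masses are log-concave along every direction, again by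
  Brunn--Minkowski.  A tangent to the logarithm of the tail bounds exponential moments, and this reverses
  Chernoff's inequality up to a factor \<open>1 - \<eta>\<close> in the exponent: every half-space that contains \<open>x\<close> has mass
  at least \<open>p = exp (- (L x - ln \<eta>) / (1 - \<eta>))\<close> (\<open>tail_at_level\<close>).  If \<open>x\<close> is missed by the hull, its
  nearest point in the hull lies, by Caratheodory, in the hull of at most \<open>n + 1\<close> sample points, and these
  alone determine a half-space around \<open>x\<close> that all other sample points avoid.  Hence \<open>x\<close> is missed with
  probability at most \<open>N ^ (n + 1) * (1 - p) ^ (N - n - 1)\<close> (\<open>prob_not_in_hull_le\<close>), which is tiny once
  \<open>N p\<close> is exponentially large.

  All error terms are exponentially small in \<open>a\<close>, so \<open>\<delta> = 1 / a\<close> serves for every \<open>\<epsilon>\<close> at once.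
\<close>

section \<open>The Prekopa--Leindler inequality on the real line\<close>

lemma nn_integral_layer_cake:
  assumes [measurable]: "f \<in> borel_measurable M" and "sigma_finite_measure M"
  shows "(\<integral>\<^sup>+x. f x \<partial>M) =
         (\<integral>\<^sup>+r. emeasure M {x\<in>space M. ennreal r < f x} * indicator {0..} r \<partial>lborel)"
proof -
  interpret M: sigma_finite_measure M by fact
  interpret pair_sigma_finite M lborel ..
  have eq: "f x = (\<integral>\<^sup>+r. indicator {r. 0 \<le> r \<and> ennreal r < f x} r \<partial>lborel)" for x
  proof (cases "f x")
    case (real a)
    then have "{r. 0 \<le> r \<and> ennreal r < f x} = {0..<a}" by (auto simp: ennreal_less_iff)
    then show ?thesis using real by simp
  next
    case top
    then have "{r. 0 \<le> r \<and> ennreal r < f x} = {0..}" by auto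
    moreover have "emeasure lborel {0::real..} = \<top>"
    proof (rule ccontr)
      assume "emeasure lborel {0::real..} \<noteq> \<top>"
      then obtain a where a: "emeasure lborel {0::real..} = ennreal a" "0 \<le> a"
        by (cases "emeasure lborel {0::real..}") auto
      have "emeasure lborel {0..a + 1} \<le> emeasure lborel {0::real..}"
        by (intro emeasure_mono) auto
      then show False using a by simp
    qed
    ultimately show ?thesis using top by simp
  qed
  have "(\<integral>\<^sup>+x. f x \<partial>M) =
      (\<integral>\<^sup>+x. \<integral>\<^sup>+r. indicator {r. 0 \<le> r \<and> ennreal r < f x} r \<partial>lborel \<partial>M)"
    using eq by simp
  also have "\<dots> = (\<integral>\<^sup>+r. \<integral>\<^sup>+x. indicator {r. 0 \<le> r \<and> ennreal r < f x} r \<partial>M \<partial>lborel)"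
    by (rule Fubini'[symmetric]) (simp add: indicator_def)
  also have "\<dots> = (\<integral>\<^sup>+r. emeasure M {x\<in>space M. ennreal r < f x} * indicator {0..} r \<partial>lborel)"
  proof (rule nn_integral_cong)
    fix r :: real
    have "(\<integral>\<^sup>+x. indicator {r. 0 \<le> r \<and> ennreal r < f x} r \<partial>M) =
        (\<integral>\<^sup>+x. indicator {x\<in>space M. ennreal r < f x} x * indicator {0..} r \<partial>M)"
      by (rule nn_integral_cong) (auto simp: indicator_def)
    also have "\<dots> = emeasure M {x\<in>space M. ennreal r < f x} * indicator {0..} r"
      by (subst nn_integral_multc) auto
    finally show "(\<integral>\<^sup>+x. indicator {r. 0 \<le> r \<and> ennreal r < f x} r \<partial>M) = \<dots>" .
  qed
  finally show ?thesis .
qed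

lemma nn_integral_layer_cake_real:
  fixes f :: "'a \<Rightarrow> real"
  assumes [measurable]: "f \<in> borel_measurable M" and "sigma_finite_measure M"
  shows "(\<integral>\<^sup>+x. ennreal (f x) \<partial>M) =
         (\<integral>\<^sup>+r. emeasure M {x\<in>space M. r < f x} * indicator {0..} r \<partial>lborel)"
  using nn_integral_layer_cake[OF _ assms(2), of "\<lambda>x. ennreal (f x)"]
  by (auto simp: ennreal_less_iff indicator_def intro!: nn_integral_cong)

lemma emeasure_lborel_affine_image:
  fixes A :: "real set"
  assumes A[measurable]: "A \<in> sets borel" and s: "s > 0"
  shows "(\<lambda>x. s * x + t) ` A \<in> sets borel" 
    and "emeasure lborel ((\<lambda>x. s * x + t) ` A) = ennreal s * emeasure lborel A"
proof -
  have im: "(\<lambda>x. s * x + t) ` A = (\<lambda>y. (y - t) / s) -` A"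
    using s by (auto simp: image_iff field_simps intro!: bexI[where x="(_ - t) / s"])
  show m[measurable]: "(\<lambda>x. s * x + t) ` A \<in> sets borel"
    unfolding im by (rule measurable_sets_borel[OF _ A]) measurable
  have "emeasure lborel ((\<lambda>x. s * x + t) ` A) = (\<integral>\<^sup>+x. indicator ((\<lambda>x. s * x + t) ` A) x \<partial>lborel)"
    by simp
  also have "\<dots> = ennreal \<bar>s\<bar> * (\<integral>\<^sup>+x. indicator ((\<lambda>x. s * x + t) ` A) (t + s * x) \<partial>lborel)"
    using s by (subst nn_integral_real_affine[where c=s and t=t]) auto
  also have "(\<integral>\<^sup>+x. indicator ((\<lambda>x. s * x + t) ` A) (t + s * x) \<partial>lborel) = (\<integral>\<^sup>+x. indicator A x \<partial>lborel)"
    using s by (intro nn_integral_cong) (auto simp: indicator_def)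
  finally show "emeasure lborel ((\<lambda>x. s * x + t) ` A) = ennreal s * emeasure lborel A"
    using s by simp
qed

text \<open>
  Two sets fit into \<open>C\<close>: \<open>s A\<close>, translated with the help of an almost smallest element of \<open>B\<close>, and
  \<open>(1 - s) B\<close>, translated with the help of an almost largest element of \<open>A\<close>.  They overlap in a set of length
  at most \<open>e\<close>.  Allowing the error \<open>e\<close> avoids any approximation by compact sets.
\<close>

lemma brunn_minkowski_real:
  fixes A B C :: "real set"
  assumes [measurable]: "A \<in> sets borel" "B \<in> sets borel" "C \<in> sets borel"
    and s: "0 < s" "s < 1"
    and ne: "A \<noteq> {}" "B \<noteq> {}" and bd: "bounded A" "bounded B"
    and sub: "\<And>a b. a \<in> A \<Longrightarrow> b \<in> B \<Longrightarrow> s * a + (1 - s) * b \<in> C"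
  shows "ennreal s * emeasure lborel A + ennreal (1 - s) * emeasure lborel B \<le> emeasure lborel C"
proof (rule ennreal_le_epsilon)
  fix e :: real assume e: "0 < e"
  have bA: "bdd_above A" and bB: "bdd_below B"
    using bd by (auto intro: bounded_imp_bdd_above bounded_imp_bdd_below)
  obtain a where a: "a \<in> A" "Sup A - e < a"
    using less_cSup_iff[OF ne(1) bA, of "Sup A - e"] e by auto
  obtain b where b: "b \<in> B" "b < Inf B + e"
    using cInf_less_iff[OF ne(2) bB, of "Inf B + e"] e by auto
  let ?A = "(\<lambda>x. s * x + (1 - s) * b) ` A"
  let ?B = "(\<lambda>y. (1 - s) * y + s * a) ` B"
  let ?I = "{s * a + (1 - s) * Inf B .. s * Sup A + (1 - s) * b}"
  have mA[measurable]: "?A \<in> sets borel" and mB[measurable]: "?B \<in> sets borel"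
    using s by (auto intro!: emeasure_lborel_affine_image)
  have AB: "?A \<union> ?B \<subseteq> C"
    using sub a b by (auto simp: add.commute)
  have le: "x \<le> s * Sup A + (1 - s) * b" if "x \<in> ?A" for x
    using that s cSup_upper[OF _ bA] by (auto intro!: mult_left_mono)
  have ge: "s * a + (1 - s) * Inf B \<le> x" if "x \<in> ?B" for x
    using that s cInf_lower[OF _ bB] by (auto intro!: mult_left_mono)
  have int: "?A \<inter> ?B \<subseteq> ?I"
  proof
    fix x assume "x \<in> ?A \<inter> ?B"
    then show "x \<in> ?I" using le[of x] ge[of x] by simp
  qed
  have len: "s * Sup A + (1 - s) * b - (s * a + (1 - s) * Inf B) \<le> e"
  proof -
    have "s * (Sup A - a) \<le> s * e" "(1 - s) * (b - Inf B) \<le> (1 - s) * e"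
      using a b s by (auto intro!: mult_left_mono)
    then show ?thesis by (simp add: algebra_simps)
  qed
  have "emeasure lborel (?A \<inter> ?B) \<le> emeasure lborel ?I"
    using int by (intro emeasure_mono) auto
  also have "\<dots> \<le> ennreal e"
    using len by (cases "s * a + (1 - s) * Inf B \<le> s * Sup A + (1 - s) * b") (auto intro: ennreal_leI)
  finally have small: "emeasure lborel (?A \<inter> ?B) \<le> ennreal e" .
  have "ennreal s * emeasure lborel A + ennreal (1 - s) * emeasure lborel B
      = emeasure lborel ?A + emeasure lborel ?B"
    using s by (simp add: emeasure_lborel_affine_image)
  also have "\<dots> = emeasure lborel (?A \<union> ?B) + emeasure lborel (?A \<inter> ?B)"
    by (rule emeasure_Un_Int) auto
  also have "\<dots> \<le> emeasure lborel C + ennreal e"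
    using AB small by (intro add_mono emeasure_mono) auto
  finally show "ennreal s * emeasure lborel A + ennreal (1 - s) * emeasure lborel B
     \<le> emeasure lborel C + ennreal e" .
qed

lemma weighted_am_gm:
  fixes a b :: real
  assumes "0 \<le> a" "0 \<le> b" "0 < s" "s < 1"
  shows "a powr s * b powr (1 - s) \<le> s * a + (1 - s) * b"
  using Youngs_inequality_0[of s "1-s" a b] assms by (cases "a = 0 \<or> b = 0") auto

text \<open>
  With both suprema equal to 1, the superlevel sets at every height \<open>r < 1\<close> are nonempty, so the
  one-dimensional Brunn--Minkowski inequality applies to each of them and can be integrated over \<open>r\<close>.
  This gives the arithmetic mean on the left.
\<close>

lemma prekopa_leindler_real_normalized:
  fixes F G :: "real \<Rightarrow> real" and H :: "real \<Rightarrow> ennreal"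
  assumes [measurable]: "F \<in> borel_measurable borel" "G \<in> borel_measurable borel" "H \<in> borel_measurable borel"
    and s: "0 < s" "s < 1"
    and F: "\<And>x. 0 \<le> F x" "\<And>x. F x \<le> 1" "\<And>x. F x \<noteq> 0 \<Longrightarrow> \<bar>x\<bar> \<le> R" "\<And>r. r < 1 \<Longrightarrow> \<exists>x. r < F x"
    and G: "\<And>x. 0 \<le> G x" "\<And>x. G x \<le> 1" "\<And>x. G x \<noteq> 0 \<Longrightarrow> \<bar>x\<bar> \<le> R" "\<And>r. r < 1 \<Longrightarrow> \<exists>x. r < G x"
    and H: "\<And>x y. ennreal (F x powr s * G y powr (1 - s)) \<le> H (s * x + (1 - s) * y)"
  shows "ennreal s * (\<integral>\<^sup>+x. F x \<partial>lborel) + ennreal (1 - s) * (\<integral>\<^sup>+x. G x \<partial>lborel) \<le> (\<integral>\<^sup>+x. H x \<partial>lborel)"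
proof -
  \<comment> \<open>Only heights below 1 matter, so \<open>H\<close> may be cut off there and becomes real-valued.\<close>
  define h where "h x = enn2real (min 1 (H x))" for x
  have [measurable]: "h \<in> borel_measurable borel" unfolding h_def by measurable
  have hH: "ennreal (h x) \<le> H x" for x
  proof -
    have "min 1 (H x) < top" by (simp add: min_less_iff_disj)
    then have "ennreal (h x) = min 1 (H x)" unfolding h_def by simp
    then show ?thesis by simp
  qed
  have hr: "r < h x" if "0 \<le> r" "r < 1" "ennreal r < H x" for r x
  proof -
    have "ennreal r < min 1 (H x)" using that by (simp add: ennreal_less_one_iff)
    moreover have "min 1 (H x) < top" by (simp add: min_less_iff_disj)
    ultimately have "ennreal r < ennreal (h x)" unfolding h_def by simp
    then show ?thesis using that(1) by (simp add: ennreal_less_iff)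
  qed
  have sf: "sigma_finite_measure (lborel :: real measure)" by unfold_locales
  let ?m = "\<lambda>f r. emeasure lborel {x. r < f x}"
  have lvl: "ennreal s * (?m F r * indicator {0..} r) + ennreal (1 - s) * (?m G r * indicator {0..} r)
      \<le> ?m h r * indicator {0..} r" for r
  proof (cases "0 \<le> r \<and> r < 1")
    case True
    have "ennreal s * ?m F r + ennreal (1 - s) * ?m G r \<le> ?m h r"
    proof (rule brunn_minkowski_real[OF _ _ _ s])
      show "{x. r < F x} \<noteq> {}" "{x. r < G x} \<noteq> {}" using True F(4) G(4) by auto
      have "{x. r < F x} \<subseteq> {-R..R}"
      proof
        fix x assume "x \<in> {x. r < F x}"
        then have "\<bar>x\<bar> \<le> R" using True by (intro F(3)) auto
        then show "x \<in> {-R..R}" by auto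
      qed
      then show "bounded {x. r < F x}" by (rule bounded_subset[OF bounded_closed_interval])
      have "{x. r < G x} \<subseteq> {-R..R}"
      proof
        fix x assume "x \<in> {x. r < G x}"
        then have "\<bar>x\<bar> \<le> R" using True by (intro G(3)) auto
        then show "x \<in> {-R..R}" by auto
      qed
      then show "bounded {x. r < G x}" by (rule bounded_subset[OF bounded_closed_interval])
    next
      fix a b assume a: "a \<in> {x. r < F x}" and b: "b \<in> {x. r < G x}"
      have "r = r powr s * r powr (1 - s)" using True by (simp flip: powr_add)
      also have "\<dots> < F a powr s * G b powr (1 - s)"
      proof (rule mult_strict_mono)
        show "r powr s < F a powr s" "r powr (1 - s) < G b powr (1 - s)"
          using a b True s by (auto intro: powr_less_mono2)
        then show "0 < F a powr s"
          by (meson le_less_trans powr_ge_zero)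
      qed simp
      finally have "ennreal r < H (s * a + (1 - s) * b)"
        using True by (intro less_le_trans[OF _ H[of a b]]) (auto simp: ennreal_less_iff)
      then show "s * a + (1 - s) * b \<in> {x. r < h x}" using hr True by auto
    qed auto
    then show ?thesis using True by simp
  next
    case False
    then show ?thesis
    proof (cases "0 \<le> r")
      case True
      then have "1 \<le> r" using False by auto
      then have "{x. r < F x} = {}" "{x. r < G x} = {}" using F(2) G(2) by (auto simp: not_less intro: order_trans)
      then show ?thesis by simp
    qed simp
  qed
  have lcF: "(\<integral>\<^sup>+x. F x \<partial>lborel) = (\<integral>\<^sup>+r. ?m F r * indicator {0..} r \<partial>lborel)"
    and lcG: "(\<integral>\<^sup>+x. G x \<partial>lborel) = (\<integral>\<^sup>+r. ?m G r * indicator {0..} r \<partial>lborel)"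
    and lch: "(\<integral>\<^sup>+x. h x \<partial>lborel) = (\<integral>\<^sup>+r. ?m h r * indicator {0..} r \<partial>lborel)"
    using nn_integral_layer_cake_real[OF _ sf, of F] nn_integral_layer_cake_real[OF _ sf, of G]
      nn_integral_layer_cake_real[OF _ sf, of h] by simp_all
  have "ennreal s * (\<integral>\<^sup>+x. F x \<partial>lborel) + ennreal (1 - s) * (\<integral>\<^sup>+x. G x \<partial>lborel) =
     (\<integral>\<^sup>+r. ennreal s * (?m F r * indicator {0..} r) + ennreal (1 - s) * (?m G r * indicator {0..} r) \<partial>lborel)"
    by (simp add: nn_integral_add nn_integral_cmult lcF lcG)
  also have "\<dots> \<le> (\<integral>\<^sup>+r. ?m h r * indicator {0..} r \<partial>lborel)"
    by (intro nn_integral_mono lvl)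
  also have "\<dots> = (\<integral>\<^sup>+x. ennreal (h x) \<partial>lborel)"
    using lch by simp
  also have "\<dots> \<le> (\<integral>\<^sup>+x. H x \<partial>lborel)" by (intro nn_integral_mono hH)
  finally show ?thesis .
qed

text \<open>
  Dividing by the suprema reduces this to the normalized form; the arithmetic mean obtained there
  dominates the geometric mean, and the geometric mean is compatible with undoing the normalization.
\<close>

lemma prekopa_leindler_real:
  fixes F G :: "real \<Rightarrow> real" and H :: "real \<Rightarrow> ennreal"
  assumes [measurable]: "F \<in> borel_measurable borel" "G \<in> borel_measurable borel" "H \<in> borel_measurable borel"
    and s: "0 < s" "s < 1"
    and F: "\<And>x. 0 \<le> F x" "\<And>x. F x \<le> D" "\<And>x. F x \<noteq> 0 \<Longrightarrow> \<bar>x\<bar> \<le> R"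
    and G: "\<And>x. 0 \<le> G x" "\<And>x. G x \<le> D" "\<And>x. G x \<noteq> 0 \<Longrightarrow> \<bar>x\<bar> \<le> R"
    and H: "\<And>x y. ennreal (F x powr s * G y powr (1 - s)) \<le> H (s * x + (1 - s) * y)"
    and i: "(\<integral>\<^sup>+x. F x \<partial>lborel) = ennreal i" "0 \<le> i" and j: "(\<integral>\<^sup>+x. G x \<partial>lborel) = ennreal j" "0 \<le> j"
  shows "ennreal (i powr s * j powr (1 - s)) \<le> (\<integral>\<^sup>+x. H x \<partial>lborel)"
proof (cases "i = 0 \<or> j = 0")
  case False
  define a where "a = Sup (range F)"
  define b where "b = Sup (range G)"
  have bF: "bdd_above (range F)" "bdd_above (range G)" using F(2) G(2) by (auto intro!: bdd_aboveI)
  have "\<exists>x. F x \<noteq> 0" using False i by (intro ccontr[of "\<exists>x. F x \<noteq> 0"]) auto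
  then obtain x where "0 < F x" using F(1) by (metis less_eq_real_def)
  then have a: "0 < a" unfolding a_def using cSUP_upper[OF UNIV_I bF(1), of x] by simp
  have "\<exists>x. G x \<noteq> 0" using False j by (intro ccontr[of "\<exists>x. G x \<noteq> 0"]) auto
  then obtain x where "0 < G x" using G(1) by (metis less_eq_real_def)
  then have b: "0 < b" unfolding b_def using cSUP_upper[OF UNIV_I bF(2), of x] by simp
  define c where "c = a powr s * b powr (1 - s)"
  have c: "0 < c" using a b by (simp add: c_def)
  have "ennreal s * (\<integral>\<^sup>+x. ennreal (F x / a) \<partial>lborel) + ennreal (1 - s) * (\<integral>\<^sup>+x. ennreal (G x / b) \<partial>lborel)
     \<le> (\<integral>\<^sup>+x. ennreal (1 / c) * H x \<partial>lborel)"
  proof (rule prekopa_leindler_real_normalized[OF _ _ _ s])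
    show "0 \<le> F x / a" "F x / a \<le> 1" "0 \<le> G x / b" "G x / b \<le> 1" for x
      using F G a b cSUP_upper[OF UNIV_I bF(1), of x] cSUP_upper[OF UNIV_I bF(2), of x]
      by (auto simp: a_def b_def)
    show "\<exists>x. r < F x / a" if "r < 1" for r
      using less_cSup_iff[OF _ bF(1), of "r * a"] that a by (auto simp: field_simps simp flip: a_def)
    show "\<exists>x. r < G x / b" if "r < 1" for r
      using less_cSup_iff[OF _ bF(2), of "r * b"] that b by (auto simp: field_simps simp flip: b_def)
    show "\<bar>x\<bar> \<le> R" if "F x / a \<noteq> 0" for x using that F by auto
    show "\<bar>x\<bar> \<le> R" if "G x / b \<noteq> 0" for x using that G by auto
    show "ennreal ((F x / a) powr s * (G y / b) powr (1 - s)) \<le> ennreal (1 / c) * H (s * x + (1 - s) * y)" for x y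
    proof -
      have "(F x / a) powr s * (G y / b) powr (1 - s) = (1 / c) * (F x powr s * G y powr (1 - s))"
        using F G a b by (simp add: powr_divide c_def)
      then have "ennreal ((F x / a) powr s * (G y / b) powr (1 - s)) =
          ennreal (1 / c) * ennreal (F x powr s * G y powr (1 - s))"
        using c by (simp only: ennreal_mult'[of "1 / c"] less_imp_le divide_nonneg_pos zero_le_one)
      then show ?thesis using H[of x y] by (simp add: mult_left_mono)
    qed
  qed auto
  also have "(\<integral>\<^sup>+x. ennreal (F x / a) \<partial>lborel) = ennreal (i / a)"
    using a F i by (simp add: divide_ennreal[symmetric] nn_integral_divide)
  also have "(\<integral>\<^sup>+x. ennreal (G x / b) \<partial>lborel) = ennreal (j / b)"
    using b G j by (simp add: divide_ennreal[symmetric] nn_integral_divide)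
  also have "(\<integral>\<^sup>+x. ennreal (1 / c) * H x \<partial>lborel) = ennreal (1 / c) * (\<integral>\<^sup>+x. H x \<partial>lborel)"
    by (rule nn_integral_cmult) auto
  also have "ennreal s * ennreal (i / a) + ennreal (1 - s) * ennreal (j / b) =
      ennreal (s * (i / a) + (1 - s) * (j / b))"
    using s i j a b by (simp add: ennreal_plus flip: ennreal_mult')
  finally have *: "ennreal (s * (i / a) + (1 - s) * (j / b)) \<le> ennreal (1 / c) * (\<integral>\<^sup>+x. H x \<partial>lborel)" .
  have "ennreal ((i / a) powr s * (j / b) powr (1 - s)) \<le> ennreal (1 / c) * (\<integral>\<^sup>+x. H x \<partial>lborel)"
    using weighted_am_gm[of "i/a" "j/b" s] i j a b s by (intro order_trans[OF _ *] ennreal_leI) auto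
  then have "ennreal c * ennreal ((i / a) powr s * (j / b) powr (1 - s)) \<le> ennreal c * (ennreal (1 / c) * (\<integral>\<^sup>+x. H x \<partial>lborel))"
    by (rule mult_left_mono) auto
  also have "ennreal c * (ennreal (1 / c) * (\<integral>\<^sup>+x. H x \<partial>lborel)) = (\<integral>\<^sup>+x. H x \<partial>lborel)"
    using c by (simp add: mult.assoc[symmetric] flip: ennreal_mult)
  also have "ennreal c * ennreal ((i / a) powr s * (j / b) powr (1 - s)) =
      ennreal (c * ((i / a) powr s * (j / b) powr (1 - s)))"
    using c by (intro ennreal_mult'[symmetric]) simp
  also have "c * ((i / a) powr s * (j / b) powr (1 - s)) = i powr s * j powr (1 - s)"
    using a b i j by (simp add: powr_divide c_def)
  finally show ?thesis .
qed auto

section \<open>The multiplicative Brunn--Minkowski inequality\<close>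

abbreviation lborelPi :: "'i set \<Rightarrow> ('i \<Rightarrow> real) measure" where
  "lborelPi I \<equiv> (\<Pi>\<^sub>M i\<in>I. lborel)"

lemma sets_section_PiM:
  assumes "A \<in> sets (lborelPi (insert i I))"
  shows "{x \<in> space (lborelPi I). x(i := t) \<in> A} \<in> sets (lborelPi I)"
proof -
  have "(\<lambda>x. x(i := t)) \<in> measurable (lborelPi I) (lborelPi (insert i I))"
    by (rule measurable_fun_upd[where J=I]) auto
  from measurable_sets[OF this assms] show ?thesis
    by (simp add: vimage_def Int_def conj_commute)
qed

lemma emeasure_PiM_insert_section:
  assumes I: "finite I" "i \<notin> I" and A[measurable]: "A \<in> sets (lborelPi (insert i I))"
  shows "emeasure (lborelPi (insert i I)) A =
      (\<integral>\<^sup>+t. emeasure (lborelPi I) {x \<in> space (lborelPi I). x(i := t) \<in> A} \<partial>lborel)"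
    and "(\<lambda>t. emeasure (lborelPi I) {x \<in> space (lborelPi I). x(i := t) \<in> A}) \<in> borel_measurable borel"
proof -
  interpret product_sigma_finite "\<lambda>i. lborel :: real measure" by unfold_locales
  interpret I: finite_product_sigma_finite "\<lambda>i. lborel :: real measure" I by unfold_locales fact
  have [measurable]: "(\<lambda>(t, x). x(i := t)) \<in> measurable (lborel \<Otimes>\<^sub>M lborelPi I) (lborelPi (insert i I))"
    unfolding case_prod_beta by (rule measurable_fun_upd[where J=I]) auto
  have eq: "(\<integral>\<^sup>+x. indicator A (x(i := t)) \<partial>lborelPi I) =
      emeasure (lborelPi I) {x \<in> space (lborelPi I). x(i := t) \<in> A}" for t
    using sets_section_PiM[OF A, of t]
    by (subst nn_integral_indicator[symmetric], assumption)
      (auto intro!: nn_integral_cong simp: indicator_def simp del: nn_integral_indicator)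
  have "emeasure (lborelPi (insert i I)) A = (\<integral>\<^sup>+x. indicator A x \<partial>lborelPi (insert i I))" by simp
  also have "\<dots> = (\<integral>\<^sup>+t. \<integral>\<^sup>+x. indicator A (x(i := t)) \<partial>lborelPi I \<partial>lborel)"
    by (rule product_nn_integral_insert_rev[OF I]) simp
  finally show "emeasure (lborelPi (insert i I)) A =
      (\<integral>\<^sup>+t. emeasure (lborelPi I) {x \<in> space (lborelPi I). x(i := t) \<in> A} \<partial>lborel)"
    by (simp only: eq)
  have "(\<lambda>t. \<integral>\<^sup>+x. indicator A ((\<lambda>(t, x). x(i := t)) (t, x)) \<partial>lborelPi I) \<in> borel_measurable lborel"
    by (rule I.borel_measurable_nn_integral) measurable
  then show "(\<lambda>t. emeasure (lborelPi I) {x \<in> space (lborelPi I). x(i := t) \<in> A}) \<in> borel_measurable borel"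
    by (simp add: eq)
qed

lemma emeasure_PiM_cube:
  assumes "finite I"
  shows "emeasure (lborelPi I) (PiE I (\<lambda>_. {-R..R})) = ennreal ((max 0 (2 * R)) ^ card I)"
proof -
  interpret product_sigma_finite "\<lambda>i. lborel :: real measure" by unfold_locales
  have eq: "emeasure lborel {-R..R} = ennreal (max 0 (2 * R))"
    by (cases "0 \<le> R") auto
  show ?thesis
    using assms by (subst emeasure_PiM) (auto simp del: emeasure_lborel_Icc_eq simp: eq prod_constant simp flip: ennreal_power)
qed

text \<open>
  Induction on the index set: the volumes of the sections of \<open>A\<close>, \<open>B\<close> and \<open>C\<close> over one coordinate satisfy
  the hypothesis of the one-dimensional Prekopa--Leindler inequality by the induction hypothesis, and
  integrating them gives the volumes of the sets.  The cube keeps all section volumes bounded.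
\<close>

lemma brunn_minkowski_PiM:
  fixes A B C :: "('i \<Rightarrow> real) set"
  assumes "finite I" and "A \<in> sets (lborelPi I)" "B \<in> sets (lborelPi I)" "C \<in> sets (lborelPi I)"
    and s: "0 < s" "s < 1"
    and "A \<subseteq> PiE I (\<lambda>_. {-R..R})" "B \<subseteq> PiE I (\<lambda>_. {-R..R})"
    and "\<And>a b. a \<in> A \<Longrightarrow> b \<in> B \<Longrightarrow> (\<lambda>i\<in>I. s * a i + (1 - s) * b i) \<in> C"
  shows "ennreal (measure (lborelPi I) A powr s * measure (lborelPi I) B powr (1 - s)) \<le> emeasure (lborelPi I) C"
  using assms(1-4,7-)
proof (induction I arbitrary: A B C rule: finite_induct)
  case empty
  have sp: "space (lborelPi {}) = {\<lambda>_. undefined}" by (simp add: space_PiM)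
  show ?case
  proof (cases "A = {} \<or> B = {}")
    case False
    then have "A = {\<lambda>_. undefined}" "B = {\<lambda>_. undefined}"
      using sets.sets_into_space[OF empty(1)] sets.sets_into_space[OF empty(2)] sp by auto
    moreover from this have "(\<lambda>_. undefined) \<in> C" using empty(6) by (auto simp: restrict_def)
    then have "C = {\<lambda>_. undefined}" using sets.sets_into_space[OF empty(3)] sp by auto
    moreover have "emeasure (lborelPi {}) {\<lambda>_::'i. undefined::real} = 1"
      by (simp add: PiM_empty)
    ultimately show ?thesis by (simp add: measure_def)
  qed auto
next
  case (insert i I)
  let ?M = "lborelPi I"
  let ?c = "PiE I (\<lambda>_. {-R..R})"
  define sec where "sec A t = {x \<in> space ?M. x(i := t) \<in> A}" for A t
  define D where "D = (max 0 (2 * R)) ^ card I"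
  have cube: "emeasure ?M ?c = ennreal D" "?c \<in> sets ?M"
    using insert(1) emeasure_PiM_cube[OF insert(1), of R] unfolding D_def by (auto intro!: sets_PiM_I_finite)
  have secs: "sec X t \<in> sets ?M" if "X \<in> sets (lborelPi (insert i I))" for X t
    unfolding sec_def by (rule sets_section_PiM[OF that])
  have sub: "sec X t \<subseteq> ?c" and supp: "sec X t \<noteq> {} \<Longrightarrow> \<bar>t\<bar> \<le> R"
    if X: "X \<subseteq> PiE (insert i I) (\<lambda>_. {-R..R})" for X t
  proof -
    show "sec X t \<subseteq> ?c"
    proof
      fix x assume x: "x \<in> sec X t"
      then have "x(i := t) \<in> PiE (insert i I) (\<lambda>_. {-R..R})" "x \<in> extensional I"
        using X by (auto simp: sec_def space_PiM PiE_def)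
      then show "x \<in> ?c" using insert(2) by (auto simp: PiE_iff split: if_splits)
    qed
    show "\<bar>t\<bar> \<le> R" if ne: "sec X t \<noteq> {}"
    proof -
      obtain x where "x(i := t) \<in> PiE (insert i I) (\<lambda>_. {-R..R})"
        using ne X unfolding sec_def by fast
      then have "(x(i := t)) i \<in> {-R..R}" by (rule PiE_mem) simp
      then show ?thesis by auto
    qed
  qed
  have em: "emeasure ?M (sec X t) = ennreal (measure ?M (sec X t))" and md: "measure ?M (sec X t) \<le> D"
    if "X \<subseteq> PiE (insert i I) (\<lambda>_. {-R..R})" for X t
  proof -
    have le: "emeasure ?M (sec X t) \<le> ennreal D"
      using emeasure_mono[OF sub[OF that] cube(2)] cube(1) by simp
    then show e: "emeasure ?M (sec X t) = ennreal (measure ?M (sec X t))"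
      by (intro emeasure_eq_ennreal_measure) (auto simp: top_unique)
    show "measure ?M (sec X t) \<le> D" using le unfolding e by (simp add: D_def)
  qed
  have emA: "emeasure (lborelPi (insert i I)) X = (\<integral>\<^sup>+t. ennreal (measure ?M (sec X t)) \<partial>lborel)"
    and finA: "emeasure (lborelPi (insert i I)) X = ennreal (measure (lborelPi (insert i I)) X)"
    and mA: "(\<lambda>t. measure ?M (sec X t)) \<in> borel_measurable borel"
    if X: "X \<in> sets (lborelPi (insert i I))" "X \<subseteq> PiE (insert i I) (\<lambda>_. {-R..R})" for X
  proof -
    show "emeasure (lborelPi (insert i I)) X = (\<integral>\<^sup>+t. ennreal (measure ?M (sec X t)) \<partial>lborel)"
      using emeasure_PiM_insert_section(1)[OF insert(1,2) X(1)] em[OF X(2)] by (simp add: sec_def)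
    have "emeasure (lborelPi (insert i I)) X \<le> emeasure (lborelPi (insert i I)) (PiE (insert i I) (\<lambda>_. {-R..R}))"
      using insert(1) by (intro emeasure_mono X sets_PiM_I_finite) auto
    also have "\<dots> < \<infinity>" using insert(1) by (subst emeasure_PiM_cube) auto
    finally show "emeasure (lborelPi (insert i I)) X = ennreal (measure (lborelPi (insert i I)) X)"
      by (intro emeasure_eq_ennreal_measure) auto
    show "(\<lambda>t. measure ?M (sec X t)) \<in> borel_measurable borel"
      using emeasure_PiM_insert_section(2)[OF insert(1,2) X(1)] unfolding measure_def sec_def
      by measurable
  qed
  note A = insert.prems(1) insert.prems(4) and B = insert.prems(2) insert.prems(5)
  have "ennreal (measure (lborelPi (insert i I)) A powr s * measure (lborelPi (insert i I)) B powr (1 - s)) \<le>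
      (\<integral>\<^sup>+t. emeasure ?M (sec C t) \<partial>lborel)"
  proof (rule prekopa_leindler_real[OF mA[OF A] mA[OF B] _ s])
    show "(\<lambda>t. emeasure ?M (sec C t)) \<in> borel_measurable borel"
      unfolding sec_def by (rule emeasure_PiM_insert_section(2)[OF insert(1,2) insert.prems(3)])
    show "(\<integral>\<^sup>+t. ennreal (measure ?M (sec A t)) \<partial>lborel) = ennreal (measure (lborelPi (insert i I)) A)"
      "(\<integral>\<^sup>+t. ennreal (measure ?M (sec B t)) \<partial>lborel) = ennreal (measure (lborelPi (insert i I)) B)"
      using emA[OF A] emA[OF B] finA[OF A] finA[OF B] by simp_all
    show "\<bar>t\<bar> \<le> R" if "measure ?M (sec A t) \<noteq> 0" for t
      by (rule supp[OF A(2)]) (use that in auto)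
    show "\<bar>t\<bar> \<le> R" if "measure ?M (sec B t) \<noteq> 0" for t
      by (rule supp[OF B(2)]) (use that in auto)
    show "measure ?M (sec A t) \<le> D" "measure ?M (sec B t) \<le> D" for t
      using md A B by auto
    show "ennreal (measure ?M (sec A t) powr s * measure ?M (sec B r) powr (1 - s)) \<le> emeasure ?M (sec C (s * t + (1 - s) * r))" for t r
    proof (rule insert.IH[OF secs[OF A(1)] secs[OF B(1)] secs[OF insert.prems(3)] sub[OF A(2)] sub[OF B(2)]])
      fix a b assume a: "a \<in> sec A t" and b: "b \<in> sec B r"
      have "(\<lambda>j\<in>insert i I. s * (a(i := t)) j + (1 - s) * (b(i := r)) j) \<in> C"
        by (rule insert.prems(6)) (use a b in \<open>simp_all only: sec_def mem_Collect_eq\<close>)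
      also have "(\<lambda>j\<in>insert i I. s * (a(i := t)) j + (1 - s) * (b(i := r)) j) =
          (\<lambda>j\<in>I. s * a j + (1 - s) * b j)(i := s * t + (1 - s) * r)"
        using insert(2) by (auto simp: fun_eq_iff)
      finally show "(\<lambda>j\<in>I. s * a j + (1 - s) * b j) \<in> sec C (s * t + (1 - s) * r)"
        by (simp only: sec_def mem_Collect_eq) (simp add: space_PiM)
    qed
  qed auto
  then show ?case
    using emeasure_PiM_insert_section(1)[OF insert(1,2) insert.prems(3)] by (simp add: sec_def)
qed

text \<open>
  Negative \<open>c\<close> is included because point reflections are used below.
\<close>

lemma nn_integral_PiM_affine:
  fixes f :: "('i \<Rightarrow> real) \<Rightarrow> ennreal"
  assumes "finite I" and c: "c \<noteq> 0" and "f \<in> borel_measurable (lborelPi I)"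
  shows "(\<integral>\<^sup>+x. f x \<partial>lborelPi I) = ennreal (\<bar>c\<bar> ^ card I) * (\<integral>\<^sup>+x. f (\<lambda>i\<in>I. z i + c * x i) \<partial>lborelPi I)"
  using assms(1,3)
proof (induction I arbitrary: f rule: finite_induct)
  case empty
  interpret product_sigma_finite "\<lambda>i. lborel :: real measure" by unfold_locales
  show ?case using empty by (simp add: PiM_empty nn_integral_count_space_finite restrict_def)
next
  case (insert i I)
  interpret product_sigma_finite "\<lambda>i. lborel :: real measure" by unfold_locales
  interpret I: finite_product_sigma_finite "\<lambda>i. lborel :: real measure" I by unfold_locales fact
  note [measurable] = insert.prems
  have [measurable]: "(\<lambda>(t, x). x(i := t)) \<in> measurable (lborel \<Otimes>\<^sub>M lborelPi I) (lborelPi (insert i I))"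
    unfolding case_prod_beta by (rule measurable_fun_upd[where J=I]) auto
  have m1: "(\<lambda>x. f (x(i := t))) \<in> borel_measurable (lborelPi I)" for t
    by (rule measurable_compose[OF measurable_fun_upd[where J=I] insert.prems]) auto
  have m2: "(\<lambda>x. f (\<lambda>i\<in>insert i I. z i + c * x i)) \<in> borel_measurable (lborelPi (insert i I))"
    by (rule measurable_compose[OF measurable_restrict insert.prems]) auto
  have [measurable]: "(\<lambda>x. \<lambda>j\<in>I. z j + c * x j) \<in> measurable (lborelPi I) (lborelPi I)"
    by (rule measurable_restrict) auto
  have "(\<integral>\<^sup>+x. f x \<partial>lborelPi (insert i I)) = (\<integral>\<^sup>+t. \<integral>\<^sup>+x. f (x(i := t)) \<partial>lborelPi I \<partial>lborel)"
    by (rule product_nn_integral_insert_rev[OF insert(1,2) insert.prems])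
  also have "\<dots> = (\<integral>\<^sup>+t. ennreal (\<bar>c\<bar> ^ card I) * \<integral>\<^sup>+x. f ((\<lambda>j\<in>I. z j + c * x j)(i := t)) \<partial>lborelPi I \<partial>lborel)"
    by (intro nn_integral_cong insert.IH m1)
  also have "\<dots> = ennreal \<bar>c\<bar> * (\<integral>\<^sup>+t. ennreal (\<bar>c\<bar> ^ card I) * \<integral>\<^sup>+x. f ((\<lambda>j\<in>I. z j + c * x j)(i := z i + c * t)) \<partial>lborelPi I \<partial>lborel)"
  proof (rule nn_integral_real_affine)
    have "(\<lambda>t. \<integral>\<^sup>+x. f ((\<lambda>(t, x). (x(i := t))) (t, (\<lambda>j\<in>I. z j + c * x j))) \<partial>lborelPi I) \<in> borel_measurable lborel"
      by (rule I.borel_measurable_nn_integral) measurable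
    then show "(\<lambda>t. ennreal (\<bar>c\<bar> ^ card I) * \<integral>\<^sup>+x. f ((\<lambda>j\<in>I. z j + c * x j)(i := t)) \<partial>lborelPi I) \<in> borel_measurable borel"
      by simp
  qed (use c in auto)
  also have "\<dots> = ennreal \<bar>c\<bar> * (ennreal (\<bar>c\<bar> ^ card I) * (\<integral>\<^sup>+t. \<integral>\<^sup>+x. f ((\<lambda>j\<in>I. z j + c * x j)(i := z i + c * t)) \<partial>lborelPi I \<partial>lborel))"
  proof -
    have "(\<lambda>t. \<integral>\<^sup>+x. f ((\<lambda>(t, x). (x(i := t))) (z i + c * t, (\<lambda>j\<in>I. z j + c * x j))) \<partial>lborelPi I) \<in> borel_measurable lborel"
      by (rule I.borel_measurable_nn_integral) measurable
    then show ?thesis using c by (subst nn_integral_cmult) auto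
  qed
  also have "(\<integral>\<^sup>+t. \<integral>\<^sup>+x. f ((\<lambda>j\<in>I. z j + c * x j)(i := z i + c * t)) \<partial>lborelPi I \<partial>lborel) =
      (\<integral>\<^sup>+t. \<integral>\<^sup>+x. f (\<lambda>j\<in>insert i I. z j + c * (x(i := t)) j) \<partial>lborelPi I \<partial>lborel)"
    using insert(2) by (intro nn_integral_cong arg_cong[where f=f]) (auto simp: fun_eq_iff)
  also have "\<dots> = (\<integral>\<^sup>+x. f (\<lambda>j\<in>insert i I. z j + c * x j) \<partial>lborelPi (insert i I))"
    by (rule product_nn_integral_insert_rev[OF insert(1,2) m2, symmetric])
  finally show ?case
    using insert(1,2) c by (simp add: ennreal_mult mult.assoc del: restrict_apply insert_iff)
qed

section \<open>Convex hulls of finitely many random points\<close>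

text \<open>
  Points of the hull of a finite family are handled through their vectors of convex weights: families
  may have repetitions, weight vectors form a compact set, and only the coordinates below \<open>n\<close> of the
  points are ever looked at.
\<close>

definition weights :: "nat set \<Rightarrow> (nat \<Rightarrow> real) set" where
  "weights J = {w. (\<forall>j. 0 \<le> w j) \<and> (\<forall>j. j \<notin> J \<longrightarrow> w j = 0) \<and> sum w J = 1}"

definition comb :: "nat set \<Rightarrow> (nat \<Rightarrow> nat \<Rightarrow> real) \<Rightarrow> (nat \<Rightarrow> real) \<Rightarrow> nat \<Rightarrow> real" where
  "comb J X w = (\<lambda>k. \<Sum>j\<in>J. w j * X j k)"

definition sqd :: "nat \<Rightarrow> (nat \<Rightarrow> real) \<Rightarrow> (nat \<Rightarrow> real) \<Rightarrow> real" where
  "sqd n x y = (\<Sum>k<n. (x k - y k)\<^sup>2)"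

text \<open>
  The squared distance from \<open>x\<close> to the hull.  It measures whether \<open>x\<close> is missed by the hull in a way that
  is measurable in the points and that can be compared between a family and its subfamilies.
\<close>

definition hull_sqd :: "nat \<Rightarrow> nat set \<Rightarrow> (nat \<Rightarrow> nat \<Rightarrow> real) \<Rightarrow> (nat \<Rightarrow> real) \<Rightarrow> real" where
  "hull_sqd n J X x = (INF w\<in>weights J. sqd n x (comb J X w))"

lemma sqd_nonneg: "0 \<le> sqd n x y"
  by (simp add: sqd_def sum_nonneg)

lemma weights_nonempty:
  assumes "finite J" "J \<noteq> {}"
  shows "weights J \<noteq> {}"
proof -
  obtain j where "j \<in> J" using assms by auto
  then have "(\<lambda>i. if i = j then 1 else 0) \<in> weights J"
    using assms by (auto simp: weights_def)
  then show ?thesis by auto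
qed

lemma sum_fun_apply: "(sum f A) x = (\<Sum>a\<in>A. f a x)"
  for f :: "'a \<Rightarrow> 'b \<Rightarrow> real"
  by (induction A rule: infinite_finite_induct) (auto simp: zero_fun_def plus_fun_def)

lemma comb_eq_sum: "comb J X w = (\<Sum>j\<in>J. w j *\<^sub>R X j)"
  by (rule ext) (simp add: comb_def sum_fun_apply scaleR_fun_def)

lemma comb_mono:
  assumes "finite J" "I \<subseteq> J" "w \<in> weights I"
  shows "w \<in> weights J" "comb J X w = comb I X w"
proof -
  have z: "w j = 0" if "j \<in> J - I" for j using assms that by (auto simp: weights_def)
  have "sum w J = sum w I" using assms z by (intro sum.mono_neutral_right) auto
  then show "w \<in> weights J" using assms z by (auto simp: weights_def)
  show "comb J X w = comb I X w"
    unfolding comb_def using assms z by (intro ext sum.mono_neutral_right) auto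
qed

lemma comb_convex:
  assumes "w \<in> weights J" "v \<in> weights J" "0 \<le> s" "s \<le> 1"
  shows "(\<lambda>j. (1 - s) * w j + s * v j) \<in> weights J"
    and "comb J X (\<lambda>j. (1 - s) * w j + s * v j) k = (1 - s) * comb J X w k + s * comb J X v k"
proof -
  have "0 \<le> (1 - s) * w j + s * v j" for j
    using assms by (intro add_nonneg_nonneg mult_nonneg_nonneg) (auto simp: weights_def)
  then show "(\<lambda>j. (1 - s) * w j + s * v j) \<in> weights J"
    using assms by (auto simp: weights_def sum.distrib simp flip: sum_distrib_left)
  show "comb J X (\<lambda>j. (1 - s) * w j + s * v j) k = (1 - s) * comb J X w k + s * comb J X v k"
    by (simp add: comb_def sum.distrib sum_distrib_left algebra_simps sum_subtractf)
qed

lemma vertex_weight: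
  assumes "finite J" "j \<in> J"
  shows "(\<lambda>i. if i = j then 1 else 0) \<in> weights J" "comb J X (\<lambda>i. if i = j then 1 else 0) = X j"
  using assms by (auto simp: weights_def comb_def if_distrib[of "\<lambda>c. c * _"] cong: if_cong)

lemma convex_hull_image_weights:
  assumes "finite J"
  shows "convex hull (X ` J) = comb J X ` weights J"
proof
  show "convex hull (X ` J) \<subseteq> comb J X ` weights J"
  proof (rule hull_minimal)
    show "X ` J \<subseteq> comb J X ` weights J"
      using vertex_weight[OF assms] by (metis (no_types, lifting) image_eqI image_subsetI)
    show "convex (comb J X ` weights J)"
      unfolding convex_alt
    proof (intro ballI allI impI, elim imageE)
      fix x y s w v assume *: "0 \<le> s \<and> s \<le> (1::real)" "x = comb J X w" "y = comb J X v" "w \<in> weights J" "v \<in> weights J"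
      have "(1 - s) *\<^sub>R x + s *\<^sub>R y = comb J X (\<lambda>j. (1 - s) * w j + s * v j)"
        using comb_convex(2)[of w J v s X] * by (auto simp: fun_eq_iff scaleR_fun_def plus_fun_def)
      then show "(1 - s) *\<^sub>R x + s *\<^sub>R y \<in> comb J X ` weights J"
        using comb_convex(1)[of w J v s] * by auto
    qed
  qed
  show "comb J X ` weights J \<subseteq> convex hull (X ` J)"
  proof (intro image_subsetI)
    fix w assume "w \<in> weights J"
    then show "comb J X w \<in> convex hull (X ` J)"
      unfolding comb_eq_sum using assms
      by (intro convex_sum convex_convex_hull) (auto simp: weights_def intro: hull_inc)
  qed
qed

lemma continuous_comb: "continuous_on S (\<lambda>w. sqd n x (comb J X w))"
  unfolding sqd_def comb_def
  by (intro continuous_intros continuous_on_product_coordinates continuous_on_subset[OF continuous_on_product_coordinates]) auto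

lemma compact_weights: "finite J \<Longrightarrow> compact (weights J)"
proof -
  assume "finite J"
  let ?B = "PiE UNIV (\<lambda>j. if j \<in> J then {0..1} else {0::real})"
  have "compactin euclidean ?B"
    unfolding euclidean_product_topology[symmetric] by (subst compactin_PiE) auto
  then have B: "compact ?B" by simp
  have c: "closed {w. sum w J = (1::real)}"
  proof (rule closed_Collect_eq)
    show "continuous_on UNIV (\<lambda>w. sum w J :: real)"
      by (intro continuous_intros continuous_on_product_coordinates)
  qed auto
  have "w j \<le> 1" if "w \<in> weights J" "j \<in> J" for w j
  proof -
    have "w j \<le> sum w J" using that \<open>finite J\<close> by (intro member_le_sum) (auto simp: weights_def)
    then show ?thesis using that by (auto simp: weights_def)
  qed
  then have "weights J = ?B \<inter> {w. sum w J = 1}"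
    by (auto simp: weights_def PiE_iff split: if_splits) (metis order_refl)
  then show ?thesis using compact_Int_closed[OF B c] by simp
qed

lemma nearest_weights:
  assumes "finite J" "J \<noteq> {}"
  obtains w where "w \<in> weights J" "hull_sqd n J X x = sqd n x (comb J X w)"
    "\<And>v. v \<in> weights J \<Longrightarrow> hull_sqd n J X x \<le> sqd n x (comb J X v)"
proof -
  obtain w where w: "w \<in> weights J" "\<And>v. v \<in> weights J \<Longrightarrow> sqd n x (comb J X w) \<le> sqd n x (comb J X v)"
    using continuous_attains_inf[OF compact_weights[OF assms(1)] weights_nonempty[OF assms] continuous_comb[of _ n x J X]]
    by auto
  have "hull_sqd n J X x = sqd n x (comb J X w)"
    unfolding hull_sqd_def using w by (intro cInf_eq_minimum) auto
  then show thesis using that w by auto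
qed

text \<open>
  More unknowns than homogeneous linear equations: Gaussian elimination of one unknown per equation.
\<close>

lemma linear_dependence:
  fixes a :: "nat \<Rightarrow> 'i \<Rightarrow> real"
  assumes "finite I" "m < card I"
  shows "\<exists>c. (\<exists>i\<in>I. c i \<noteq> 0) \<and> (\<forall>k<m. (\<Sum>i\<in>I. c i * a k i) = 0)"
  using assms
proof (induction m arbitrary: I a)
  case 0
  then have "I \<noteq> {}" by auto
  then show ?case by (intro exI[of _ "\<lambda>_. 1"]) auto
next
  case (Suc m)
  show ?case
  proof (cases "\<forall>i\<in>I. a m i = 0")
    case True
    obtain c where c: "\<exists>i\<in>I. c i \<noteq> 0" "\<forall>k<m. (\<Sum>i\<in>I. c i * a k i) = 0"
      using Suc.IH[of I a] Suc.prems by auto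
    have "(\<Sum>i\<in>I. c i * a k i) = 0" if "k < Suc m" for k
      using that c(2) True by (cases "k = m") auto
    then show ?thesis using c(1) by auto
  next
    case False
    then obtain i0 where i0: "i0 \<in> I" "a m i0 \<noteq> 0" by auto
    let ?I = "I - {i0}"
    have "m < card ?I" using Suc.prems i0 by simp
    from Suc.IH[OF _ this, of "\<lambda>k i. a k i - a k i0 * a m i / a m i0"] Suc.prems
    obtain c where c: "\<exists>i\<in>?I. c i \<noteq> 0" "\<forall>k<m. (\<Sum>i\<in>?I. c i * (a k i - a k i0 * a m i / a m i0)) = 0"
      by auto
    define d where "d = c(i0 := - (\<Sum>i\<in>?I. c i * a m i) / a m i0)"
    have eq: "(\<Sum>i\<in>I. d i * a k i) = (\<Sum>i\<in>?I. c i * (a k i - a k i0 * a m i / a m i0))" for k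
    proof -
      have "(\<Sum>i\<in>I. d i * a k i) = d i0 * a k i0 + (\<Sum>i\<in>?I. d i * a k i)"
        using Suc.prems i0 by (simp add: sum.remove)
      also have "(\<Sum>i\<in>?I. d i * a k i) = (\<Sum>i\<in>?I. c i * a k i)"
        by (rule sum.cong) (auto simp: d_def)
      also have "d i0 * a k i0 = (\<Sum>i\<in>?I. - (c i * (a k i0 * a m i / a m i0)))"
        unfolding d_def by (simp add: sum_distrib_left sum_divide_distrib sum_negf mult_ac)
      finally show ?thesis by (simp add: sum.distrib[symmetric] algebra_simps)
    qed
    have "(\<Sum>i\<in>I. d i * a k i) = 0" if "k < Suc m" for k
      using that c(2) i0 by (cases "k = m") (auto simp: eq)
    moreover have "\<exists>i\<in>I. d i \<noteq> 0" using c(1) by (auto simp: d_def)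
    ultimately show ?thesis by auto
  qed
qed

text \<open>
  A subfamily of least size that still represents the point has positive weights only.  If it had more
  than \<open>n + 1\<close> members, an affine dependence could be subtracted until one weight vanishes.
\<close>

lemma caratheodory_weights:
  assumes "finite J" "w \<in> weights J"
  obtains I v where "I \<subseteq> J" "I \<noteq> {}" "card I \<le> n + 1" "v \<in> weights I"
    "\<And>k. k < n \<Longrightarrow> comb I X v k = comb J X w k"
proof -
  let ?P = "\<lambda>I. I \<subseteq> J \<and> (\<exists>v\<in>weights I. \<forall>k<n. comb I X v k = comb J X w k)"
  have "?P J" using assms by auto
  from ex_has_least_nat[of ?P, OF this, of card]
  obtain I where I: "?P I" "\<And>I'. ?P I' \<Longrightarrow> card I \<le> card I'" by blast
  then obtain v where v: "v \<in> weights I" "\<And>k. k < n \<Longrightarrow> comb I X v k = comb J X w k" by auto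
  have finI: "finite I" using I assms finite_subset by blast
  have ne: "I \<noteq> {}" using v by (auto simp: weights_def)
  have nz: "\<not> (v' i = 0)" if v': "v' \<in> weights I" "\<forall>k<n. comb I X v' k = comb J X w k" and i: "i \<in> I" for v' i
  proof
    assume "v' i = 0"
    then have "sum v' (I - {i}) = sum v' I" "comb (I - {i}) X v' = comb I X v'"
      unfolding comb_def using finI i by (auto simp: sum.remove[OF finI i])
    then have "?P (I - {i})" using v' I(1) \<open>v' i = 0\<close> by (intro conjI bexI[of _ v']) (auto simp: weights_def)
    from I(2)[OF this] show False using finI i card_Diff1_less[OF finI i] by simp
  qed
  have "card I \<le> n + 1"
  proof (rule ccontr)
    assume "\<not> card I \<le> n + 1"
    then have "Suc n < card I" by simp
    \<comment> \<open>The equation with index \<open>n\<close> says that the coefficients sum to 0.\<close>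
    from linear_dependence[OF finI this, of "\<lambda>k i. if k = n then 1 else X i k"]
    obtain c where c: "\<exists>i\<in>I. c i \<noteq> 0" "\<And>k. k < Suc n \<Longrightarrow> (\<Sum>i\<in>I. c i * (if k = n then 1 else X i k)) = 0"
      by auto
    have c0: "sum c I = 0" using c(2)[of n] by simp
    have cX: "(\<Sum>i\<in>I. c i * X i k) = 0" if "k < n" for k using c(2)[of k] that by simp
    let ?P = "{i\<in>I. 0 < c i}"
    have "?P \<noteq> {}"
    proof
      assume "?P = {}"
      then have "\<forall>i\<in>I. 0 \<le> - c i" by auto
      moreover have "(\<Sum>i\<in>I. - c i) = 0" using c0 by (simp add: sum_negf)
      ultimately have "\<forall>i\<in>I. - c i = 0" using finI by (subst (asm) sum_nonneg_eq_0_iff) auto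
      then show False using c(1) by auto
    qed
    define t where "t = Min ((\<lambda>i. v i / c i) ` ?P)"
    have "t \<in> (\<lambda>i. v i / c i) ` ?P" unfolding t_def using \<open>?P \<noteq> {}\<close> finI by (intro Min_in) auto
    then obtain i0 where i0: "i0 \<in> I" "0 < c i0" "t = v i0 / c i0" by auto
    have t0: "0 \<le> t" using i0 v(1) by (auto simp: weights_def)
    have tle: "t * c i \<le> v i" if "i \<in> I" for i
    proof (cases "0 < c i")
      case True
      then have "t \<le> v i / c i" unfolding t_def using that finI by (intro Min_le) auto
      then show ?thesis using True by (simp add: field_simps)
    next
      case False
      then have "t * c i \<le> 0" using t0 by (simp add: mult_nonneg_nonpos)
      also have "0 \<le> v i" using v(1) by (simp add: weights_def)
      finally show ?thesis .
    qed
    define v' where "v' i = (if i \<in> I then v i - t * c i else 0)" for i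
    have "v' \<in> weights I"
      using v(1) tle c0 by (auto simp: weights_def v'_def sum_subtractf simp flip: sum_distrib_left)
    moreover have "comb I X v' k = comb J X w k" if "k < n" for k
    proof -
      have "comb I X v' k = comb I X v k - t * (\<Sum>i\<in>I. c i * X i k)"
        unfolding comb_def v'_def by (simp add: sum_subtractf algebra_simps sum_distrib_left)
      then show ?thesis using v(2) cX that by simp
    qed
    moreover have "v' i0 = 0" using i0 by (simp add: v'_def)
    ultimately show False using nz i0 by blast
  qed
  then show thesis using that I ne v by blast
qed

lemma hull_sqd_support:
  assumes "finite J" "J \<noteq> {}"
  obtains I where "I \<subseteq> J" "I \<noteq> {}" "card I \<le> n + 1" "hull_sqd n I X x = hull_sqd n J X x"
proof -
  obtain w where w: "w \<in> weights J" "hull_sqd n J X x = sqd n x (comb J X w)"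
    "\<And>v. v \<in> weights J \<Longrightarrow> hull_sqd n J X x \<le> sqd n x (comb J X v)"
    using nearest_weights[where n=n and X=X and x=x, OF assms] by blast
  obtain I v where I: "I \<subseteq> J" "I \<noteq> {}" "card I \<le> n + 1" and v: "v \<in> weights I"
    "\<And>k. k < n \<Longrightarrow> comb I X v k = comb J X w k"
    using caratheodory_weights[where n=n and X=X, OF assms(1) w(1)] by blast
  have finI: "finite I" using I assms finite_subset by blast
  obtain u where u: "u \<in> weights I" "hull_sqd n I X x = sqd n x (comb I X u)"
    "\<And>v. v \<in> weights I \<Longrightarrow> hull_sqd n I X x \<le> sqd n x (comb I X v)"
    using nearest_weights[where n=n and X=X and x=x, OF finI I(2)] by blast
  have "sqd n x (comb I X v) = sqd n x (comb J X w)" using v(2) by (simp add: sqd_def)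
  then have "hull_sqd n I X x \<le> hull_sqd n J X x" using u(3)[OF v(1)] w(2) by simp
  moreover have "hull_sqd n J X x \<le> hull_sqd n I X x"
    using w(3)[OF comb_mono(1)[OF assms(1) I(1) u(1)]] comb_mono(2)[OF assms(1) I(1) u(1), of X] u(2) by simp
  ultimately show thesis using that I by simp
qed

lemma hull_sqd_eq_0_iff:
  assumes "finite J" "J \<noteq> {}" "x \<in> Rn n" "\<And>j. j \<in> J \<Longrightarrow> X j \<in> Rn n"
  shows "hull_sqd n J X x = 0 \<longleftrightarrow> x \<in> convex hull (X ` J)"
proof
  obtain w where w: "w \<in> weights J" "hull_sqd n J X x = sqd n x (comb J X w)"
    "\<And>v. v \<in> weights J \<Longrightarrow> hull_sqd n J X x \<le> sqd n x (comb J X v)"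
    using nearest_weights[where n=n and X=X and x=x, OF assms(1,2)] by blast
  {
    assume "hull_sqd n J X x = 0"
    then have "x k = comb J X w k" if "k < n" for k
      using w(2) that by (auto simp: sqd_def sum_nonneg_eq_0_iff)
    moreover have "comb J X w \<in> convex hull (X ` J)"
      using w(1) by (auto simp: convex_hull_image_weights[OF assms(1)])
    moreover from this have "comb J X w \<in> Rn n"
      using convex_hull_subset_Rn[of "X ` J" n] assms(4) by auto
    ultimately have "x = comb J X w"
      using assms(3) by (intro ext) (auto simp: Rn_def PiE_iff extensional_def not_less, metis not_less)
    then show "x \<in> convex hull (X ` J)" using \<open>comb J X w \<in> convex hull _\<close> by simp
  next
    assume "x \<in> convex hull (X ` J)"
    then obtain v where "v \<in> weights J" "x = comb J X v" by (auto simp: convex_hull_image_weights[OF assms(1)])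
    then have "hull_sqd n J X x \<le> 0" using w(3)[of v] by (simp add: sqd_def)
    then show "hull_sqd n J X x = 0" using w(2) sqd_nonneg[of n x] by (metis antisym)
  }
qed

text \<open>
  The direction \<open>u\<close> points from the nearest point of the hull of \<open>I\<close> to \<open>x\<close>.  It is chosen from the points
  with index in \<open>I\<close> alone, before the other points are known: as long as these do not bring the hull
  closer to \<open>x\<close>, the same \<open>u\<close> separates all of them strictly from \<open>x\<close>.  This is what makes the remaining
  points independent of \<open>u\<close> in a random family.
\<close>

lemma separating_direction:
  assumes "finite J" "I \<subseteq> J" "I \<noteq> {}"
  obtains u where "\<And>X' x'. \<lbrakk>\<And>i. i \<in> I \<Longrightarrow> X' i = X i; hull_sqd n I X' x = hull_sqd n J X' x; 0 < hull_sqd n J X' x\<rbrakk>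
     \<Longrightarrow> \<forall>j\<in>J. inner_Rn n u (X' j) < inner_Rn n u x"
proof -
  have finI: "finite I" using assms finite_subset by blast
  obtain w where w: "w \<in> weights I" "hull_sqd n I X x = sqd n x (comb I X w)"
    "\<And>v. v \<in> weights I \<Longrightarrow> hull_sqd n I X x \<le> sqd n x (comb I X v)"
    using nearest_weights[where n=n and X=X and x=x, OF finI assms(3)] by blast
  define z where "z = comb I X w"
  define u where "u k = x k - z k" for k
  have "inner_Rn n u (X' j) < inner_Rn n u x"
    if X': "\<And>i. i \<in> I \<Longrightarrow> X' i = X i" and eq: "hull_sqd n I X' x = hull_sqd n J X' x"
      and pos: "0 < hull_sqd n J X' x" and j: "j \<in> J" for X' j
  proof -
    have ceq: "comb I X' = comb I X" using X' by (auto simp: comb_def fun_eq_iff intro!: sum.cong)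
    have wJ: "w \<in> weights J" "comb J X' w = z" using comb_mono(1)[OF assms(1,2) w(1)] comb_mono(2)[OF assms(1,2) w(1), of X'] ceq
      by (auto simp: z_def)
    have val: "hull_sqd n J X' x = sqd n x z" using eq w(2) by (simp add: hull_sqd_def ceq z_def)
    have mn: "sqd n x z \<le> sqd n x (comb J X' v)" if "v \<in> weights J" for v
    proof -
      have "J \<noteq> {}" using j by auto
      from nearest_weights[OF assms(1) this, where n=n and X=X' and x=x]
      show ?thesis using val that by metis
    qed
    define y where "y k = X' j k - z k" for k
    let ?uy = "\<Sum>k<n. u k * y k"
    let ?yy = "\<Sum>k<n. (y k)\<^sup>2"
    \<comment> \<open>Moving from the nearest point towards \<open>X' j\<close> does not decrease the distance to \<open>x\<close>.\<close>
    have quad: "2 * s * ?uy \<le> s\<^sup>2 * ?yy" if "0 \<le> s" "s \<le> 1" for s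
    proof -
      note cc = comb_convex[OF wJ(1) vertex_weight(1)[OF assms(1) j] that]
      have "sqd n x z \<le> sqd n x (comb J X' (\<lambda>i. (1 - s) * w i + s * (if i = j then 1 else 0)))"
        by (rule mn[OF cc(1)])
      also have "\<dots> = (\<Sum>k<n. (u k - s * y k)\<^sup>2)"
        unfolding sqd_def cc(2) wJ(2) vertex_weight(2)[OF assms(1) j]
        by (intro sum.cong refl) (simp add: u_def y_def algebra_simps)
      also have "\<dots> = (\<Sum>k<n. (u k)\<^sup>2) - 2 * s * ?uy + s\<^sup>2 * ?yy"
        by (simp add: power2_diff sum.distrib sum_subtractf sum_distrib_left algebra_simps power_mult_distrib)
      also have "(\<Sum>k<n. (u k)\<^sup>2) = sqd n x z" by (simp add: sqd_def u_def)
      finally show ?thesis by simp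
    qed
    have uy: "?uy \<le> 0"
    proof (rule ccontr)
      assume "\<not> ?uy \<le> 0"
      then have p: "0 < ?uy" by simp
      have yy: "0 \<le> ?yy" by (simp add: sum_nonneg)
      \<comment> \<open>A step length so small that the linear term beats the quadratic one.\<close>
      define s where "s = min 1 (?uy / (?yy + 1))"
      have s: "0 < s" "s \<le> 1" "s \<le> ?uy / (?yy + 1)" using p yy by (auto simp: s_def)
      have "2 * ?uy \<le> s * ?yy" using quad[of s] s by (simp add: power2_eq_square)
      also have "\<dots> \<le> s * (?yy + 1)" using s by simp
      also have "\<dots> \<le> ?uy" using s(3) yy by (simp add: field_simps)
      finally show False using p by simp
    qed
    have "inner_Rn n u x - inner_Rn n u (X' j) = sqd n x z - ?uy"
      unfolding inner_Rn_def sqd_def sum_subtractf[symmetric]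
      by (intro sum.cong refl) (simp add: u_def y_def power2_eq_square algebra_simps)
    then show ?thesis using uy pos val by simp
  qed
  then show thesis using that by blast
qed

text \<open>
  The infimum may be taken over the countably many rational weight vectors, because these are dense in
  all weight vectors and the distance depends continuously on the weights.
\<close>

lemma borel_measurable_hull_sqd:
  assumes J: "finite J" "J \<noteq> {}"
    and [measurable]: "\<And>k. k < n \<Longrightarrow> (\<lambda>\<omega>. x \<omega> k) \<in> borel_measurable M"
      "\<And>j k. j \<in> J \<Longrightarrow> k < n \<Longrightarrow> (\<lambda>\<omega>. X \<omega> j k) \<in> borel_measurable M"
  shows "(\<lambda>\<omega>. hull_sqd n J (X \<omega>) (x \<omega>)) \<in> borel_measurable M"
proof -
  define W where "W = (\<lambda>q j. if j \<in> J then real (q j) / real (sum q J) else 0) ` {q \<in> PiE J (\<lambda>_. UNIV :: nat set). 0 < sum q J}"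
  have "countable (PiE J (\<lambda>_. UNIV :: nat set))" using J by (intro countable_PiE) auto
  then have cW: "countable W"
    unfolding W_def by (intro countable_image) (rule countable_subset[rotated], auto)
  have WJ: "W \<subseteq> weights J"
    unfolding W_def by (auto simp: weights_def simp flip: sum_divide_distrib of_nat_sum)
  have Wne: "W \<noteq> {}"
  proof -
    have "(\<lambda>j\<in>J. 1) \<in> {q \<in> PiE J (\<lambda>_. UNIV :: nat set). 0 < sum q J}"
      using J by (auto simp: card_gt_0_iff)
    then show ?thesis unfolding W_def by blast
  qed
  have bdd: "bdd_below ((\<lambda>w. sqd n y (comb J Y w)) ` S)" for y Y S
    by (rule bdd_belowI[of _ 0]) (auto simp: sqd_nonneg)
  have eq: "hull_sqd n J Y y = (INF w\<in>W. sqd n y (comb J Y w))" for Y y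
  proof (rule antisym)
    show "hull_sqd n J Y y \<le> (INF w\<in>W. sqd n y (comb J Y w))"
      unfolding hull_sqd_def by (rule cINF_superset_mono[OF Wne bdd WJ]) auto
    obtain w where w: "w \<in> weights J" "hull_sqd n J Y y = sqd n y (comb J Y w)"
      "\<And>v. v \<in> weights J \<Longrightarrow> hull_sqd n J Y y \<le> sqd n y (comb J Y v)"
      using nearest_weights[where n=n and X=Y and x=y, OF J] by blast
    have w0: "0 \<le> w j" for j using w(1) by (simp add: weights_def)
    \<comment> \<open>Rounding up with \<open>Suc\<close> keeps the total positive, so that normalization is possible.\<close>
    define q where "q m j = (if j \<in> J then Suc (nat \<lfloor>real m * w j\<rfloor>) else undefined)" for m j
    define v where "v m j = (if j \<in> J then real (q m j) / real (sum (q m) J) else 0)" for m j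
    have qpos: "0 < sum (q m) J" for m
      using J by (auto simp: q_def sum_pos intro!: sum_pos)
    have vW: "v m \<in> W" for m
      unfolding W_def v_def using qpos[of m] by (intro image_eqI[of _ _ "q m"]) (auto simp: q_def)
    have ql: "(\<lambda>m. real (q m j) / real m) \<longlonglongrightarrow> w j" if "j \<in> J" for j
    proof (rule tendsto_sandwich[of "\<lambda>m. w j" _ _ "\<lambda>m. w j + 1 / real m"])
      show "\<forall>\<^sub>F m in sequentially. w j \<le> real (q m j) / real m"
        using eventually_gt_at_top[of 0]
      proof eventually_elim
        case (elim m)
        have "real m * w j \<le> real (q m j)" using that w0[of j] by (simp add: q_def) linarith
        then show ?case using elim by (simp add: field_simps)
      qed
      show "\<forall>\<^sub>F m in sequentially. real (q m j) / real m \<le> w j + 1 / real m"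
        using eventually_gt_at_top[of 0]
      proof eventually_elim
        case (elim m)
        have "real (q m j) \<le> real m * w j + 1" using that w0[of j] by (simp add: q_def)
        then show ?case using elim by (simp add: field_simps)
      qed
      show "(\<lambda>m. w j + 1 / real m) \<longlonglongrightarrow> w j"
        using tendsto_add[OF tendsto_const lim_1_over_n, of "w j"] by simp
    qed auto
    have sl: "(\<lambda>m. real (sum (q m) J) / real m) \<longlonglongrightarrow> 1"
    proof -
      have "(\<lambda>m. \<Sum>j\<in>J. real (q m j) / real m) \<longlonglongrightarrow> (\<Sum>j\<in>J. w j)"
        by (intro tendsto_sum ql)
      then show ?thesis using w(1) by (simp add: weights_def sum_divide_distrib)
    qed
    have vl: "(\<lambda>m. v m j) \<longlonglongrightarrow> w j" if "j \<in> J" for j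
    proof -
      have "(\<lambda>m. (real (q m j) / real m) / (real (sum (q m) J) / real m)) \<longlonglongrightarrow> w j / 1"
        by (intro tendsto_divide ql sl that) auto
      moreover have "\<forall>\<^sub>F m in sequentially. real (q m j) / real m / (real (sum (q m) J) / real m) = v m j"
        using eventually_gt_at_top[of 0] by eventually_elim (use that in \<open>auto simp: v_def\<close>)
      ultimately show ?thesis by (simp add: Lim_transform_eventually)
    qed
    have "(\<lambda>m. sqd n y (comb J Y (v m))) \<longlonglongrightarrow> sqd n y (comb J Y w)"
      unfolding sqd_def comb_def by (intro tendsto_intros vl)
    then have "(INF w\<in>W. sqd n y (comb J Y w)) \<le> sqd n y (comb J Y w)"
      by (rule LIMSEQ_le_const) (auto intro!: cINF_lower[OF bdd] vW)
    then show "(INF w\<in>W. sqd n y (comb J Y w)) \<le> hull_sqd n J Y y" using w(2) by simp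
  qed
  have [measurable]: "(\<lambda>\<omega>. sqd n (x \<omega>) (comb J (X \<omega>) w)) \<in> borel_measurable M" for w
    unfolding sqd_def comb_def by measurable
  show ?thesis unfolding eq
    by (rule borel_measurable_cINF[OF cW]) (auto intro: bdd)
qed


lemma emeasure_PiM_less_halfspace:
  assumes "prob_space \<mu>" and \<mu>: "sets \<mu> = sets (\<Pi>\<^sub>M i\<in>{..<n}. borel)"
    and p: "p \<le> measure \<mu> {y \<in> space \<mu>. inner_Rn n u x \<le> inner_Rn n u y}" and "finite L"
  shows "PiE L (\<lambda>_. {y \<in> space \<mu>. inner_Rn n u y < inner_Rn n u x}) \<in> sets (\<Pi>\<^sub>M j\<in>L. \<mu>)"
    and "emeasure (\<Pi>\<^sub>M j\<in>L. \<mu>) (PiE L (\<lambda>_. {y \<in> space \<mu>. inner_Rn n u y < inner_Rn n u x})) \<le> ennreal ((1 - p) ^ card L)"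
proof -
  interpret M: prob_space \<mu> by fact
  interpret product_prob_space "\<lambda>_. \<mu>" L ..
  have [measurable]: "(\<lambda>y. y k) \<in> borel_measurable \<mu>" if "k < n" for k
    using that unfolding measurable_cong_sets[OF \<mu> refl] by (auto intro: measurable_component_singleton)
  have [measurable]: "inner_Rn n u \<in> borel_measurable \<mu>"
    unfolding inner_Rn_def by measurable
  let ?A = "{y \<in> space \<mu>. inner_Rn n u y < inner_Rn n u x}"
  show "PiE L (\<lambda>_. ?A) \<in> sets (\<Pi>\<^sub>M j\<in>L. \<mu>)"
    using assms(4) by (intro sets_PiM_I_finite) auto
  have "?A = space \<mu> - {y \<in> space \<mu>. inner_Rn n u x \<le> inner_Rn n u y}" by auto
  then have "measure \<mu> ?A = 1 - measure \<mu> {y \<in> space \<mu>. inner_Rn n u x \<le> inner_Rn n u y}"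
    by (simp add: M.prob_compl)
  then have A: "measure \<mu> ?A \<le> 1 - p" using p by simp
  have "emeasure (\<Pi>\<^sub>M j\<in>L. \<mu>) (PiE L (\<lambda>_. ?A)) = ennreal (measure \<mu> ?A ^ card L)"
    using assms(4) by (subst emeasure_PiM) (auto simp: M.emeasure_eq_measure prod_constant ennreal_power)
  also have "\<dots> \<le> ennreal ((1 - p) ^ card L)"
    using A by (intro ennreal_leI power_mono) auto
  finally show "emeasure (\<Pi>\<^sub>M j\<in>L. \<mu>) (PiE L (\<lambda>_. ?A)) \<le> ennreal ((1 - p) ^ card L)" .
qed

text \<open>
  A nonempty set with at most \<open>m\<close> elements is the image of a map from \<open>m\<close> points, repetitions allowed.
\<close>

lemma card_small_subsets:
  assumes "finite J"
  shows "finite {I. I \<subseteq> J \<and> I \<noteq> {} \<and> card I \<le> m}"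
    and "card {I. I \<subseteq> J \<and> I \<noteq> {} \<and> card I \<le> m} \<le> card J ^ m"
proof -
  let ?S = "{I. I \<subseteq> J \<and> I \<noteq> {} \<and> card I \<le> m}"
  show "finite ?S" using assms by simp
  have "?S \<subseteq> (\<lambda>f. f ` {..<m}) ` (PiE {..<m} (\<lambda>_. J))"
  proof
    fix I assume "I \<in> ?S"
    then have I: "I \<subseteq> J" "I \<noteq> {}" "card I \<le> m" by auto
    have fI: "finite I" using I assms finite_subset by blast
    obtain h where h: "bij_betw h {..<card I} I" using ex_bij_betw_nat_finite[OF fI] by (auto simp: atLeast0LessThan)
    obtain i0 where i0: "i0 \<in> I" using I by auto
    define f where "f = (\<lambda>k\<in>{..<m}. if k < card I then h k else i0)"
    have "f ` {..<m} = I"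
    proof -
      have "f ` {..<card I} = I" using h I(3) by (auto simp: f_def bij_betw_def intro!: image_eqI)
      moreover have "f ` {..<m} \<subseteq> I" using h i0 by (auto simp: f_def bij_betw_def)
      moreover have "f ` {..<card I} \<subseteq> f ` {..<m}" using I(3) by (intro image_mono) auto
      ultimately show ?thesis by auto
    qed
    moreover from this have "f \<in> PiE {..<m} (\<lambda>_. J)"
      using I(1) by (auto simp: PiE_iff f_def)
    ultimately show "I \<in> (\<lambda>f. f ` {..<m}) ` (PiE {..<m} (\<lambda>_. J))" by blast
  qed
  then have "card ?S \<le> card ((\<lambda>f. f ` {..<m}) ` (PiE {..<m} (\<lambda>_. J)))"
    using assms by (intro card_mono finite_imageI finite_PiE) auto
  also have "\<dots> \<le> card (PiE {..<m} (\<lambda>_. J))"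
    using assms by (intro card_image_le finite_PiE) auto
  also have "\<dots> = card J ^ m" by (simp add: card_PiE)
  finally show "card ?S \<le> card J ^ m" .
qed

lemma hull_sqd_measurable_PiM:
  assumes \<mu>: "sets \<mu> = sets (\<Pi>\<^sub>M i\<in>{..<n}. borel)" and "finite I" "I \<noteq> {}" "I \<subseteq> J"
  shows "(\<lambda>X. hull_sqd n I X x) \<in> borel_measurable (\<Pi>\<^sub>M j\<in>J. \<mu>)"
proof (rule borel_measurable_hull_sqd[OF assms(2,3)])
  have k: "(\<lambda>y. y k) \<in> borel_measurable \<mu>" if "k < n" for k
    using that unfolding measurable_cong_sets[OF \<mu> refl] by (auto intro: measurable_component_singleton)
  show "(\<lambda>\<omega>. \<omega> j k) \<in> borel_measurable (\<Pi>\<^sub>M j\<in>J. \<mu>)" if "j \<in> I" "k < n" for j k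
    by (rule measurable_compose[OF measurable_component_singleton[of j J "\<lambda>_. \<mu>"] k]) (use that assms in auto)
qed auto

text \<open>
  The missed event is covered by the events \<open>E I\<close>, for nonempty index sets \<open>I\<close> with at most \<open>n + 1\<close>
  elements, that the subfamily \<open>I\<close> already realizes the positive distance from \<open>x\<close> to the whole hull.
  Given the points in \<open>I\<close>, the others must all avoid one fixed half-space of mass at least \<open>p\<close>.
\<close>

lemma prob_not_in_hull_le:
  fixes J :: "nat set"
  assumes "prob_space \<mu>" and \<mu>: "sets \<mu> = sets (\<Pi>\<^sub>M i\<in>{..<n}. borel)"
    and x: "x \<in> Rn n"
    and p: "\<And>u. p \<le> measure \<mu> {y \<in> space \<mu>. inner_Rn n u x \<le> inner_Rn n u y}" and p01: "0 \<le> p" "p \<le> 1"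
    and J: "finite J" "J \<noteq> {}"
  shows "emeasure (\<Pi>\<^sub>M j\<in>J. \<mu>) {X \<in> space (\<Pi>\<^sub>M j\<in>J. \<mu>). x \<notin> convex hull (X ` J)}
    \<le> ennreal (real (card J) ^ (n + 1) * (1 - p) ^ (card J - (n + 1)))"
proof -
  interpret M: prob_space \<mu> by fact
  interpret product_prob_space "\<lambda>_. \<mu>" J ..
  let ?P = "\<lambda>L::nat set. \<Pi>\<^sub>M j\<in>L. \<mu>"
  let ?S = "{I. I \<subseteq> J \<and> I \<noteq> {} \<and> card I \<le> n + 1}"
  have sp: "space \<mu> = Rn n" using sets_eq_imp_space_eq[OF \<mu>] by (simp add: space_PiM Rn_def)
  define E where "E I = {X \<in> space (?P J). hull_sqd n I X x = hull_sqd n J X x \<and> 0 < hull_sqd n J X x}" for I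
  have E[measurable]: "E I \<in> sets (?P J)" if "I \<in> ?S" for I
  proof -
    have m: "(\<lambda>X. hull_sqd n I X x) \<in> borel_measurable (?P J)" "(\<lambda>X. hull_sqd n J X x) \<in> borel_measurable (?P J)"
      using that J finite_subset[of I J] by (auto intro!: hull_sqd_measurable_PiM[OF \<mu>])
    show ?thesis unfolding E_def
      by (intro sets.sets_Collect_conj borel_measurable_eq[OF m] borel_measurable_less[OF borel_measurable_const m(2)])
  qed
  have sub: "{X \<in> space (?P J). x \<notin> convex hull (X ` J)} \<subseteq> (\<Union>I\<in>?S. E I)"
  proof
    fix X assume X: "X \<in> {X \<in> space (?P J). x \<notin> convex hull (X ` J)}"
    then have "X j \<in> Rn n" if "j \<in> J" for j using that sp by (auto simp: space_PiM)
    from hull_sqd_eq_0_iff[OF J x this] X have "hull_sqd n J X x \<noteq> 0" by auto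
    moreover obtain w where "hull_sqd n J X x = sqd n x (comb J X w)"
      using nearest_weights[where n=n and X=X and x=x, OF J] by blast
    ultimately have "0 < hull_sqd n J X x" using sqd_nonneg[of n x "comb J X w"] by simp
    moreover obtain I where "I \<subseteq> J" "I \<noteq> {}" "card I \<le> n + 1" "hull_sqd n I X x = hull_sqd n J X x"
      using hull_sqd_support[where n=n and X=X and x=x, OF J] by blast
    ultimately show "X \<in> (\<Union>I\<in>?S. E I)" using X by (auto simp: E_def)
  qed
  have EI: "emeasure (?P J) (E I) \<le> ennreal ((1 - p) ^ (card J - (n + 1)))" if I: "I \<in> ?S" for I
  proof -
    have fI: "finite I" "finite (J - I)" and JI: "I \<union> (J - I) = J" and dj: "I \<inter> (J - I) = {}"
      using I J finite_subset by auto
    have sec: "(\<integral>\<^sup>+Z. indicator (E I) (merge I (J - I) (Y, Z)) \<partial>?P (J - I)) \<le> ennreal ((1 - p) ^ (card J - (n + 1)))" for Y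
    proof -
      obtain u where u: "\<And>X' x'. \<lbrakk>\<And>i. i \<in> I \<Longrightarrow> X' i = Y i; hull_sqd n I X' x = hull_sqd n J X' x; 0 < hull_sqd n J X' x\<rbrakk>
         \<Longrightarrow> \<forall>j\<in>J. inner_Rn n u (X' j) < inner_Rn n u x"
        using separating_direction[where J=J and I=I and n=n and X=Y and x=x] I J by blast
      let ?Q = "PiE (J - I) (\<lambda>_. {y \<in> space \<mu>. inner_Rn n u y < inner_Rn n u x})"
      have "(\<integral>\<^sup>+Z. indicator (E I) (merge I (J - I) (Y, Z)) \<partial>?P (J - I)) \<le> (\<integral>\<^sup>+Z. indicator ?Q Z \<partial>?P (J - I))"
      proof (rule nn_integral_mono)
        fix Z assume Z: "Z \<in> space (?P (J - I))"
        let ?X = "merge I (J - I) (Y, Z)"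
        have "Z \<in> ?Q" if "?X \<in> E I"
        proof -
          have "\<forall>j\<in>J. inner_Rn n u (?X j) < inner_Rn n u x"
            using that by (intro u) (auto simp: E_def)
          moreover have "?X j = Z j" if "j \<in> J - I" for j using that by (auto simp: merge_def)
          ultimately have "inner_Rn n u (Z j) < inner_Rn n u x" if "j \<in> J - I" for j
            using that by (metis DiffD1)
          then show ?thesis using Z by (auto simp: space_PiM PiE_iff)
        qed
        then show "indicator (E I) ?X \<le> (indicator ?Q Z :: ennreal)" by (auto simp: indicator_def)
      qed
      also have "\<dots> = emeasure (?P (J - I)) ?Q"
        by (rule nn_integral_indicator, rule emeasure_PiM_less_halfspace(1)[OF assms(1) \<mu> p fI(2)])
      also have "\<dots> \<le> ennreal ((1 - p) ^ card (J - I))"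
        by (rule emeasure_PiM_less_halfspace(2)[OF assms(1) \<mu> p fI(2)])
      also have "\<dots> \<le> ennreal ((1 - p) ^ (card J - (n + 1)))"
        using p01 I J fI by (intro ennreal_leI power_decreasing) (auto simp: card_Diff_subset)
      finally show ?thesis .
    qed
    have "emeasure (?P J) (E I) = (\<integral>\<^sup>+X. indicator (E I) X \<partial>?P (I \<union> (J - I)))"
      using E[OF I] JI by simp
    also have "\<dots> = (\<integral>\<^sup>+Y. \<integral>\<^sup>+Z. indicator (E I) (merge I (J - I) (Y, Z)) \<partial>?P (J - I) \<partial>?P I)"
      using E[OF I] JI by (intro product_nn_integral_fold dj fI) simp
    also have "\<dots> \<le> (\<integral>\<^sup>+Y. ennreal ((1 - p) ^ (card J - (n + 1))) \<partial>?P I)"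
      by (intro nn_integral_mono sec)
    also have "\<dots> = ennreal ((1 - p) ^ (card J - (n + 1)))"
      using prob_space.emeasure_space_1[OF prob_space_PiM[of I "\<lambda>_. \<mu>"]] assms(1) by simp
    finally show ?thesis .
  qed
  have "emeasure (?P J) {X \<in> space (?P J). x \<notin> convex hull (X ` J)} \<le> emeasure (?P J) (\<Union>I\<in>?S. E I)"
    using card_small_subsets(1)[OF J(1), of "n + 1"] by (intro emeasure_mono sub sets.finite_UN E) auto
  also have "\<dots> \<le> (\<Sum>I\<in>?S. emeasure (?P J) (E I))"
    using card_small_subsets(1)[OF J(1), of "n + 1"] by (intro emeasure_subadditive_finite) (use E in blast)+
  also have "\<dots> \<le> (\<Sum>I\<in>?S. ennreal ((1 - p) ^ (card J - (n + 1))))"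
    by (intro sum_mono EI)
  also have "\<dots> = ennreal (real (card ?S) * (1 - p) ^ (card J - (n + 1)))"
    using p01 by (simp add: ennreal_mult ennreal_of_nat_eq_real_of_nat)
  also have "\<dots> \<le> ennreal (real (card J) ^ (n + 1) * (1 - p) ^ (card J - (n + 1)))"
    using of_nat_mono[OF card_small_subsets(2)[OF J(1), of "n + 1"], where 'a=real] p01
    by (intro ennreal_leI mult_right_mono) (simp_all only: of_nat_power zero_le_power diff_ge_0_iff_ge)
  finally show ?thesis .
qed

section \<open>Convex bodies and their uniform measure\<close>

definition mix :: "nat \<Rightarrow> real \<Rightarrow> (nat \<Rightarrow> real) \<Rightarrow> (nat \<Rightarrow> real) \<Rightarrow> nat \<Rightarrow> real" where
  "mix n s a b = (\<lambda>i\<in>{..<n}. s * a i + (1 - s) * b i)"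

lemma mix_in_Rn: "mix n s a b \<in> Rn n"
  by (simp add: mix_def Rn_def)

lemma mix_mem_convex:
  assumes "convex K" "K \<subseteq> Rn n" "a \<in> K" "b \<in> K" "0 \<le> s" "s \<le> 1"
  shows "mix n s a b \<in> K"
proof -
  have u: "a i = undefined" "b i = undefined" if "\<not> i < n" for i
    using assms(2-4) that by (auto simp: Rn_def PiE_def extensional_def)
  have "mix n s a b = s *\<^sub>R a + (1 - s) *\<^sub>R b"
    by (rule ext) (auto simp: mix_def scaleR_fun_def plus_fun_def u simp flip: distrib_right)
  then show ?thesis using convexD[OF assms(1,3,4), of s "1 - s"] assms by simp
qed

lemma inner_Rn_mix: "inner_Rn n u (mix n s a b) = s * inner_Rn n u a + (1 - s) * inner_Rn n u b"
  by (simp add: inner_Rn_def mix_def sum_distrib_left algebra_simps flip: sum.distrib)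

lemma inner_Rn_scale: "inner_Rn n (\<lambda>i. s * u i) x = s * inner_Rn n u x"
  by (simp add: inner_Rn_def sum_distrib_left algebra_simps)

text \<open>
  Functions in the product space are constant beyond \<open>n\<close>, so the Borel sets of the full function space
  can be used to check measurability in the product space over the first \<open>n\<close> indices.
\<close>

lemma measurable_identity_PiM_borel:
  "(\<lambda>x. x) \<in> measurable (\<Pi>\<^sub>M i\<in>{..<n::nat}. borel :: real measure) borel"
proof -
  have "(\<lambda>x. x) \<in> measurable (\<Pi>\<^sub>M i\<in>{..<n::nat}. borel :: real measure) (\<Pi>\<^sub>M i\<in>UNIV. borel)"
  proof (rule measurable_PiM_single')
    show "(\<lambda>x. x i) \<in> borel_measurable (\<Pi>\<^sub>M i\<in>{..<n::nat}. borel :: real measure)" for i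
    proof (cases "i < n")
      case False
      then have "x i = undefined" if "x \<in> space (\<Pi>\<^sub>M i\<in>{..<n::nat}. borel :: real measure)" for x
        using that by (auto simp: space_PiM PiE_iff extensional_def)
      then show ?thesis by (subst measurable_cong[where g="\<lambda>_. undefined"]) auto
    qed (auto intro: measurable_component_singleton)
  qed auto
  then show ?thesis by (simp add: measurable_cong_sets[OF refl sets_PiM_equal_borel])
qed

lemma closed_Int_Rn_sets:
  assumes "closed (C :: (nat \<Rightarrow> real) set)"
  shows "C \<inter> Rn n \<in> sets (\<Pi>\<^sub>M i\<in>{..<n}. borel)"
  using measurable_sets[OF measurable_identity_PiM_borel, of C n] assms
  by (simp add: space_PiM Rn_def vimage_def)

lemma closedin_powertop_sets:
  assumes "closedin (powertop_real {..<n::nat}) C"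
  shows "C \<in> sets (\<Pi>\<^sub>M i\<in>{..<n}. borel)"
proof -
  have C: "C \<subseteq> Rn n" using closedin_subset[OF assms] by (simp add: Rn_def)
  have "continuous_map euclidean (powertop_real {..<n}) (\<lambda>f. restrict f {..<n})"
    by (auto simp: continuous_map_componentwise intro!: continuous_on_product_coordinates)
  from closedin_continuous_map_preimage[OF this assms]
  have "closed {f. restrict f {..<n} \<in> C}" by simp
  from closed_Int_Rn_sets[OF this, of n]
  have "{f. restrict f {..<n} \<in> C} \<inter> Rn n \<in> sets (\<Pi>\<^sub>M i\<in>{..<n}. borel)" .
  also have "{f. restrict f {..<n} \<in> C} \<inter> Rn n = C"
    using C by (auto simp: Rn_def)
  finally show ?thesis .
qed

lemma interior_powertop_contains_box:
  assumes "(powertop_real {..<n::nat}) interior_of K \<noteq> {}"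
  obtains x e where "0 < e" "x \<in> Rn n" "PiE {..<n} (\<lambda>i. {x i - e..x i + e}) \<subseteq> K"
proof -
  obtain x where x: "x \<in> (powertop_real {..<n}) interior_of K" using assms by auto
  have "openin (powertop_real {..<n}) ((powertop_real {..<n}) interior_of K)" by simp
  then have "\<forall>x\<in>(powertop_real {..<n}) interior_of K. \<exists>V. (\<forall>i\<in>{..<n}. open (V i)) \<and> x \<in> PiE {..<n} V \<and>
      PiE {..<n} V \<subseteq> (powertop_real {..<n}) interior_of K"
    unfolding openin_product_topology_alt by simp
  from bspec[OF this x] obtain V where V: "\<And>i. i \<in> {..<n} \<Longrightarrow> open (V i)" "x \<in> PiE {..<n} V"
      "PiE {..<n} V \<subseteq> (powertop_real {..<n}) interior_of K" by auto
  have "\<exists>e>0. {x i - e..x i + e} \<subseteq> V i" if "i \<in> {..<n}" for i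
  proof -
    have "x i \<in> V i" using V(2) that by auto
    moreover have "open (V i)" using V(1) that by simp
    ultimately obtain e where "0 < e" "cball (x i) e \<subseteq> V i" by (auto simp: open_contains_cball)
    then show ?thesis by (auto simp: cball_eq_atLeastAtMost)
  qed
  then have "\<forall>i\<in>{..<n}. \<exists>e. 0 < e \<and> {x i - e..x i + e} \<subseteq> V i" by (rule ballI)
  from bchoice[OF this] obtain e where e0: "\<forall>i\<in>{..<n}. 0 < e i \<and> {x i - e i..x i + e i} \<subseteq> V i" ..
  have e: "0 < e i \<and> {x i - e i..x i + e i} \<subseteq> V i" if "i < n" for i
    using bspec[OF e0, of i] that by simp
  define d where "d = Min (insert 1 (e ` {..<n}))"
  have d: "0 < d" unfolding d_def using e by (subst Min_gr_iff) auto
  have dle: "d \<le> e i" if "i < n" for i unfolding d_def using that by (intro Min_le) auto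
  have "{x i - d..x i + d} \<subseteq> V i" if "i < n" for i
  proof -
    have "{x i - d..x i + d} \<subseteq> {x i - e i..x i + e i}" using dle[OF that] by auto
    also have "\<dots> \<subseteq> V i" using e[OF that] by simp
    finally show ?thesis .
  qed
  then have "PiE {..<n} (\<lambda>i. {x i - d..x i + d}) \<subseteq> PiE {..<n} V"
    by (intro PiE_mono) auto
  then have "PiE {..<n} (\<lambda>i. {x i - d..x i + d}) \<subseteq> K"
    using V(3) interior_of_subset[of "powertop_real {..<n}" K] by (meson order_trans)
  moreover have "x \<in> Rn n" using V(2) by (auto simp: Rn_def)
  ultimately show thesis by (intro that[OF d])
qed

locale body =
  fixes n :: nat and K :: "(nat \<Rightarrow> real) set"
  assumes n_pos: "1 \<le> n" and body: "convex_body n K"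
begin

abbreviation "vol \<equiv> lborelPi {..<n}"
abbreviation "\<mu> \<equiv> uniform_on n K"

lemma space_vol: "space vol = Rn n"
  by (simp add: space_PiM Rn_def)

lemma sets_vol: "sets vol = sets (\<Pi>\<^sub>M i\<in>{..<n}. borel)"
  by (intro sets_PiM_cong) auto

lemma sets_mu: "sets \<mu> = sets (\<Pi>\<^sub>M i\<in>{..<n}. borel)"
  by (simp add: uniform_on_def lborel_Rn_def sets_vol)

lemma sets_mu_vol: "sets \<mu> = sets vol"
  using sets_mu sets_vol by simp

lemma space_mu: "space \<mu> = Rn n"
  using sets_eq_imp_space_eq[OF sets_mu_vol] space_vol by simp

lemma K_Rn: "K \<subseteq> Rn n"
  using body by (auto simp: convex_body_def compactin_def Rn_def)

lemma K_convex: "convex K"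
  using body by (simp add: convex_body_def)

lemma K_sets: "K \<in> sets vol"
proof -
  have "Hausdorff_space (powertop_real {..<n})" by (simp add: Hausdorff_space_product_topology)
  then have "closedin (powertop_real {..<n}) K"
    using body by (auto simp: convex_body_def intro: compactin_imp_closedin)
  then show ?thesis using closedin_powertop_sets sets_vol by blast
qed

lemma K_bounded: obtains R where "0 < R" "K \<subseteq> PiE {..<n} (\<lambda>_. {-R..R})"
proof -
  have "\<exists>B. \<forall>x\<in>K. \<bar>x k\<bar> \<le> B" if "k < n" for k
  proof -
    have "continuous_map (powertop_real {..<n}) euclidean (\<lambda>x. x k)"
      using that by (intro continuous_map_product_projection) auto
    then have "compactin euclidean ((\<lambda>x. x k) ` K)"
      using body by (intro image_compactin[of "powertop_real {..<n}"]) (auto simp: convex_body_def)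
    then have "bounded ((\<lambda>x. x k) ` K)" by (simp add: compact_imp_bounded)
    then show ?thesis by (auto simp: bounded_iff)
  qed
  then have "\<forall>k\<in>{..<n}. \<exists>B. \<forall>x\<in>K. \<bar>x k\<bar> \<le> B" by simp
  from bchoice[OF this] obtain B where B0: "\<forall>k\<in>{..<n}. \<forall>x\<in>K. \<bar>x k\<bar> \<le> B k" ..
  have B: "\<bar>x k\<bar> \<le> B k" if "k < n" "x \<in> K" for k x
    using bspec[OF bspec[OF B0, of k] that(2)] that(1) by simp
  define R where "R = 1 + (\<Sum>k<n. \<bar>B k\<bar>)"
  have BR: "\<bar>B k\<bar> \<le> R" if "k < n" for k
    using member_le_sum[of k "{..<n}" "\<lambda>k. \<bar>B k\<bar>"] that unfolding R_def by simp
  have "\<bar>x k\<bar> \<le> R" if "x \<in> K" "k < n" for x k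
    using B[OF that(2,1)] BR[OF that(2)] by simp
  then have "K \<subseteq> PiE {..<n} (\<lambda>_. {-R..R})"
  proof (intro subsetI)
    fix x assume x: "x \<in> K" and B: "\<And>x k. x \<in> K \<Longrightarrow> k < n \<Longrightarrow> \<bar>x k\<bar> \<le> R"
    have "x \<in> extensional {..<n}" using x K_Rn by (auto simp: Rn_def PiE_def)
    moreover have "x k \<in> {-R..R}" if "k \<in> {..<n}" for k
      using B[OF x, of k] that by (simp add: abs_le_iff)
    ultimately show "x \<in> PiE {..<n} (\<lambda>_. {-R..R})" by (simp add: PiE_iff)
  qed
  moreover have "0 < R" unfolding R_def by (simp add: add_pos_nonneg sum_nonneg)
  ultimately show thesis by (intro that)
qed

lemma inner_bounded: "\<exists>B. \<forall>y\<in>K. \<bar>inner_Rn n \<theta> y\<bar> \<le> B"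
proof -
  obtain R where R: "0 < R" "K \<subseteq> PiE {..<n} (\<lambda>_. {-R..R})" using K_bounded .
  have "\<bar>inner_Rn n \<theta> y\<bar> \<le> (\<Sum>i<n. \<bar>\<theta> i\<bar> * R)" if "y \<in> K" for y
  proof -
    have "y \<in> PiE {..<n} (\<lambda>_. {-R..R})" using R(2) that by (rule subsetD)
    then have "y i \<in> {-R..R}" if "i < n" for i using that by (simp add: PiE_iff)
    then have "\<bar>y i\<bar> \<le> R" if "i < n" for i using that by (simp add: abs_le_iff minus_le_iff)
    then show ?thesis unfolding inner_Rn_def
      by (intro order_trans[OF sum_abs] sum_mono) (auto simp: abs_mult intro!: mult_left_mono)
  qed
  then show ?thesis by blast
qed

lemma inner_measurable[measurable]: "inner_Rn n \<theta> \<in> borel_measurable vol"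
  unfolding inner_Rn_def by measurable

lemma inner_measurable_mu[measurable]: "inner_Rn n \<theta> \<in> borel_measurable \<mu>"
  by (subst measurable_cong_sets[OF sets_mu_vol refl]) measurable

lemma box_emeasure_pos:
  assumes "0 < e"
  shows "0 < emeasure vol (PiE {..<n} (\<lambda>i. {x i - e..x i + e}))"
proof -
  interpret product_sigma_finite "\<lambda>i. lborel :: real measure" by unfold_locales
  have "emeasure vol (PiE {..<n} (\<lambda>i. {x i - e..x i + e})) = ennreal ((2 * e) ^ n)"
    using assms by (subst emeasure_PiM) (auto simp: prod_constant ennreal_power)
  then show ?thesis using assms by simp
qed

lemma K_emeasure_pos: "0 < emeasure vol K"
proof -
  have "(powertop_real {..<n}) interior_of K \<noteq> {}" using body by (simp add: convex_body_def)
  then obtain x e where e: "0 < e" "PiE {..<n} (\<lambda>i. {x i - e..x i + e}) \<subseteq> K"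
    by (rule interior_powertop_contains_box)
  show ?thesis
    by (rule less_le_trans[OF box_emeasure_pos[OF e(1)] emeasure_mono[OF e(2) K_sets]])
qed

lemma K_emeasure_finite: "emeasure vol K < \<infinity>"
proof -
  obtain R where R: "0 < R" "K \<subseteq> PiE {..<n} (\<lambda>_. {-R..R})" using K_bounded .
  have "emeasure vol K \<le> emeasure vol (PiE {..<n} (\<lambda>_. {-R..R}))"
    using R by (intro emeasure_mono sets_PiM_I_finite) auto
  also have "\<dots> < \<infinity>" by (subst emeasure_PiM_cube) auto
  finally show ?thesis .
qed

lemma measure_K_pos: "0 < measure vol K"
  using K_emeasure_pos K_emeasure_finite by (simp add: measure_def enn2real_positive_iff)

lemma emeasure_K: "emeasure vol K = ennreal (measure vol K)"
  using K_emeasure_finite by (intro emeasure_eq_ennreal_measure) auto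

lemma mu_uniform: "\<mu> = uniform_measure vol K"
  by (simp add: uniform_on_def lborel_Rn_def)

sublocale prob_space \<mu>
  unfolding mu_uniform using K_emeasure_pos K_emeasure_finite
  by (intro prob_space_uniform_measure) auto

lemma emeasure_Int_K:
  assumes "A \<in> sets vol"
  shows "emeasure vol (K \<inter> A) = ennreal (measure vol (K \<inter> A))"
proof -
  have "emeasure vol (K \<inter> A) \<le> emeasure vol K" by (intro emeasure_mono K_sets) auto
  then show ?thesis using K_emeasure_finite by (intro emeasure_eq_ennreal_measure) (auto simp: top_unique)
qed

lemma prob_eq: "A \<in> sets vol \<Longrightarrow> prob A = measure vol (K \<inter> A) / measure vol K"
  unfolding mu_uniform using K_sets K_emeasure_pos K_emeasure_finite by (subst measure_uniform_measure) auto

lemma nn_integral_mu: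
  "f \<in> borel_measurable vol \<Longrightarrow> (\<integral>\<^sup>+x. f x \<partial>\<mu>) = (\<integral>\<^sup>+x. f x * indicator K x \<partial>vol) / emeasure vol K"
  unfolding mu_uniform using K_sets by (intro nn_integral_uniform_measure) auto

lemma AE_in_K: "AE x in \<mu>. x \<in> K"
  unfolding mu_uniform using K_emeasure_pos K_emeasure_finite K_sets by (intro AE_uniform_measureI) auto

lemma borel_prob_Rn_mu: "borel_prob_Rn n \<mu>"
  using sets_mu prob_space_axioms by (simp add: borel_prob_Rn_def)

text \<open>
  The Laplace transform recentred at \<open>x\<close>; its infimum over \<open>\<theta>\<close> is the exponential of minus the Cramer
  transform at \<open>x\<close>, and it is in this form that the Cramer transform is used throughout.
\<close>

definition lap :: "(nat \<Rightarrow> real) \<Rightarrow> (nat \<Rightarrow> real) \<Rightarrow> real" where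
  "lap \<theta> x = (\<integral>y. exp (inner_Rn n \<theta> y - inner_Rn n \<theta> x) \<partial>\<mu>)"

lemma integrable_exp: "integrable \<mu> (\<lambda>y. exp (inner_Rn n \<theta> y - c))"
proof -
  obtain B where B: "\<forall>y\<in>K. \<bar>inner_Rn n \<theta> y\<bar> \<le> B" using inner_bounded[of \<theta>] ..
  show ?thesis
  proof (rule integrable_const_bound)
    show "AE y in \<mu>. norm (exp (inner_Rn n \<theta> y - c)) \<le> exp (B - c)"
      using AE_in_K by eventually_elim (use B in \<open>auto simp: abs_le_iff\<close>)
  qed measurable
qed

lemma ennreal_lap: "ennreal (lap \<theta> x) = (\<integral>\<^sup>+y. ennreal (exp (inner_Rn n \<theta> y - inner_Rn n \<theta> x)) \<partial>\<mu>)"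
  unfolding lap_def by (rule nn_integral_eq_integral[symmetric]) (auto intro: integrable_exp)

lemma lap_eq: "lap \<theta> x = (\<integral>y. exp (inner_Rn n \<theta> y) \<partial>\<mu>) * exp (- inner_Rn n \<theta> x)"
  unfolding lap_def by (simp add: exp_diff exp_minus field_simps)

lemma integral_exp_pos: "0 < (\<integral>y. exp (inner_Rn n \<theta> y) \<partial>\<mu>)"
proof -
  have "(\<integral>y. exp (inner_Rn n \<theta> y) \<partial>\<mu>) \<noteq> 0"
  proof
    assume "(\<integral>y. exp (inner_Rn n \<theta> y) \<partial>\<mu>) = 0"
    then have "AE y in \<mu>. exp (inner_Rn n \<theta> y) = 0"
      using integrable_exp[of \<theta> 0] by (subst (asm) integral_nonneg_eq_0_iff_AE) auto
    then show False by simp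
  qed
  then show ?thesis by (simp add: order_less_le)
qed

definition level :: "real \<Rightarrow> (nat \<Rightarrow> real) set" where
  "level c = {x \<in> Rn n. \<forall>\<theta>. exp (- c) \<le> lap \<theta> x}"

lemma level_sets: "level c \<in> sets vol"
proof -
  have "closed {x. \<forall>\<theta>. exp (- c) \<le> lap \<theta> x}"
  proof (rule closed_Collect_all)
    show "closed {x. exp (- c) \<le> lap \<theta> x}" for \<theta>
      unfolding lap_eq inner_Rn_def
      by (intro closed_Collect_le continuous_intros continuous_on_product_coordinates)
  qed
  from closed_Int_Rn_sets[OF this, of n] show ?thesis
    unfolding level_def sets_vol by (simp add: Int_def conj_commute)
qed

lemma level_mono: "c \<le> d \<Longrightarrow> level c \<subseteq> level d"
  unfolding level_def by (auto intro: order_trans[rotated])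

text \<open>
  This identifies the sets \<open>level c\<close> as the sublevel sets of the Cramer transform.
\<close>

lemma cramer_le_iff:
  assumes "x \<in> Rn n"
  shows "cramer n \<mu> x \<le> ereal c \<longleftrightarrow> x \<in> level c"
proof -
  let ?I = "\<lambda>\<theta>. \<integral>y. exp (inner_Rn n \<theta> y) \<partial>\<mu>"
  have iff: "ereal (inner_Rn n \<theta> x) - log_laplace n \<mu> \<theta> \<le> ereal c \<longleftrightarrow> exp (- c) \<le> lap \<theta> x" for \<theta>
  proof -
    have "log_laplace n \<mu> \<theta> = ereal (ln (?I \<theta>))"
      using integrable_exp[of \<theta> 0] by (simp add: log_laplace_def)
    then have "ereal (inner_Rn n \<theta> x) - log_laplace n \<mu> \<theta> \<le> ereal c \<longleftrightarrow> inner_Rn n \<theta> x - c \<le> ln (?I \<theta>)"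
      by auto
    also have "\<dots> \<longleftrightarrow> exp (inner_Rn n \<theta> x - c) \<le> ?I \<theta>"
      using integral_exp_pos[of \<theta>] by (simp add: ln_ge_iff)
    also have "\<dots> \<longleftrightarrow> exp (- c) \<le> lap \<theta> x"
      unfolding lap_eq by (simp add: exp_diff exp_minus field_simps)
    finally show ?thesis .
  qed
  have "(\<forall>\<theta>\<in>Rn n. exp (- c) \<le> lap \<theta> x) \<longleftrightarrow> (\<forall>\<theta>. exp (- c) \<le> lap \<theta> x)"
  proof (intro iffI allI ballI)
    fix \<theta> assume *: "\<forall>\<theta>\<in>Rn n. exp (- c) \<le> lap \<theta> x"
    have r: "restrict \<theta> {..<n} \<in> Rn n" by (simp add: Rn_def)
    have "inner_Rn n (restrict \<theta> {..<n}) = inner_Rn n \<theta>" by (simp add: inner_Rn_def fun_eq_iff)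
    then have "lap (restrict \<theta> {..<n}) x = lap \<theta> x" by (simp add: lap_def)
    with bspec[OF * r] show "exp (- c) \<le> lap \<theta> x" by simp
  qed auto
  then show ?thesis using assms unfolding cramer_def SUP_le_iff iff by (simp add: level_def)
qed

lemma cramer_nonneg: "0 \<le> cramer n \<mu> x"
proof -
  let ?z = "\<lambda>i\<in>{..<n}. 0::real"
  have "inner_Rn n ?z = (\<lambda>y. 0)" by (simp add: inner_Rn_def fun_eq_iff)
  then have "ereal (inner_Rn n ?z x) - log_laplace n \<mu> ?z = 0"
    by (simp add: log_laplace_def prob_space zero_ereal_def)
  moreover have "?z \<in> Rn n" by (simp add: Rn_def)
  ultimately show ?thesis unfolding cramer_def by (intro SUP_upper2[of ?z]) simp_all
qed

lemma e2ennreal_cramer_less_iff: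
  assumes "x \<in> Rn n" "0 \<le> r"
  shows "ennreal r < e2ennreal (cramer n \<mu> x) \<longleftrightarrow> x \<notin> level r"
proof -
  have "ennreal r < e2ennreal (cramer n \<mu> x) \<longleftrightarrow> ereal r < cramer n \<mu> x"
    using cramer_nonneg[of x] assms(2)
    by (cases "cramer n \<mu> x") (auto simp: ennreal_less_iff)
  then show ?thesis using cramer_le_iff[OF assms(1), of r] by auto
qed

lemma cramer_measurable: "(\<lambda>x. e2ennreal (cramer n \<mu> x)) \<in> borel_measurable \<mu>"
proof -
  have "cramer n \<mu> \<in> borel_measurable \<mu>"
  proof (subst borel_measurable_iff_Iic_ereal, rule allI)
    fix a :: ereal
    show "cramer n \<mu> -` {..a} \<inter> space \<mu> \<in> sets \<mu>"
    proof (cases a)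
      case (real c)
      have "cramer n \<mu> -` {..a} \<inter> space \<mu> = level c"
        using cramer_le_iff[of _ c] real by (auto simp: space_mu level_def)
      then show ?thesis using level_sets sets_mu_vol by simp
    next
      case MInf
      have "cramer n \<mu> -` {..a} \<inter> space \<mu> = {}"
      proof -
        have "\<not> cramer n \<mu> x \<le> -\<infinity>" for x
          using cramer_nonneg[of x] by (cases "cramer n \<mu> x") auto
        then show ?thesis using MInf by auto
      qed
      then show ?thesis by simp
    next
      case PInf
      then have "cramer n \<mu> -` {..a} \<inter> space \<mu> = space \<mu>" by auto
      then show ?thesis by simp
    qed
  qed
  then show ?thesis by measurable
qed

definition V :: "real \<Rightarrow> real" where "V c = prob (level c)"

lemma V_bounds: "0 \<le> V c" "V c \<le> 1"
  by (auto simp: V_def)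

lemma V_mono: "c \<le> d \<Longrightarrow> V c \<le> V d"
  unfolding V_def using level_sets sets_mu_vol by (intro finite_measure_mono level_mono) auto

lemma expect_cramer_layers:
  "expect_cramer n \<mu> = (\<integral>\<^sup>+r. ennreal (1 - V r) * indicator {0..} r \<partial>lborel)"
proof -
  have "expect_cramer n \<mu> = (\<integral>\<^sup>+r. emeasure \<mu> {x \<in> space \<mu>. ennreal r < e2ennreal (cramer n \<mu> x)} * indicator {0..} r \<partial>lborel)"
    unfolding expect_cramer_def by (rule nn_integral_layer_cake[OF cramer_measurable]) unfold_locales
  also have "\<dots> = (\<integral>\<^sup>+r. ennreal (1 - V r) * indicator {0..} r \<partial>lborel)"
  proof (rule nn_integral_cong)
    fix r :: real
    have "emeasure \<mu> {x \<in> space \<mu>. ennreal r < e2ennreal (cramer n \<mu> x)} = ennreal (1 - V r)" if "0 \<le> r"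
    proof -
      have "{x \<in> space \<mu>. ennreal r < e2ennreal (cramer n \<mu> x)} = space \<mu> - level r"
        using e2ennreal_cramer_less_iff[OF _ that] by (auto simp: space_mu)
      then show ?thesis using level_sets sets_mu_vol by (simp add: emeasure_eq_measure V_def prob_compl)
    qed
    then show "emeasure \<mu> {x \<in> space \<mu>. ennreal r < e2ennreal (cramer n \<mu> x)} * indicator {0..} r = ennreal (1 - V r) * indicator {0..} r"
      by (auto simp: indicator_def)
  qed
  finally show ?thesis .
qed

end

section \<open>Concentration of the Cramer transform\<close>

context body begin

text \<open>
  The image of \<open>K\<close> under the contraction with ratio \<open>s\<close> towards \<open>z\<close> lies in \<open>K\<close> and carries the fraction
  \<open>s ^ n\<close> of its volume.  Restricting the integral on the right to this image and substituting gives the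
  left-hand side.
\<close>

lemma lap_mix:
  assumes s: "0 < s" "s < 1" and z: "z \<in> K"
  shows "s ^ n * lap (\<lambda>i. s * \<theta> i) x \<le> lap \<theta> (mix n s x z)"
proof -
  define f where "f y = ennreal (exp (inner_Rn n \<theta> y - inner_Rn n \<theta> (mix n s x z))) * indicator K y" for y
  define g where "g y = ennreal (exp (inner_Rn n (\<lambda>i. s * \<theta> i) y - inner_Rn n (\<lambda>i. s * \<theta> i) x)) * indicator K y" for y
  note [measurable] = K_sets
  have [measurable]: "f \<in> borel_measurable vol" "g \<in> borel_measurable vol" unfolding f_def g_def by measurable
  have "ennreal (s ^ n) * (\<integral>\<^sup>+y. g y \<partial>vol) \<le> ennreal (s ^ n) * (\<integral>\<^sup>+y. f (\<lambda>i\<in>{..<n}. (1 - s) * z i + s * y i) \<partial>vol)"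
  proof (intro mult_left_mono nn_integral_mono)
    fix y assume "y \<in> space vol"
    have eq: "(\<lambda>i\<in>{..<n}. (1 - s) * z i + s * y i) = mix n s y z" by (auto simp: mix_def fun_eq_iff)
    show "g y \<le> f (\<lambda>i\<in>{..<n}. (1 - s) * z i + s * y i)"
    proof (cases "y \<in> K")
      case True
      then have "mix n s y z \<in> K" using mix_mem_convex[OF K_convex K_Rn _ z] s by simp
      then show ?thesis using True unfolding eq f_def g_def
        by (simp add: inner_Rn_mix inner_Rn_scale algebra_simps)
    qed (simp add: g_def)
  qed simp
  also have "\<dots> = (\<integral>\<^sup>+y. f y \<partial>vol)"
    using s nn_integral_PiM_affine[of "{..<n}" s f "\<lambda>i. (1 - s) * z i"] by simp
  finally have "ennreal (s ^ n) * (\<integral>\<^sup>+y. g y \<partial>vol) / emeasure vol K \<le> (\<integral>\<^sup>+y. f y \<partial>vol) / emeasure vol K"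
    by (rule divide_right_mono_ennreal)
  moreover have "(\<integral>\<^sup>+y. f y \<partial>vol) / emeasure vol K = ennreal (lap \<theta> (mix n s x z))"
    unfolding ennreal_lap f_def by (rule nn_integral_mu[symmetric]) measurable
  moreover have "(\<integral>\<^sup>+y. g y \<partial>vol) / emeasure vol K = ennreal (lap (\<lambda>i. s * \<theta> i) x)"
    unfolding ennreal_lap g_def by (rule nn_integral_mu[symmetric]) measurable
  ultimately have "ennreal (s ^ n) * ennreal (lap (\<lambda>i. s * \<theta> i) x) \<le> ennreal (lap \<theta> (mix n s x z))"
    by (simp flip: ennreal_times_divide)
  moreover have "0 \<le> lap \<theta> (mix n s x z)" by (simp add: lap_def)
  ultimately show ?thesis using s by (simp add: ennreal_mult'[symmetric])
qed

lemma level_mix: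
  assumes s: "0 < s" "s < 1" and z: "z \<in> K" and x: "x \<in> level c"
  shows "mix n s x z \<in> level (c - n * ln s)"
proof -
  have "exp (- (c - n * ln s)) \<le> lap \<theta> (mix n s x z)" for \<theta>
  proof -
    have "exp (- (c - n * ln s)) = s ^ n * exp (- c)"
      using s by (simp add: exp_diff exp_minus exp_of_nat_mult field_simps)
    also have "\<dots> \<le> s ^ n * lap (\<lambda>i. s * \<theta> i) x"
      using x s by (intro mult_left_mono) (auto simp: level_def)
    also have "\<dots> \<le> lap \<theta> (mix n s x z)" by (rule lap_mix[OF s z])
    finally show ?thesis .
  qed
  then show ?thesis by (simp add: level_def mix_in_Rn)
qed

lemma brunn_minkowski_prob:
  assumes s: "0 < s" "s < 1" and sets: "A \<in> sets vol" "B \<in> sets vol" "C \<in> sets vol"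
    and mix: "\<And>a b. a \<in> A \<Longrightarrow> b \<in> B \<Longrightarrow> a \<in> K \<Longrightarrow> b \<in> K \<Longrightarrow> mix n s a b \<in> C"
  shows "prob A powr s * prob B powr (1 - s) \<le> prob C"
proof -
  obtain R where R: "0 < R" "K \<subseteq> PiE {..<n} (\<lambda>_. {-R..R})" using K_bounded .
  have "ennreal (measure vol (K \<inter> A) powr s * measure vol (K \<inter> B) powr (1 - s)) \<le> emeasure vol (K \<inter> C)"
  proof (rule brunn_minkowski_PiM[OF _ _ _ _ s])
    show "(\<lambda>i\<in>{..<n}. s * a i + (1 - s) * b i) \<in> K \<inter> C" if "a \<in> K \<inter> A" "b \<in> K \<inter> B" for a b
      using mix[of a b] mix_mem_convex[OF K_convex K_Rn, of a b s] that s by (auto simp: mix_def)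
  qed (use K_sets sets R in auto)
  then have "measure vol (K \<inter> A) powr s * measure vol (K \<inter> B) powr (1 - s) \<le> measure vol (K \<inter> C)"
    unfolding emeasure_Int_K[OF sets(3)] by simp
  then have "measure vol (K \<inter> A) powr s * measure vol (K \<inter> B) powr (1 - s) / measure vol K \<le> measure vol (K \<inter> C) / measure vol K"
    using measure_K_pos by (intro divide_right_mono) auto
  moreover have "measure vol K powr s * measure vol K powr (1 - s) = measure vol K"
    using measure_K_pos by (simp flip: powr_add)
  ultimately show ?thesis
    using measure_K_pos by (simp add: prob_eq sets powr_divide)
qed

lemma V_powr:
  assumes s: "0 < s" "s < 1"
  shows "V c powr s \<le> V (c - n * ln s)"
proof -
  have "V c powr s * prob K powr (1 - s) \<le> V (c - n * ln s)"
    unfolding V_def by (rule brunn_minkowski_prob[OF s level_sets K_sets level_sets]) (rule level_mix[OF s])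
  moreover have "prob K = 1" using AE_in_K K_sets sets_mu_vol by (subst prob_eq_1) auto
  ultimately show ?thesis by simp
qed

text \<open>
  Take \<open>s = exp (- (r - c) / n)\<close> in \<open>V_powr\<close> and use \<open>1 + s ln q \<le> q powr s\<close>.
\<close>

lemma V_tail:
  assumes q: "0 < V c" and r: "c \<le> r"
  shows "1 - V r \<le> ln (1 / V c) * exp (- (r - c) / n)"
proof (cases "r = c")
  case True
  then show ?thesis using q ln_le_minus_one[OF q] by (simp add: ln_div)
next
  case False
  define s where "s = exp (- (r - c) / n)"
  have "(c - r) / n < 0" using False r n_pos by (intro divide_neg_pos) auto
  then have s: "0 < s" "s < 1" by (simp_all add: s_def)
  have "c - n * ln s = r" using n_pos by (simp add: s_def)
  then have "V c powr s \<le> V r" using V_powr[OF s, of c] by simp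
  moreover have "1 + s * ln (V c) \<le> V c powr s" using q by (simp add: powr_def)
  ultimately show ?thesis using q by (simp add: s_def ln_div algebra_simps)
qed

lemma expect_cramer_le:
  assumes q: "0 < V c" and c: "0 \<le> c"
  shows "expect_cramer n \<mu> \<le> ennreal (c + n * ln (1 / V c))"
proof -
  let ?L = "ln (1 / V c)"
  have L: "0 \<le> ?L" using q V_bounds[of c] by (simp add: ln_div)
  have tail: "(\<integral>\<^sup>+r. ennreal (?L * exp (- (r - c) / n)) * indicator {c..} r \<partial>lborel) = ennreal (0 - (- n * ?L * exp (- (c - c) / n)))"
  proof (rule nn_integral_FTC_atLeast[where F="\<lambda>r. - n * ?L * exp (- (r - c) / n)"])
    show "((\<lambda>r. - n * ?L * exp (- (r - c) / n)) has_real_derivative ?L * exp (- (r - c) / n)) (at r)" for r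
      using n_pos by (auto intro!: derivative_eq_intros simp: field_simps)
    show "((\<lambda>r. - n * ?L * exp (- (r - c) / n)) \<longlongrightarrow> 0) at_top"
    proof -
      have "filterlim (\<lambda>r. (r - c) / n) at_top at_top"
        unfolding filterlim_at_top eventually_at_top_linorder
      proof (intro allI exI impI)
        fix Z r :: real
        assume "Z * n + c \<le> r"
        then show "Z \<le> (r - c) / n" using n_pos by (simp add: field_simps)
      qed
      then have "((\<lambda>r. exp (- ((r - c) / n))) \<longlongrightarrow> 0) at_top"
        by (intro filterlim_compose[OF exp_at_bot] filterlim_uminus_at_bot_at_top[THEN filterlim_compose])
      from tendsto_mult_right_zero[OF this, of "- n * ?L"] show ?thesis
        by (simp only: minus_divide_left)
    qed
  qed (use L in auto)
  have "expect_cramer n \<mu> \<le> (\<integral>\<^sup>+r. indicator {0..c} r + ennreal (?L * exp (- (r - c) / n)) * indicator {c..} r \<partial>lborel)"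
    unfolding expect_cramer_layers
  proof (rule nn_integral_mono)
    fix r :: real
    show "ennreal (1 - V r) * indicator {0..} r \<le> indicator {0..c} r + ennreal (?L * exp (- (r - c) / n)) * indicator {c..} r"
    proof (cases "c \<le> r")
      case True
      have "ennreal (1 - V r) * indicator {0..} r \<le> ennreal (1 - V r)" by (auto simp: indicator_def)
      also have "\<dots> \<le> ennreal (?L * exp (- (r - c) / n))" by (rule ennreal_leI[OF V_tail[OF q True]])
      finally show ?thesis using True by (auto intro: add_increasing)
    next
      case False
      then show ?thesis using V_bounds[of r] by (auto simp: indicator_def intro!: ennreal_leI[of _ 1, simplified])
    qed
  qed
  also have "\<dots> = ennreal c + ennreal (n * ?L)"
    using tail c by (subst nn_integral_add) auto
  also have "\<dots> = ennreal (c + n * ?L)" using L c by (simp add: ennreal_plus)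
  finally show ?thesis .
qed

text \<open>
  The centre \<open>x0\<close> of a box inside \<open>K\<close> has finite Cramer transform: pairing points of the box that are
  symmetric about \<open>x0\<close> shows that the recentred Laplace transform at \<open>x0\<close> is at least the mass of the box.
  The sublevel sets then also contain the contracted copy of \<open>K\<close> towards \<open>x0\<close>, which has positive volume.
\<close>

lemma some_level_pos: "\<exists>c\<ge>0. 0 < V c"
proof -
  have "(powertop_real {..<n}) interior_of K \<noteq> {}" using body by (simp add: convex_body_def)
  then obtain x0 e where e: "0 < e" and x0: "x0 \<in> Rn n" and QK: "PiE {..<n} (\<lambda>i. {x0 i - e..x0 i + e}) \<subseteq> K"
    by (rule interior_powertop_contains_box)
  let ?Q = "PiE {..<n} (\<lambda>i. {x0 i - e..x0 i + e})"
  have Q[measurable]: "?Q \<in> sets vol" by (intro sets_PiM_I_finite) auto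
  note [measurable] = K_sets
  define q where "q = prob ?Q"
  have KQ: "K \<inter> ?Q = ?Q" using QK by auto
  have "0 < measure vol ?Q"
    using box_emeasure_pos[OF e, of x0] emeasure_Int_K[OF Q] unfolding KQ by (simp add: ennreal_zero_less_divide)
  then have q0: "0 < q" unfolding q_def prob_eq[OF Q] KQ using measure_K_pos by simp
  have "q \<le> lap \<theta> x0" for \<theta>
  proof -
    let ?g = "\<lambda>y. inner_Rn n \<theta> y - inner_Rn n \<theta> x0"
    let ?r = "\<lambda>y. \<lambda>i\<in>{..<n}. 2 * x0 i + (-1) * y i"
    let ?J = "\<integral>\<^sup>+y. ennreal (exp (?g y)) * indicator ?Q y \<partial>vol"
    have "?J = ennreal (\<bar>-1\<bar> ^ card {..<n}) * (\<integral>\<^sup>+y. ennreal (exp (?g (?r y))) * indicator ?Q (?r y) \<partial>vol)"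
      by (rule nn_integral_PiM_affine) auto
    also have "(\<integral>\<^sup>+y. ennreal (exp (?g (?r y))) * indicator ?Q (?r y) \<partial>vol) =
        (\<integral>\<^sup>+y. ennreal (exp (- ?g y)) * indicator ?Q y \<partial>vol)"
    proof (rule nn_integral_cong)
      fix y assume "y \<in> space vol"
      then have "y \<in> extensional {..<n}" by (auto simp: space_PiM PiE_def)
      then have "y \<in> ?Q \<longleftrightarrow> (\<forall>i<n. y i \<in> {x0 i - e..x0 i + e})" by (simp add: PiE_iff Ball_def)
      moreover have "?r y \<in> ?Q \<longleftrightarrow> (\<forall>i<n. 2 * x0 i - y i \<in> {x0 i - e..x0 i + e})" by (simp add: PiE_iff Ball_def)
      moreover have "2 * x0 i - y i \<in> {x0 i - e..x0 i + e} \<longleftrightarrow> y i \<in> {x0 i - e..x0 i + e}" for i by auto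
      ultimately have "?r y \<in> ?Q \<longleftrightarrow> y \<in> ?Q" by simp
      moreover have "?g (?r y) = - ?g y"
        by (simp add: inner_Rn_def algebra_simps sum_subtractf sum.distrib sum_distrib_left)
      ultimately show "ennreal (exp (?g (?r y))) * indicator ?Q (?r y) = ennreal (exp (- ?g y)) * indicator ?Q y"
        by (simp add: indicator_def)
    qed
    finally have J2: "?J = (\<integral>\<^sup>+y. ennreal (exp (- ?g y)) * indicator ?Q y \<partial>vol)" by simp
    have "2 * emeasure vol ?Q = (\<integral>\<^sup>+y. 2 * indicator ?Q y \<partial>vol)" by (simp add: nn_integral_cmult)
    also have "\<dots> \<le> (\<integral>\<^sup>+y. ennreal (exp (?g y)) * indicator ?Q y + ennreal (exp (- ?g y)) * indicator ?Q y \<partial>vol)"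
    proof (rule nn_integral_mono)
      fix y
      have "2 \<le> exp (?g y) + exp (- ?g y)"
        using exp_ge_add_one_self[of "?g y"] exp_ge_add_one_self[of "- ?g y"] by linarith
      then have "ennreal 2 \<le> ennreal (exp (?g y) + exp (- ?g y))" by (rule ennreal_leI)
      then show "2 * indicator ?Q y \<le> ennreal (exp (?g y)) * indicator ?Q y + ennreal (exp (- ?g y)) * indicator ?Q y"
        by (auto simp: indicator_def ennreal_plus)
    qed
    also have "\<dots> = ?J + (\<integral>\<^sup>+y. ennreal (exp (- ?g y)) * indicator ?Q y \<partial>vol)"
      by (rule nn_integral_add) measurable
    also have "\<dots> = 2 * ?J" unfolding J2[symmetric] by (simp add: mult_2)
    finally have "emeasure vol ?Q \<le> ?J" by (simp add: ennreal_mult_le_mult_iff)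
    also have "\<dots> \<le> (\<integral>\<^sup>+y. ennreal (exp (?g y)) * indicator K y \<partial>vol)"
      using QK by (intro nn_integral_mono) (auto simp: indicator_def)
    finally have "emeasure vol ?Q / emeasure vol K \<le> (\<integral>\<^sup>+y. ennreal (exp (?g y)) * indicator K y \<partial>vol) / emeasure vol K"
      by (rule divide_right_mono_ennreal)
    also have "\<dots> = ennreal (lap \<theta> x0)"
      unfolding ennreal_lap by (rule nn_integral_mu[symmetric]) measurable
    finally have "ennreal q \<le> ennreal (lap \<theta> x0)"
      unfolding q_def prob_eq[OF Q] using emeasure_Int_K[OF Q] measure_K_pos
      by (simp add: KQ emeasure_K divide_ennreal)
    moreover have "0 \<le> lap \<theta> x0" by (simp add: lap_def)
    ultimately show ?thesis by simp
  qed
  then have x0l: "x0 \<in> level (- ln q)" using x0 q0 by (simp add: level_def)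
  let ?c = "- ln q - n * ln (1 / 2)"
  let ?C = "K \<inter> level ?c"
  have [measurable]: "?C \<in> sets vol" using level_sets by auto
  have x0K: "x0 \<in> K" using QK e x0 by (auto simp: Rn_def PiE_iff subset_eq)
  have "emeasure vol ?C = (\<integral>\<^sup>+y. indicator ?C y \<partial>vol)" by simp
  also have "\<dots> = ennreal (\<bar>1 / 2\<bar> ^ card {..<n}) * (\<integral>\<^sup>+y. indicator ?C (\<lambda>i\<in>{..<n}. 1 / 2 * x0 i + 1 / 2 * y i) \<partial>vol)"
    by (rule nn_integral_PiM_affine) auto
  finally have eq: "emeasure vol ?C = ennreal ((1 / 2) ^ n) * (\<integral>\<^sup>+y. indicator ?C (\<lambda>i\<in>{..<n}. 1 / 2 * x0 i + 1 / 2 * y i) \<partial>vol)"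
    by simp
  have "0 < ennreal ((1 / 2) ^ n) * emeasure vol K"
    using K_emeasure_pos by (simp add: ennreal_zero_less_mult_iff)
  also have "ennreal ((1 / 2) ^ n) * emeasure vol K = ennreal ((1 / 2) ^ n) * (\<integral>\<^sup>+y. indicator K y \<partial>vol)" using K_sets by simp
  also have "\<dots> \<le> emeasure vol ?C"
    unfolding eq
  proof (intro mult_left_mono nn_integral_mono)
    fix y
    have "mix n (1 / 2) x0 y \<in> ?C" if "y \<in> K"
      using level_mix[of "1 / 2" y x0] x0l mix_mem_convex[OF K_convex K_Rn x0K that] that by auto
    then show "indicator K y \<le> (indicator ?C (\<lambda>i\<in>{..<n}. 1 / 2 * x0 i + 1 / 2 * y i) :: ennreal)"
      by (auto simp: indicator_def mix_def)
  qed simp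
  finally have "0 < emeasure vol ?C" .
  then have "0 < V ?c"
    unfolding V_def prob_eq[OF level_sets] using measure_K_pos emeasure_Int_K[OF level_sets] by simp
  then have "0 < V (max 0 ?c)" using V_mono[of ?c "max 0 ?c"] by simp
  then show ?thesis by (intro exI[of _ "max 0 ?c"]) simp
qed

definition T :: real where "T = enn2real (expect_cramer n \<mu>)"

lemma expect_cramer_eq: "expect_cramer n \<mu> = ennreal T"
proof -
  obtain c where "0 \<le> c" "0 < V c" using some_level_pos by auto
  from expect_cramer_le[OF this(2,1)] have "expect_cramer n \<mu> < \<infinity>" by (auto simp: less_top[symmetric] top_unique)
  then show ?thesis unfolding T_def by simp
qed

lemma T_nonneg: "0 \<le> T" by (simp add: T_def)

text \<open>
  The upper bound \<open>T \<le> c + n ln (1 / V c)\<close> on the mean, solved for \<open>V c\<close>.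
\<close>

lemma V_lower_tail:
  assumes "0 \<le> c"
  shows "V c \<le> exp (- (T - c) / n)"
proof (cases "V c = 0")
  case False
  then have q: "0 < V c" using V_bounds[of c] by simp
  have L: "0 \<le> ln (1 / V c)" using q V_bounds[of c] by (simp add: ln_div)
  then have "T \<le> c + n * ln (1 / V c)" using expect_cramer_le[OF q assms] assms
    unfolding expect_cramer_eq by (simp del: ennreal_plus)
  then have "ln (V c) \<le> - (T - c) / n" using q n_pos by (simp add: ln_div field_simps)
  then have "exp (ln (V c)) \<le> exp (- (T - c) / n)" by (simp only: exp_le_cancel_iff)
  then show ?thesis using q by simp
qed simp

lemma V_markov:
  assumes "0 < c"
  shows "1 - T / c \<le> V c"
proof -
  have "(\<integral>\<^sup>+r. ennreal (1 - V c) * indicator {0..c} r \<partial>lborel) \<le> expect_cramer n \<mu>"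
    unfolding expect_cramer_layers
    by (intro nn_integral_mono) (auto simp: indicator_def intro!: ennreal_leI V_mono)
  then have "ennreal ((1 - V c) * c) \<le> ennreal T"
    using assms V_bounds[of c] by (simp add: nn_integral_cmult expect_cramer_eq ennreal_mult)
  then have "(1 - V c) * c \<le> T" using T_nonneg by simp
  then show ?thesis using assms by (simp add: field_simps)
qed

lemma hyperplane_null: "emeasure vol {y \<in> space vol. y 0 = t} = 0"
proof -
  interpret product_sigma_finite "\<lambda>i. lborel :: real measure" by unfold_locales
  have "{y \<in> space vol. y 0 = t} = PiE {..<n} (\<lambda>i. if i = 0 then {t} else UNIV)"
    using n_pos by (auto simp: space_PiM PiE_def Pi_def extensional_def split: if_splits)
  then have "emeasure vol {y \<in> space vol. y 0 = t} = (\<Prod>i<n. emeasure lborel (if i = 0 then {t} else UNIV :: real set))"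
    by (simp only:) (rule emeasure_PiM, auto)
  also have "\<dots> = 0" using n_pos by (intro prod_zero) (auto intro!: bexI[of _ 0])
  finally show ?thesis .
qed

text \<open>
  If the Cramer transform vanished almost everywhere, the first coordinate would almost everywhere be at
  most the logarithm of its own exponential mean, hence constant, and \<open>K\<close> would lie in a hyperplane up to a
  null set.
\<close>

lemma T_pos: "0 < T"
proof (rule ccontr)
  assume "\<not> 0 < T"
  then have "(\<integral>\<^sup>+x. e2ennreal (cramer n \<mu> x) \<partial>\<mu>) = 0"
    using T_nonneg expect_cramer_eq by (simp add: expect_cramer_def)
  then have "AE x in \<mu>. e2ennreal (cramer n \<mu> x) = 0"
    using cramer_measurable by (subst (asm) nn_integral_0_iff_AE) auto
  then have AE: "AE x in \<mu>. x \<in> level 0"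
    using AE_space
  proof eventually_elim
    case (elim x)
    then have "\<not> ennreal 0 < e2ennreal (cramer n \<mu> x)" by simp
    then show ?case using e2ennreal_cramer_less_iff[of x 0] elim(2) by (simp add: space_mu)
  qed
  define \<theta> :: "nat \<Rightarrow> real" where "\<theta> = (\<lambda>i. if i = 0 then 1 else 0)"
  have in0: "inner_Rn n \<theta> y = y 0" for y
    using n_pos by (simp add: inner_Rn_def \<theta>_def if_distrib[of "\<lambda>c. c * _"] cong: if_cong)
  let ?I = "\<integral>y. exp (inner_Rn n \<theta> y) \<partial>\<mu>"
  have int: "integrable \<mu> (\<lambda>y. exp (inner_Rn n \<theta> y))" using integrable_exp[of \<theta> 0] by simp
  have le: "AE x in \<mu>. 0 \<le> ?I - exp (inner_Rn n \<theta> x)"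
    using AE
  proof eventually_elim
    case (elim x)
    then have "1 \<le> ?I * exp (- inner_Rn n \<theta> x)" unfolding level_def lap_eq by (auto dest: spec[of _ \<theta>])
    then show ?case by (simp add: exp_minus field_simps)
  qed
  have "(\<integral>x. ?I - exp (inner_Rn n \<theta> x) \<partial>\<mu>) = 0" using int by (simp add: prob_space)
  then have "AE x in \<mu>. ?I - exp (inner_Rn n \<theta> x) = 0"
    using int le by (subst (asm) integral_nonneg_eq_0_iff_AE) auto
  then have "AE x in \<mu>. x \<in> {y \<in> space vol. y 0 = ln ?I}"
    using AE_space by eventually_elim (auto simp: in0 space_mu space_vol)
  moreover have H: "{y \<in> space vol. y 0 = ln ?I} \<in> sets vol"
  proof -
    have [measurable]: "(\<lambda>y. y 0) \<in> borel_measurable vol"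
      using n_pos by (auto intro: measurable_component_singleton)
    show ?thesis by measurable
  qed
  ultimately have "prob {y \<in> space vol. y 0 = ln ?I} = 1"
    using sets_mu_vol by (subst prob_eq_1) auto
  moreover have "measure vol (K \<inter> {y \<in> space vol. y 0 = ln ?I}) = 0"
  proof -
    have "emeasure vol (K \<inter> {y \<in> space vol. y 0 = ln ?I}) \<le> emeasure vol {y \<in> space vol. y 0 = ln ?I}"
      using H by (intro emeasure_mono) auto
    then show ?thesis using hyperplane_null[of "ln ?I"] by (simp add: measure_def)
  qed
  ultimately show False using prob_eq[OF H] by simp
qed

end

section \<open>Half-space masses and the reversed Chernoff bound\<close>

text \<open>
  Layer cake: the tail of the integrand at height \<open>r\<close> is at most \<open>p * r powr (- 1 / (1 - \<eta>))\<close>, and it is at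
  most 1; the two bounds cross at \<open>m = p powr (1 - \<eta>)\<close>.
\<close>

lemma exp_moment_of_tail_bound:
  fixes Y :: "'a \<Rightarrow> real"
  assumes "prob_space M" and [measurable]: "Y \<in> borel_measurable M"
    and p: "0 < p" and D: "0 < D" and \<eta>: "0 < \<eta>" "\<eta> < 1"
    and tail: "\<And>y. measure M {x \<in> space M. y \<le> Y x} \<le> p * exp (- D * (y - t))"
  shows "(\<integral>\<^sup>+x. ennreal (exp ((1 - \<eta>) * D * (Y x - t))) \<partial>M) \<le> ennreal (p powr (1 - \<eta>) / \<eta>)"
proof -
  interpret prob_space M by fact
  define a where "a = 1 / (1 - \<eta>)"
  define m where "m = p powr (1 - \<eta>)"
  have a: "1 < a" and m: "0 < m" using \<eta> p by (auto simp: a_def m_def)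
  have FTC: "(\<integral>\<^sup>+r. ennreal (p * r powr (- a)) * indicator {m..} r \<partial>lborel) = ennreal (0 - (p / (1 - a) * m powr (1 - a)))"
  proof (rule nn_integral_FTC_atLeast[where F="\<lambda>r. p / (1 - a) * r powr (1 - a)"])
    show "((\<lambda>r. p / (1 - a) * r powr (1 - a)) has_real_derivative p * r powr (- a)) (at r)" if "m \<le> r" for r
    proof -
      have "((\<lambda>r. r powr (1 - a)) has_real_derivative (1 - a) * r powr (1 - a - 1)) (at r)"
        using that m by (intro has_real_derivative_powr) auto
      from DERIV_cmult[OF this, of "p / (1 - a)"] show ?thesis using a by simp
    qed
    have "((\<lambda>r. r powr (1 - a)) \<longlongrightarrow> 0) at_top"
      using a by (intro tendsto_neg_powr filterlim_ident) auto
    from tendsto_mult_right_zero[OF this, of "p / (1 - a)"]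
    show "((\<lambda>r. p / (1 - a) * r powr (1 - a)) \<longlongrightarrow> 0) at_top" .
  qed (use p in auto)
  let ?f = "\<lambda>x. exp ((1 - \<eta>) * D * (Y x - t))"
  have "(\<integral>\<^sup>+x. ennreal (?f x) \<partial>M) = (\<integral>\<^sup>+r. emeasure M {x\<in>space M. r < ?f x} * indicator {0..} r \<partial>lborel)"
    by (rule nn_integral_layer_cake_real) (measurable, unfold_locales)
  also have "\<dots> \<le> (\<integral>\<^sup>+r. indicator {0..m} r + ennreal (p * r powr (- a)) * indicator {m..} r \<partial>lborel)"
  proof (rule nn_integral_mono)
    fix r :: real
    show "emeasure M {x\<in>space M. r < ?f x} * indicator {0..} r \<le> indicator {0..m} r + ennreal (p * r powr (- a)) * indicator {m..} r"
    proof (cases "m \<le> r")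
      case True
      then have r: "0 < r" using m by simp
      define y where "y = t + ln r / ((1 - \<eta>) * D)"
      have "{x\<in>space M. r < ?f x} \<subseteq> {x \<in> space M. y \<le> Y x}"
      proof
        fix x assume x: "x \<in> {x\<in>space M. r < ?f x}"
        then have "ln r < ln (?f x)" using r by (subst ln_less_cancel_iff) auto
        then have "ln r < (1 - \<eta>) * D * (Y x - t)" by simp
        then have "y \<le> Y x" unfolding y_def using D \<eta> by (simp add: field_simps)
        then show "x \<in> {x \<in> space M. y \<le> Y x}" using x by simp
      qed
      then have "prob {x\<in>space M. r < ?f x} \<le> prob {x \<in> space M. y \<le> Y x}"
        by (intro finite_measure_mono) measurable
      also have "\<dots> \<le> p * exp (- D * (y - t))" by (rule tail)
      also have "exp (- D * (y - t)) = r powr (- a)"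
        using r D \<eta> by (simp add: y_def a_def powr_def field_simps)
      finally have "emeasure M {x\<in>space M. r < ?f x} \<le> ennreal (p * r powr (- a))"
        by (simp add: emeasure_eq_measure ennreal_leI)
      then show ?thesis using True by (auto simp: indicator_def intro: add_increasing)
    next
      case False
      then show ?thesis using emeasure_le_1 by (auto simp: indicator_def)
    qed
  qed
  also have "\<dots> = ennreal m + ennreal (0 - (p / (1 - a) * m powr (1 - a)))"
    using FTC m by (subst nn_integral_add) auto
  also have "\<dots> = ennreal (m + p * (1 - \<eta>) / \<eta> * m powr (1 - a))"
  proof -
    have "1 / (1 - a) = - ((1 - \<eta>) / \<eta>)" using \<eta> by (simp add: a_def field_simps)
    then have "0 - (p / (1 - a) * m powr (1 - a)) = p * (1 - \<eta>) / \<eta> * m powr (1 - a)"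
      by (metis (no_types, opaque_lifting) diff_0 divide_inverse inverse_eq_divide minus_mult_left minus_mult_right minus_minus mult.assoc times_divide_eq_right)
    then show ?thesis using m p \<eta> by (simp add: ennreal_plus)
  qed
  also have "m + p * (1 - \<eta>) / \<eta> * m powr (1 - a) = p powr (1 - \<eta>) / \<eta>"
  proof -
    have "(1 - \<eta>) * (1 - a) = - \<eta>" using \<eta> by (simp add: a_def field_simps)
    then have "m powr (1 - a) = p powr (- \<eta>)" by (simp add: m_def powr_powr)
    moreover have "p * p powr (- \<eta>) = p powr (1 - \<eta>)" using p by (simp add: powr_mult_base)
    ultimately have "p * (1 - \<eta>) / \<eta> * m powr (1 - a) = (1 - \<eta>) / \<eta> * m" 
      by (simp add: m_def mult_ac) 
    then show ?thesis using \<eta> by (simp add: field_simps m_def)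
  qed
  finally show ?thesis .
qed

context body begin

definition tail :: "(nat \<Rightarrow> real) \<Rightarrow> real \<Rightarrow> real" where
  "tail u t = prob {y \<in> space \<mu>. t \<le> inner_Rn n u y}"

lemma halfspace_sets: "{y \<in> space \<mu>. t \<le> inner_Rn n u y} \<in> sets vol"
  unfolding sets_mu_vol[symmetric] by measurable

lemma tail_bounds: "0 \<le> tail u t" "tail u t \<le> 1"
  by (auto simp: tail_def)

lemma tail_antimono: "s \<le> t \<Longrightarrow> tail u t \<le> tail u s"
  unfolding tail_def by (intro finite_measure_mono) auto

lemma tail_eq_1: "\<exists>a. tail u a = 1"
proof -
  obtain B where B: "\<forall>y\<in>K. \<bar>inner_Rn n u y\<bar> \<le> B" using inner_bounded[of u] ..
  have "AE y in \<mu>. y \<in> {y \<in> space \<mu>. - B \<le> inner_Rn n u y}"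
    using AE_in_K AE_space by eventually_elim (use B in \<open>auto simp: abs_le_iff\<close>)
  then have "tail u (- B) = 1" unfolding tail_def by (subst prob_eq_1) auto
  then show ?thesis ..
qed

lemma tail_log_concave:
  assumes "0 < s" "s < 1"
  shows "tail u a powr s * tail u b powr (1 - s) \<le> tail u (s * a + (1 - s) * b)"
  unfolding tail_def
proof (rule brunn_minkowski_prob[OF assms halfspace_sets halfspace_sets halfspace_sets])
  fix x y assume *: "x \<in> {y \<in> space \<mu>. a \<le> inner_Rn n u y}" "y \<in> {y \<in> space \<mu>. b \<le> inner_Rn n u y}"
  then have "s * a + (1 - s) * b \<le> s * inner_Rn n u x + (1 - s) * inner_Rn n u y"
    using assms by (intro add_mono mult_left_mono) auto
  then show "mix n s x y \<in> {y \<in> space \<mu>. s * a + (1 - s) * b \<le> inner_Rn n u y}"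
    by (simp add: inner_Rn_mix space_mu mix_in_Rn)
qed

text \<open>
  The exponent \<open>D\<close> is minus the slope of a tangent at \<open>t\<close> to the concave function \<open>ln (tail u y)\<close> of \<open>y\<close>.  Mass
  beyond \<open>t\<close> makes \<open>t\<close> an interior point of the domain of this function.  Since the tail is 1 far to the
  left but less than 1 at \<open>t\<close>, the slope is strictly negative.
\<close>

lemma tail_exponential_bound:
  assumes p: "tail u t < 1" and t1: "t < t1" "0 < tail u t1"
  shows "\<exists>D>0. \<forall>y. tail u y \<le> tail u t * exp (- D * (y - t))"
proof -
  let ?G = "tail u"
  let ?I = "{y. 0 < ?G y}"
  let ?f = "\<lambda>y. - ln (?G y)"
  have pp: "0 < ?G t" using tail_antimono[of t t1 u] t1 by simp
  have Iconv: "convex ?I"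
  proof (rule convexI)
    fix x y a b :: real assume *: "x \<in> ?I" "y \<in> ?I" "0 \<le> a" "0 \<le> b" "a + b = 1"
    have "a *\<^sub>R x + b *\<^sub>R y \<le> max x y"
      using convex_bound_le[of x "max x y" y a b] * by simp
    then have "?G (max x y) \<le> ?G (a *\<^sub>R x + b *\<^sub>R y)" by (rule tail_antimono)
    moreover have "0 < ?G (max x y)" using * by (simp add: max_def)
    ultimately show "a *\<^sub>R x + b *\<^sub>R y \<in> ?I" by simp
  qed
  have fconv: "convex_on ?I ?f"
  proof (rule convex_onI[OF _ Iconv])
    fix s x y assume *: "0 < s" "s < (1::real)" "x \<in> ?I" "y \<in> ?I"
    have pos: "0 < ?G x powr (1 - s) * ?G y powr s" using * by simp
    have le: "?G x powr (1 - s) * ?G y powr s \<le> ?G ((1 - s) * x + s * y)"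
      using tail_log_concave[of "1 - s" u x y] * by simp
    have "ln (?G x powr (1 - s) * ?G y powr s) \<le> ln (?G ((1 - s) * x + s * y))"
      using le pos by (subst ln_le_cancel_iff) auto
    moreover have "ln (?G x powr (1 - s) * ?G y powr s) = (1 - s) * ln (?G x) + s * ln (?G y)"
      using * by (simp add: ln_mult ln_powr)
    ultimately show "?f ((1 - s) *\<^sub>R x + s *\<^sub>R y) \<le> (1 - s) * ?f x + s * ?f y" by simp
  qed
  have "{..<t1} \<subseteq> ?I"
  proof
    fix y assume "y \<in> {..<t1}"
    then have "?G t1 \<le> ?G y" by (intro tail_antimono) auto
    then show "y \<in> ?I" using t1 by simp
  qed
  then have tint: "t \<in> interior ?I" using t1 by (intro interiorI[of "{..<t1}"]) auto
  define D where "D = Inf ((\<lambda>x. (?f t - ?f x) / (t - x)) ` ({t<..} \<inter> ?I))"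
  have sub: "?f t + D * (y - t) \<le> ?f y" if "y \<in> ?I" for y
    using convex_le_Inf_differential[OF fconv tint that] unfolding D_def by simp
  have bound: "?G y \<le> ?G t * exp (- D * (y - t))" for y
  proof (cases "0 < ?G y")
    case True
    then have "ln (?G y) \<le> ln (?G t) - D * (y - t)" using sub[of y] by simp
    then have "exp (ln (?G y)) \<le> exp (ln (?G t) - D * (y - t))" by (simp only: exp_le_cancel_iff)
    also have "exp (ln (?G t) - D * (y - t)) = exp (ln (?G t)) * exp (- D * (y - t))"
      by (simp flip: exp_add)
    finally show ?thesis using True pp by simp
  next
    case False
    then show ?thesis using pp tail_bounds[of u y] by simp
  qed
  obtain a where a: "?G a = 1" using tail_eq_1 ..
  have "a < t"
  proof (rule ccontr)
    assume "\<not> a < t"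
    then have "?G a \<le> ?G t" by (intro tail_antimono) simp
    then show False using a p by simp
  qed
  have "1 \<le> ?G t * exp (- D * (a - t))" using bound[of a] a by simp
  also have "\<dots> < 1 * exp (- D * (a - t))" using p by (intro mult_strict_right_mono) auto
  finally have "0 < D * (t - a)" by (simp add: algebra_simps)
  then have "0 < D" using \<open>a < t\<close> by (simp add: zero_less_mult_iff)
  then show ?thesis using bound by blast
qed

lemma level_nonneg:
  assumes "x \<in> level c" shows "0 \<le> c"
proof -
  have "inner_Rn n (\<lambda>i. 0) y = 0" for y by (simp add: inner_Rn_def)
  then have "lap (\<lambda>i. 0) x = 1" by (simp add: lap_def prob_space)
  then have "exp (- c) \<le> 1" using assms by (auto simp: level_def dest: spec[of _ "\<lambda>i. 0"])
  then show ?thesis by simp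
qed

text \<open>
  Only multiples of \<open>u\<close> are used as directions in the definition of the level.  In the generic case the
  multiple \<open>(1 - \<eta>) D\<close> is taken, with \<open>D\<close> from the tangent to the logarithm of the tail.  If no mass lies
  strictly beyond \<open>x\<close>, there may be no tangent, but large multiples of \<open>u\<close> isolate the mass of the
  bounding hyperplane itself and give even \<open>exp (- c)\<close>.
\<close>

lemma tail_at_level:
  assumes x: "x \<in> level c" and \<eta>: "0 < \<eta>" "\<eta> < 1"
  shows "exp (- (c - ln \<eta>) / (1 - \<eta>)) \<le> tail u (inner_Rn n u x)"
proof -
  let ?t = "inner_Rn n u x" and ?Y = "inner_Rn n u"
  let ?p = "tail u ?t"
  have c: "0 \<le> c" by (rule level_nonneg[OF x])
  have ln\<eta>: "ln \<eta> < 0" using \<eta> by simp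
  have *: "- (c - ln \<eta>) / (1 - \<eta>) \<le> - c"
  proof -
    have "c * (1 - \<eta>) \<le> c" using c \<eta> by (simp add: mult_left_le)
    then have "c * (1 - \<eta>) \<le> c - ln \<eta>" using ln\<eta> by simp
    then show ?thesis using \<eta> by (simp add: field_simps)
  qed
  have scaled: "exp (- c) \<le> (\<integral>y. exp (k * (?Y y - ?t)) \<partial>\<mu>)" for k
  proof -
    have "exp (- c) \<le> lap (\<lambda>i. k * u i) x" using x by (simp add: level_def)
    then show ?thesis by (simp add: lap_def inner_Rn_scale algebra_simps)
  qed
  consider "prob {y \<in> space \<mu>. ?t < ?Y y} = 0" | "?p = 1" | "prob {y \<in> space \<mu>. ?t < ?Y y} \<noteq> 0" "?p < 1"
    using tail_bounds[of u ?t] by fastforce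
  then show ?thesis
  proof cases
    case 1
    then have AE: "AE y in \<mu>. ?Y y \<le> ?t"
      by (subst (asm) prob_eq_0) (auto simp: not_less)
    have "(\<lambda>k. \<integral>y. exp (real k * (?Y y - ?t)) \<partial>\<mu>) \<longlonglongrightarrow> (\<integral>y. indicator {y \<in> space \<mu>. ?t \<le> ?Y y} y \<partial>\<mu>)"
    proof (rule integral_dominated_convergence[where w="\<lambda>_. 1"])
      show "AE y in \<mu>. (\<lambda>k. exp (real k * (?Y y - ?t))) \<longlonglongrightarrow> indicator {y \<in> space \<mu>. ?t \<le> ?Y y} y"
        using AE AE_space
      proof eventually_elim
        case (elim y)
        show ?case
        proof (cases "?Y y = ?t")
          case True
          then show ?thesis using elim by simp
        next
          case False
          then have lt: "?Y y - ?t < 0" using elim by simp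
          have "(\<lambda>k. exp (?Y y - ?t) ^ k) \<longlonglongrightarrow> 0"
            using lt by (intro LIMSEQ_realpow_zero) auto
          then show ?thesis using lt by (simp add: exp_of_nat_mult indicator_def)
        qed
      qed
      show "AE y in \<mu>. norm (exp (real k * (?Y y - ?t))) \<le> 1" for k
        using AE by eventually_elim (simp add: mult_nonneg_nonpos)
    qed auto
    then have "exp (- c) \<le> (\<integral>y. indicator {y \<in> space \<mu>. ?t \<le> ?Y y} y \<partial>\<mu>)"
      by (rule LIMSEQ_le_const) (use scaled in blast)
    moreover have "{y \<in> space \<mu>. ?t \<le> ?Y y} \<inter> space \<mu> = {y \<in> space \<mu>. ?t \<le> ?Y y}" by auto
    ultimately have "exp (- c) \<le> ?p" by (simp add: tail_def)
    then show ?thesis using * by (meson exp_le_cancel_iff order_trans)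
  next
    case 2
    have "exp (- (c - ln \<eta>) / (1 - \<eta>)) \<le> exp 0" using * c by (simp only: exp_le_cancel_iff)
    then show ?thesis using 2 by simp
  next
    case 3
    have "\<exists>k. 0 < tail u (?t + 1 / real (Suc k))"
    proof (rule ccontr)
      assume none: "\<not> (\<exists>k. 0 < tail u (?t + 1 / real (Suc k)))"
      have z: "tail u (?t + 1 / real (Suc k)) = 0" for k
      proof -
        have "\<not> 0 < tail u (?t + 1 / real (Suc k))" using none by (rule contrapos_nn) (rule exI)
        then show ?thesis using tail_bounds(1)[of u "?t + 1 / real (Suc k)"] by linarith
      qed
      have "{y \<in> space \<mu>. ?t < ?Y y} = (\<Union>k. {y \<in> space \<mu>. ?t + 1 / real (Suc k) \<le> ?Y y})"
      proof (intro equalityI subsetI)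
        fix y assume y: "y \<in> {y \<in> space \<mu>. ?t < ?Y y}"
        then obtain k where "1 / real (Suc k) < ?Y y - ?t"
          using nat_approx_posE[of "?Y y - ?t"] by auto
        then show "y \<in> (\<Union>k. {y \<in> space \<mu>. ?t + 1 / real (Suc k) \<le> ?Y y})" using y by (auto intro!: exI[of _ k])
      next
        fix y assume "y \<in> (\<Union>k. {y \<in> space \<mu>. ?t + 1 / real (Suc k) \<le> ?Y y})"
        then obtain k where "y \<in> space \<mu>" "?t + 1 / real (Suc k) \<le> ?Y y" by auto
        moreover have "?t < ?t + 1 / real (Suc k)" by simp
        ultimately have "?t < ?Y y" by linarith
        then show "y \<in> {y \<in> space \<mu>. ?t < ?Y y}" using \<open>y \<in> space \<mu>\<close> by simp
      qed
      moreover have "prob (\<Union>k. {y \<in> space \<mu>. ?t + 1 / real (Suc k) \<le> ?Y y}) = 0"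
        using z unfolding tail_def by (intro measure_eq_0_null_sets null_sets_UN) (auto simp: null_sets_def emeasure_eq_measure)
      ultimately show False using 3 by simp
    qed
    then obtain k where "0 < tail u (?t + 1 / real (Suc k))" ..
    moreover have "?t < ?t + 1 / real (Suc k)" by simp
    ultimately obtain D where D: "0 < D" "\<And>y. tail u y \<le> ?p * exp (- D * (y - ?t))"
      using tail_exponential_bound[OF 3(2)] by blast
    have "0 < ?p"
      using tail_antimono[of ?t "?t + 1 / real (Suc k)" u] \<open>0 < tail u (?t + 1 / real (Suc k))\<close> by simp
    have "ennreal (exp (- c)) \<le> ennreal (\<integral>y. exp ((1 - \<eta>) * D * (?Y y - ?t)) \<partial>\<mu>)"
      by (rule ennreal_leI[OF scaled])
    also have "\<dots> = (\<integral>\<^sup>+y. ennreal (exp ((1 - \<eta>) * D * (?Y y - ?t))) \<partial>\<mu>)"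
    proof (rule nn_integral_eq_integral[symmetric])
      show "integrable \<mu> (\<lambda>y. exp ((1 - \<eta>) * D * (?Y y - ?t)))"
        using integrable_exp[of "\<lambda>i. (1 - \<eta>) * D * u i" "(1 - \<eta>) * D * ?t"]
        by (simp add: inner_Rn_scale right_diff_distrib)
    qed auto
    also have "\<dots> \<le> ennreal (?p powr (1 - \<eta>) / \<eta>)"
      by (rule exp_moment_of_tail_bound[OF prob_space_axioms _ \<open>0 < ?p\<close> D(1) \<eta>])
        (use D(2) in \<open>auto simp: tail_def\<close>)
    finally have "exp (- c) \<le> ?p powr (1 - \<eta>) / \<eta>" using \<eta> by simp
    then have "ln (exp (- c)) \<le> ln (?p powr (1 - \<eta>) / \<eta>)"
      using \<open>0 < ?p\<close> \<eta> by (subst ln_le_cancel_iff) auto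
    then have "- (c - ln \<eta>) / (1 - \<eta>) \<le> ln ?p"
      using \<open>0 < ?p\<close> \<eta> by (simp add: ln_div ln_powr field_simps)
    then have "exp (- (c - ln \<eta>) / (1 - \<eta>)) \<le> exp (ln ?p)" by (simp only: exp_le_cancel_iff)
    then show ?thesis using \<open>0 < ?p\<close> by simp
  qed
qed

end

section \<open>The expected mass of a random convex hull\<close>

text \<open>
  Fubini.  That \<open>x\<close> lies in the hull is a measurable condition on \<open>x\<close> and the sample jointly, because it
  says that \<open>hull_sqd\<close> vanishes; without this measurability the Bochner integral in \<open>expect_hull\<close> would
  carry no information.
\<close>

lemma expect_hull_eq:
  assumes "prob_space \<mu>" and \<mu>: "sets \<mu> = sets (\<Pi>\<^sub>M i\<in>{..<n}. borel)" and N: "1 \<le> N"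
  shows "ennreal (expect_hull \<mu> N) =
      (\<integral>\<^sup>+x. emeasure (\<Pi>\<^sub>M j\<in>{1..N}. \<mu>) {X \<in> space (\<Pi>\<^sub>M j\<in>{1..N}. \<mu>). x \<in> convex hull (X ` {1..N})} \<partial>\<mu>)"
    and "x \<in> space \<mu> \<Longrightarrow> {X \<in> space (\<Pi>\<^sub>M j\<in>{1..N}. \<mu>). x \<in> convex hull (X ` {1..N})} \<in> sets (\<Pi>\<^sub>M j\<in>{1..N}. \<mu>)"
proof -
  let ?J = "{1..N}"
  let ?P = "\<Pi>\<^sub>M j\<in>?J. \<mu>"
  interpret M: prob_space \<mu> by fact
  interpret Q: prob_space ?P by (intro prob_space_PiM assms)
  interpret pair_sigma_finite \<mu> ?P ..
  have J: "finite ?J" "?J \<noteq> {}" using N by auto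
  have sp: "space \<mu> = Rn n" using sets_eq_imp_space_eq[OF \<mu>] by (simp add: space_PiM Rn_def)
  have k: "(\<lambda>y. y k) \<in> borel_measurable \<mu>" if "k < n" for k
    using that unfolding measurable_cong_sets[OF \<mu> refl] by (auto intro: measurable_component_singleton)
  define A where "A = {\<omega> \<in> space (\<mu> \<Otimes>\<^sub>M ?P). hull_sqd n ?J (snd \<omega>) (fst \<omega>) = 0}"
  have m: "(\<lambda>\<omega>. hull_sqd n ?J (snd \<omega>) (fst \<omega>)) \<in> borel_measurable (\<mu> \<Otimes>\<^sub>M ?P)"
  proof (rule borel_measurable_hull_sqd[OF J])
    show "(\<lambda>\<omega>. fst \<omega> i) \<in> borel_measurable (\<mu> \<Otimes>\<^sub>M ?P)" if "i < n" for i
      by (rule measurable_compose[OF measurable_fst k[OF that]])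
    show "(\<lambda>\<omega>. snd \<omega> j i) \<in> borel_measurable (\<mu> \<Otimes>\<^sub>M ?P)" if "j \<in> ?J" "i < n" for j i
      by (rule measurable_compose[OF measurable_compose[OF measurable_snd measurable_component_singleton[OF that(1)]] k[OF that(2)]])
  qed
  have A: "A \<in> sets (\<mu> \<Otimes>\<^sub>M ?P)"
    unfolding A_def by (intro borel_measurable_eq[OF m] borel_measurable_const)
  have hull: "(x, X) \<in> A \<longleftrightarrow> x \<in> convex hull (X ` ?J)" if "x \<in> space \<mu>" "X \<in> space ?P" for x X
  proof -
    have X: "X j \<in> Rn n" if "j \<in> ?J" for j using \<open>X \<in> space ?P\<close> that sp by (auto simp: space_PiM)
    show ?thesis unfolding A_def
      using hull_sqd_eq_0_iff[OF J _ X, of x] that sp by (simp add: space_pair_measure)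
  qed
  have A_sub: "A \<subseteq> space \<mu> \<times> space ?P" unfolding A_def by (auto simp: space_pair_measure)
  have sec1: "Pair x -` A = {X \<in> space ?P. x \<in> convex hull (X ` ?J)}" if "x \<in> space \<mu>" for x
    using hull[OF that] A_sub by auto
  then show "x \<in> space \<mu> \<Longrightarrow> {X \<in> space ?P. x \<in> convex hull (X ` ?J)} \<in> sets ?P"
    using sets_Pair1[OF A, of x] by simp
  have sec2: "(\<lambda>x. (x, X)) -` A = convex hull (X ` ?J)" if "X \<in> space ?P" for X
  proof -
    have "X ` ?J \<subseteq> Rn n" using that sp by (auto simp: space_PiM)
    from convex_hull_subset_Rn[OF this] show ?thesis using hull[OF _ that] A_sub sp by auto
  qed
  have meas: "(\<lambda>X. emeasure \<mu> ((\<lambda>x. (x, X)) -` A)) \<in> borel_measurable ?P"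
    by (rule measurable_emeasure_Pair2[OF A])
  then have "(\<lambda>X. measure \<mu> ((\<lambda>x. (x, X)) -` A)) \<in> borel_measurable ?P"
    unfolding measure_def by measurable
  then have "integrable ?P (\<lambda>X. measure \<mu> ((\<lambda>x. (x, X)) -` A))"
    by (intro Q.integrable_const_bound[where B=1]) auto
  then have "ennreal (\<integral>X. measure \<mu> ((\<lambda>x. (x, X)) -` A) \<partial>?P) = (\<integral>\<^sup>+X. ennreal (measure \<mu> ((\<lambda>x. (x, X)) -` A)) \<partial>?P)"
    by (intro nn_integral_eq_integral[symmetric]) auto
  also have "\<dots> = (\<integral>\<^sup>+X. emeasure \<mu> ((\<lambda>x. (x, X)) -` A) \<partial>?P)"
    by (simp add: M.emeasure_eq_measure)
  also have "\<dots> = emeasure (\<mu> \<Otimes>\<^sub>M ?P) A" by (rule emeasure_pair_measure_alt2[OF A, symmetric])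
  also have "\<dots> = (\<integral>\<^sup>+x. emeasure ?P (Pair x -` A) \<partial>\<mu>)" by (rule Q.emeasure_pair_measure_alt[OF A])
  also have "\<dots> = (\<integral>\<^sup>+x. emeasure ?P {X \<in> space ?P. x \<in> convex hull (X ` ?J)} \<partial>\<mu>)"
    by (intro nn_integral_cong) (simp add: sec1)
  also have "(\<integral>X. measure \<mu> ((\<lambda>x. (x, X)) -` A) \<partial>?P) = expect_hull \<mu> N"
    unfolding expect_hull_def by (intro Bochner_Integration.integral_cong refl) (simp add: sec2)
  finally show "ennreal (expect_hull \<mu> N) = (\<integral>\<^sup>+x. emeasure ?P {X \<in> space ?P. x \<in> convex hull (X ` ?J)} \<partial>\<mu>)" .
qed

lemma inner_Rn_less_of_hull:
  assumes "x \<in> convex hull S" "\<And>y. y \<in> S \<Longrightarrow> inner_Rn n u y < c"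
  shows "inner_Rn n u x < c"
proof -
  have lin: "inner_Rn n u (a *\<^sub>R y + b *\<^sub>R z) = a * inner_Rn n u y + b * inner_Rn n u z" for a b y z
    by (simp add: inner_Rn_def scaleR_fun_def plus_fun_def sum_distrib_left algebra_simps sum.distrib)
  have "convex {y. inner_Rn n u y < c}"
    by (rule convexI) (auto simp: lin intro: convex_bound_lt)
  then have "convex hull S \<subseteq> {y. inner_Rn n u y < c}"
    using assms(2) by (intro hull_minimal) auto
  then show ?thesis using assms(1) by auto
qed

context body begin

lemma chernoff: "emeasure \<mu> {y \<in> space \<mu>. inner_Rn n \<theta> x \<le> inner_Rn n \<theta> y} \<le> ennreal (lap \<theta> x)"
proof -
  have "emeasure \<mu> {y \<in> space \<mu>. inner_Rn n \<theta> x \<le> inner_Rn n \<theta> y} =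
      (\<integral>\<^sup>+y. indicator {y \<in> space \<mu>. inner_Rn n \<theta> x \<le> inner_Rn n \<theta> y} y \<partial>\<mu>)"
    by (intro nn_integral_indicator[symmetric]) measurable
  also have "\<dots> \<le> ennreal (lap \<theta> x)"
    unfolding ennreal_lap
    by (intro nn_integral_mono) (auto simp: indicator_def)
  finally show ?thesis .
qed

lemma prob_in_hull_le:
  fixes N :: nat
  assumes x: "x \<in> Rn n" "x \<notin> level t"
  shows "emeasure (\<Pi>\<^sub>M j\<in>{1..N}. \<mu>) {X \<in> space (\<Pi>\<^sub>M j\<in>{1..N}. \<mu>). x \<in> convex hull (X ` {1..N})} \<le> ennreal (N * exp (- t))"
proof -
  let ?J = "{1..N}"
  let ?P = "\<Pi>\<^sub>M j\<in>?J. \<mu>"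
  interpret P: product_prob_space "\<lambda>_. \<mu>" ?J ..
  obtain \<theta> where \<theta>: "lap \<theta> x < exp (- t)" using x by (auto simp: level_def not_le)
  define H where "H = {y \<in> space \<mu>. inner_Rn n \<theta> x \<le> inner_Rn n \<theta> y}"
  have H: "H \<in> sets \<mu>" unfolding H_def by measurable
  have S: "{X \<in> space ?P. X j \<in> H} \<in> sets ?P" if "j \<in> ?J" for j
    using measurable_sets[OF measurable_component_singleton[OF that, of "\<lambda>_. \<mu>"] H]
    by (simp add: vimage_def Int_def conj_commute)
  have "{X \<in> space ?P. x \<in> convex hull (X ` ?J)} \<subseteq> (\<Union>j\<in>?J. {X \<in> space ?P. X j \<in> H})"
  proof
    fix X assume X: "X \<in> {X \<in> space ?P. x \<in> convex hull (X ` ?J)}"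
    have "\<exists>j\<in>?J. inner_Rn n \<theta> x \<le> inner_Rn n \<theta> (X j)"
    proof (rule ccontr)
      assume "\<not> ?thesis"
      then have "inner_Rn n \<theta> x < inner_Rn n \<theta> x"
        using X by (intro inner_Rn_less_of_hull[of x "X ` ?J"]) auto
      then show False by simp
    qed
    then obtain j where j: "j \<in> ?J" "inner_Rn n \<theta> x \<le> inner_Rn n \<theta> (X j)" ..
    moreover have "X j \<in> space \<mu>" using X j(1) by (auto simp: space_PiM)
    ultimately show "X \<in> (\<Union>j\<in>?J. {X \<in> space ?P. X j \<in> H})" using X unfolding H_def by blast
  qed
  then have "emeasure ?P {X \<in> space ?P. x \<in> convex hull (X ` ?J)} \<le> emeasure ?P (\<Union>j\<in>?J. {X \<in> space ?P. X j \<in> H})"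
    using S by (intro emeasure_mono sets.finite_UN) auto
  also have "\<dots> \<le> (\<Sum>j\<in>?J. emeasure ?P {X \<in> space ?P. X j \<in> H})"
    using S by (intro emeasure_subadditive_finite) auto
  also have "\<dots> = (\<Sum>j\<in>?J. emeasure \<mu> H)"
    by (intro sum.cong refl P.emeasure_PiM_Collect_single H)
  also have "\<dots> \<le> (\<Sum>j\<in>?J. ennreal (exp (- t)))"
  proof (intro sum_mono)
    have "emeasure \<mu> H \<le> ennreal (lap \<theta> x)" unfolding H_def by (rule chernoff)
    also have "\<dots> \<le> ennreal (exp (- t))" using \<theta> by (intro ennreal_leI) simp
    finally show "emeasure \<mu> H \<le> ennreal (exp (- t))" .
  qed
  also have "\<dots> = ennreal (N * exp (- t))" by (simp add: ennreal_mult ennreal_of_nat_eq_real_of_nat)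
  finally show ?thesis .
qed

lemma expect_hull_le:
  assumes N: "1 \<le> N"
  shows "expect_hull \<mu> N \<le> V t + N * exp (- t)"
proof -
  let ?P = "\<Pi>\<^sub>M j\<in>{1..N}. \<mu>"
  interpret P: prob_space ?P by (intro prob_space_PiM prob_space_axioms)
  have lev: "level t \<in> sets \<mu>" using level_sets sets_mu_vol by simp
  have "ennreal (expect_hull \<mu> N) = (\<integral>\<^sup>+x. emeasure ?P {X \<in> space ?P. x \<in> convex hull (X ` {1..N})} \<partial>\<mu>)"
    by (rule expect_hull_eq(1)[OF prob_space_axioms sets_mu N])
  also have "\<dots> \<le> (\<integral>\<^sup>+x. indicator (level t) x + ennreal (N * exp (- t)) \<partial>\<mu>)"
  proof (rule nn_integral_mono)
    fix x assume "x \<in> space \<mu>"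
    then show "emeasure ?P {X \<in> space ?P. x \<in> convex hull (X ` {1..N})} \<le> indicator (level t) x + ennreal (N * exp (- t))"
      using prob_in_hull_le[of x t N] P.emeasure_le_1
      by (cases "x \<in> level t") (auto simp: space_mu intro: add_increasing2)
  qed
  also have "\<dots> = ennreal (V t) + ennreal (N * exp (- t))"
    using lev emeasure_space_1 by (subst nn_integral_add) (auto simp: emeasure_eq_measure V_def)
  also have "\<dots> = ennreal (V t + N * exp (- t))" using V_bounds by (simp add: ennreal_plus)
  finally show ?thesis using V_bounds[of t] by (subst (asm) ennreal_le_iff) (auto intro: add_nonneg_nonneg)
qed

text \<open>
  The cut-off \<open>max 0\<close> in the proof makes the bound on the probability of being captured trivial, rather
  than negative, when the union bound exceeds 1.
\<close>

lemma expect_hull_ge: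
  assumes N: "1 \<le> N" and p: "0 \<le> p" "p \<le> 1" "\<And>x u. x \<in> level c \<Longrightarrow> p \<le> tail u (inner_Rn n u x)"
  shows "V c - real N ^ (n + 1) * (1 - p) ^ (N - (n + 1)) \<le> expect_hull \<mu> N"
proof -
  let ?P = "\<Pi>\<^sub>M j\<in>{1..N}. \<mu>"
  let ?b = "real N ^ (n + 1) * (1 - p) ^ (N - (n + 1))"
  interpret P: prob_space ?P by (intro prob_space_PiM prob_space_axioms)
  have lev: "level c \<in> sets \<mu>" using level_sets sets_mu_vol by simp
  have b: "0 \<le> ?b" using p by simp
  have "ennreal (max 0 (1 - ?b) * V c) = (\<integral>\<^sup>+x. ennreal (max 0 (1 - ?b)) * indicator (level c) x \<partial>\<mu>)"
    using lev by (simp add: nn_integral_cmult emeasure_eq_measure V_def ennreal_mult)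
  also have "\<dots> \<le> (\<integral>\<^sup>+x. emeasure ?P {X \<in> space ?P. x \<in> convex hull (X ` {1..N})} \<partial>\<mu>)"
  proof (rule nn_integral_mono)
    fix x assume x: "x \<in> space \<mu>"
    show "ennreal (max 0 (1 - ?b)) * indicator (level c) x \<le> emeasure ?P {X \<in> space ?P. x \<in> convex hull (X ` {1..N})}"
    proof (cases "x \<in> level c")
      case True
      let ?E = "{X \<in> space ?P. x \<in> convex hull (X ` {1..N})}"
      have E: "?E \<in> sets ?P" by (rule expect_hull_eq(2)[OF prob_space_axioms sets_mu N x])
      have "emeasure ?P {X \<in> space ?P. x \<notin> convex hull (X ` {1..N})} \<le> ennreal (real (card {1..N}) ^ (n + 1) * (1 - p) ^ (card {1..N} - (n + 1)))"
        using p(3)[OF True] x N p(1,2)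
        by (intro prob_not_in_hull_le[OF prob_space_axioms sets_mu]) (auto simp: space_mu tail_def)
      then have "ennreal (P.prob {X \<in> space ?P. x \<notin> convex hull (X ` {1..N})}) \<le> ennreal ?b"
        unfolding P.emeasure_eq_measure by simp
      then have "P.prob {X \<in> space ?P. x \<notin> convex hull (X ` {1..N})} \<le> ?b"
        using b by (simp only: ennreal_le_iff)
      moreover have "{X \<in> space ?P. x \<notin> convex hull (X ` {1..N})} = space ?P - ?E" by auto
      ultimately have "1 - ?b \<le> P.prob ?E" using P.prob_compl[OF E] by simp
      then show ?thesis unfolding P.emeasure_eq_measure using True by (simp add: ennreal_leI)
    qed simp
  qed
  also have "\<dots> = ennreal (expect_hull \<mu> N)"
    by (rule expect_hull_eq(1)[OF prob_space_axioms sets_mu N, symmetric])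
  finally have "max 0 (1 - ?b) * V c \<le> expect_hull \<mu> N"
    using V_bounds[of c] by (simp add: expect_hull_def)
  moreover have "V c - ?b \<le> (1 - ?b) * V c"
    using mult_left_mono[OF V_bounds(2)[of c] b] by (simp add: algebra_simps)
  moreover have "(1 - ?b) * V c \<le> max 0 (1 - ?b) * V c"
    using V_bounds[of c] by (intro mult_right_mono) auto
  ultimately show ?thesis by linarith
qed

end

lemma eventually_quadratic_le_exp:
  fixes k C :: real
  assumes "0 < k"
  shows "\<forall>\<^sub>F x in at_top. C * x\<^sup>2 \<le> exp (k * x)"
proof -
  have "filterlim (\<lambda>x. k * x) at_top at_top"
    using assms by (intro filterlim_tendsto_pos_mult_at_top[OF tendsto_const _ filterlim_ident])
  from filterlim_compose[OF tendsto_power_div_exp_0[of 2] this]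
  have "((\<lambda>x. (k * x)\<^sup>2 / exp (k * x)) \<longlongrightarrow> 0) at_top" by simp
  then have "((\<lambda>x. C / k\<^sup>2 * ((k * x)\<^sup>2 / exp (k * x))) \<longlongrightarrow> C / k\<^sup>2 * 0) at_top"
    by (rule tendsto_mult_left)
  then have "\<forall>\<^sub>F x in at_top. C / k\<^sup>2 * ((k * x)\<^sup>2 / exp (k * x)) < 1"
    by (intro order_tendstoD) auto
  then show ?thesis
    by eventually_elim (use assms in \<open>simp add: field_simps\<close>)
qed

section \<open>The threshold\<close>

text \<open>
  For \<open>N < k\<close> the truncated exponent \<open>N - k\<close> is 0; the bound remains true because of the summand \<open>k\<close>.
\<close>

lemma power_mult_one_minus_le:
  assumes p: "0 \<le> p" "p \<le> 1" and N: "1 \<le> N"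
  shows "real N ^ k * (1 - p) ^ (N - k) \<le> exp (k * ln (real N) + k - p * N)"
proof -
  have "(1 - p) ^ (N - k) \<le> exp (- p) ^ (N - k)"
    using p exp_ge_add_one_self[of "- p"] by (intro power_mono) auto
  also have "\<dots> = exp (- p * real (N - k))" by (simp add: exp_of_nat_mult[symmetric] mult.commute)
  also have "\<dots> \<le> exp (k - p * N)"
  proof -
    have "p * real k \<le> k" using p by (simp add: mult_left_le_one_le)
    moreover have "p * (real N - real k) \<le> p * real (N - k)" using p by (intro mult_left_mono) auto
    ultimately show ?thesis by (simp add: algebra_simps)
  qed
  finally have "(1 - p) ^ (N - k) \<le> exp (k - p * N)" .
  moreover have "real N ^ k = exp (k * ln (real N))" using N by (simp add: exp_of_nat_mult)
  ultimately have "real N ^ k * (1 - p) ^ (N - k) \<le> exp (k * ln (real N)) * exp (k - p * N)"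
    by (simp add: mult_left_mono)
  then show ?thesis by (simp add: exp_add[symmetric] algebra_simps)
qed

context body begin

text \<open>
  Split at the height \<open>t = (1 - \<epsilon> / 2) T\<close>, halfway between the exponent of \<open>N\<close> and \<open>T\<close>.
\<close>

lemma expect_hull_below_threshold:
  assumes \<epsilon>: "0 < \<epsilon>" "\<epsilon> < 1" and a: "a = T / n"
    and A: "2 * a \<le> exp (\<epsilon> / 2 * a)"
    and N: "1 \<le> N" "real N \<le> exp ((1 - \<epsilon>) * T)"
  shows "expect_hull \<mu> N \<le> 1 / a"
proof -
  have a0: "0 < a" using T_pos n_pos a by simp
  define t where "t = (1 - \<epsilon> / 2) * T"
  have aT: "a \<le> T"
  proof -
    have "a * 1 \<le> a * real n" using a0 n_pos by (intro mult_left_mono) auto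
    then show ?thesis using a n_pos by simp
  qed
  have "V t \<le> exp (- (T - t) / n)" using \<epsilon> T_pos by (intro V_lower_tail) (simp add: t_def)
  also have "- (T - t) / n = - (\<epsilon> / 2 * a)" unfolding t_def a by (simp add: field_simps)
  finally have 1: "V t \<le> exp (- (\<epsilon> / 2 * a))" .
  have "real N * exp (- t) \<le> exp ((1 - \<epsilon>) * T) * exp (- t)" using N by (intro mult_right_mono) auto
  also have "\<dots> = exp (- (\<epsilon> / 2 * T))" unfolding t_def exp_add[symmetric] by (simp add: algebra_simps)
  also have "\<dots> \<le> exp (- (\<epsilon> / 2 * a))" using aT \<epsilon> by simp
  finally have 2: "real N * exp (- t) \<le> exp (- (\<epsilon> / 2 * a))" .
  have "expect_hull \<mu> N \<le> 2 * exp (- (\<epsilon> / 2 * a))" using expect_hull_le[OF N(1), of t] 1 2 by simp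
  also have "\<dots> \<le> 1 / a" using A a0 by (simp add: exp_minus field_simps)
  finally show ?thesis .
qed

text \<open>
  The heights are spaced out between \<open>T\<close> and \<open>(1 + \<epsilon>) T\<close>: Markov's inequality gives a fixed positive
  probability at \<open>(1 + \<epsilon> / 4) T\<close>; the exponential tail makes it almost 1 at \<open>(1 + \<epsilon> / 2) T\<close>; half-spaces
  through points of that level have mass at least \<open>exp (- (1 + 3 \<epsilon> / 4) T)\<close> when \<open>\<eta> = \<epsilon> / 16\<close>; and
  \<open>N\<close> exceeds the reciprocal of this mass by an exponential factor, which beats the \<open>N ^ (n + 1)\<close> of the
  union bound because \<open>n \<le> T\<close>.
\<close>

lemma expect_hull_above_threshold:
  assumes \<epsilon>: "0 < \<epsilon>" "\<epsilon> < 1" and a: "a = T / n"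
    and A1: "1 \<le> a" and A2: "- ln (\<epsilon> / 16) / (1 - \<epsilon> / 16) \<le> \<epsilon> / 8 * a"
    and A3: "2 * ln ((1 + \<epsilon> / 4) / (\<epsilon> / 4)) * a \<le> exp (\<epsilon> / 4 * a)"
    and A4: "2 * a \<le> exp a"
    and A5: "\<And>L. a \<le> L \<Longrightarrow> 5 * L\<^sup>2 \<le> exp (\<epsilon> / 8 * L)"
    and N: "1 \<le> N" "exp ((1 + \<epsilon>) * T) \<le> real N"
  shows "1 - 1 / a \<le> expect_hull \<mu> N"
proof -
  have a0: "0 < a" using A1 by simp
  have aT: "a \<le> T" and nT: "n \<le> T"
  proof -
    have T: "T = a * real n" using a n_pos by simp
    have "a * 1 \<le> a * real n" using a0 n_pos by (intro mult_left_mono) auto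
    then show "a \<le> T" using T by simp
    have "1 * real n \<le> a * real n" using A1 by (intro mult_right_mono) auto
    then show "n \<le> T" using T by simp
  qed
  have \<epsilon>2: "\<epsilon> * \<epsilon> \<le> \<epsilon>" using \<epsilon> by (simp add: mult_left_le)
  define c1 c where "c1 = (1 + \<epsilon> / 4) * T" and "c = (1 + \<epsilon> / 2) * T"
  have c1: "0 < c1" "c1 \<le> c" using \<epsilon> T_pos by (auto simp: c1_def c_def intro!: mult_right_mono)
  let ?q = "(\<epsilon> / 4) / (1 + \<epsilon> / 4)"
  have q0: "0 < ?q" using \<epsilon> by simp
  have "T / c1 = 1 / (1 + \<epsilon> / 4)" using T_pos by (simp add: c1_def)
  moreover have "?q = 1 - 1 / (1 + \<epsilon> / 4)" using \<epsilon> by (simp add: field_simps)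
  ultimately have "?q = 1 - T / c1" by simp
  then have q: "?q \<le> V c1" using V_markov[OF c1(1)] by simp
  then have V1: "0 < V c1" using q0 by linarith
  define l where "l = ln (1 / ?q)"
  have A3': "2 * l * a \<le> exp (\<epsilon> / 4 * a)"
    using A3 by (simp only: l_def divide_divide_eq_right mult_1)
  have "1 - V c \<le> ln (1 / V c1) * exp (- (c - c1) / n)" by (rule V_tail[OF V1 c1(2)])
  also have "- (c - c1) / n = - (\<epsilon> / 4 * a)" unfolding c1_def c_def a by (simp add: field_simps)
  also have "ln (1 / V c1) * exp (- (\<epsilon> / 4 * a)) \<le> l * exp (- (\<epsilon> / 4 * a))"
    unfolding l_def
  proof (intro mult_right_mono ln_mono)
    show "1 / V c1 \<le> 1 / ?q" using q q0 V1 by (intro divide_left_mono mult_pos_pos) auto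
  qed (use V1 in auto)
  also have "\<dots> \<le> 1 / (2 * a)" using A3' a0 by (simp add: exp_minus field_simps)
  finally have Vc: "1 - V c \<le> 1 / (2 * a)" .
  define \<eta> where "\<eta> = \<epsilon> / 16"
  have \<eta>: "0 < \<eta>" "\<eta> < 1" using \<epsilon> by (auto simp: \<eta>_def)
  define p where "p = exp (- ((1 + 3 * \<epsilon> / 4) * T))"
  have p: "0 \<le> p" "p \<le> 1" using \<epsilon> T_pos by (auto simp: p_def)
  have "p \<le> tail u (inner_Rn n u x)" if x: "x \<in> level c" for x u
  proof -
    have "c / (1 - \<eta>) \<le> (1 + 5 * \<epsilon> / 8) * T"
    proof -
      have "(1 + 5 * \<epsilon> / 8) * (1 - \<eta>) = 1 + 9 / 16 * \<epsilon> - 5 / 128 * (\<epsilon> * \<epsilon>)"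
        unfolding \<eta>_def by (simp add: field_simps)
      then have "1 + \<epsilon> / 2 \<le> (1 + 5 * \<epsilon> / 8) * (1 - \<eta>)" using \<epsilon>2 \<epsilon> by linarith
      then have "(1 + \<epsilon> / 2) * T \<le> (1 + 5 * \<epsilon> / 8) * (1 - \<eta>) * T" using T_pos by (intro mult_right_mono) auto
      then show ?thesis using \<eta> by (simp add: c_def field_simps)
    qed
    moreover have "- ln \<eta> / (1 - \<eta>) \<le> \<epsilon> / 8 * T"
    proof -
      have "\<epsilon> / 8 * a \<le> \<epsilon> / 8 * T" using aT \<epsilon> by (intro mult_left_mono) auto
      then show ?thesis using A2 unfolding \<eta>_def by linarith
    qed
    moreover have "(c - ln \<eta>) / (1 - \<eta>) = c / (1 - \<eta>) + - ln \<eta> / (1 - \<eta>)" by (simp add: diff_divide_distrib)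
    moreover have "(1 + 3 * \<epsilon> / 4) * T = (1 + 5 * \<epsilon> / 8) * T + \<epsilon> / 8 * T" by (simp add: algebra_simps)
    ultimately have "(c - ln \<eta>) / (1 - \<eta>) \<le> (1 + 3 * \<epsilon> / 4) * T" by linarith
    then have "p \<le> exp (- (c - ln \<eta>) / (1 - \<eta>))" 
      by (simp only: p_def exp_le_cancel_iff minus_divide_left[symmetric] neg_le_iff_le)
    then show ?thesis using tail_at_level[OF x \<eta>, of u] by simp
  qed
  then have main: "V c - real N ^ (n + 1) * (1 - p) ^ (N - (n + 1)) \<le> expect_hull \<mu> N"
    by (intro expect_hull_ge N p)
  \<comment> \<open>Estimates are in terms of \<open>ln N\<close>, since they are needed for all large \<open>N\<close> and not only at the threshold.\<close>
  define L where "L = ln (real N)"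
  have NL: "real N = exp L" using N by (simp add: L_def)
  have L: "(1 + \<epsilon>) * T \<le> L" using N(2) unfolding NL by simp
  have LT: "T \<le> L"
  proof -
    have "0 \<le> \<epsilon> * T" using \<epsilon> T_pos by simp
    then show ?thesis using L by (simp add: algebra_simps)
  qed
  have pN: "exp (\<epsilon> / 8 * L) \<le> p * N"
  proof -
    have "(1 - \<epsilon> / 8) * (1 + \<epsilon>) = 1 + 7 / 8 * \<epsilon> - 1 / 8 * (\<epsilon> * \<epsilon>)"
      by (simp add: field_simps)
    then have "1 + 3 * \<epsilon> / 4 \<le> (1 - \<epsilon> / 8) * (1 + \<epsilon>)" using \<epsilon>2 by linarith
    then have "(1 + 3 * \<epsilon> / 4) * T \<le> (1 - \<epsilon> / 8) * (1 + \<epsilon>) * T" using T_pos by (intro mult_right_mono) auto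
    also have "\<dots> = (1 - \<epsilon> / 8) * ((1 + \<epsilon>) * T)" by simp
    also have "\<dots> \<le> (1 - \<epsilon> / 8) * L" using L \<epsilon> by (intro mult_left_mono) auto
    finally show ?thesis unfolding p_def NL exp_add[symmetric] by (simp add: algebra_simps)
  qed
  have "real N ^ (n + 1) * (1 - p) ^ (N - (n + 1)) \<le> exp ((n + 1) * L + (n + 1) - p * N)"
    using power_mult_one_minus_le[OF p N(1), of "n + 1"] by (simp add: L_def)
  also have "\<dots> \<le> exp (- L)"
  proof -
    have L1: "1 \<le> L" using LT aT A1 by simp
    have n1: "real (n + 1) \<le> 2 * L" using nT LT L1 by simp
    have "real (n + 1) * L \<le> 2 * (L * L)" using mult_right_mono[OF n1, of L] L1 by (simp add: mult.assoc)
    moreover have "L \<le> L * L" using L1 by simp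
    ultimately have "real (n + 1) * L + real (n + 1) + L \<le> 5 * L\<^sup>2"
      unfolding power2_eq_square using n1 by linarith
    also have "\<dots> \<le> exp (\<epsilon> / 8 * L)" using LT aT by (intro A5) simp
    finally show ?thesis using pN by simp
  qed
  also have "\<dots> \<le> exp (- a)" using LT aT by simp
  also have "\<dots> \<le> 1 / (2 * a)" using A4 a0 by (simp add: exp_minus field_simps)
  finally have "real N ^ (n + 1) * (1 - p) ^ (N - (n + 1)) \<le> 1 / (2 * a)" .
  moreover have "1 / a = 1 / (2 * a) + 1 / (2 * a)" using a0 by (simp add: field_simps)
  ultimately show ?thesis using main Vc by linarith
qed

lemma rho1_ge:
  assumes \<epsilon>: "0 < \<epsilon>" "\<epsilon> < 1" and A: "2 * (T / n) \<le> exp (\<epsilon> / 2 * (T / n))"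
  shows "ereal ((1 - \<epsilon>) * T) \<le> rho1 \<mu> (n / T)"
  unfolding rho1_def
proof (intro Sup_upper imageI, safe)
  show "0 < (1 - \<epsilon>) * T" using \<epsilon> T_pos by simp
  show "expect_hull \<mu> N \<le> n / T" if "1 \<le> N" "real N \<le> exp ((1 - \<epsilon>) * T)" for N
    using expect_hull_below_threshold[OF \<epsilon> refl A that] by simp
qed

lemma rho2_le:
  assumes \<epsilon>: "0 < \<epsilon>" "\<epsilon> < 1"
    and A1: "1 \<le> T / n" and A2: "- ln (\<epsilon> / 16) / (1 - \<epsilon> / 16) \<le> \<epsilon> / 8 * (T / n)"
    and A3: "2 * ln ((1 + \<epsilon> / 4) / (\<epsilon> / 4)) * (T / n) \<le> exp (\<epsilon> / 4 * (T / n))"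
    and A4: "2 * (T / n) \<le> exp (T / n)"
    and A5: "\<And>L. T / n \<le> L \<Longrightarrow> 5 * L\<^sup>2 \<le> exp (\<epsilon> / 8 * L)"
  shows "rho2 \<mu> (n / T) \<le> ereal ((1 + \<epsilon>) * T)"
  unfolding rho2_def
proof (intro Inf_lower imageI, safe)
  show "0 < (1 + \<epsilon>) * T" using \<epsilon> T_pos by simp
  show "1 - n / T \<le> expect_hull \<mu> N" if "1 \<le> N" "exp ((1 + \<epsilon>) * T) \<le> real N" for N
    using expect_hull_above_threshold[OF \<epsilon> refl A1 A2 A3 A4 A5 that] by simp
qed

end

lemma eventually_threshold_conditions:
  assumes "0 < (\<epsilon>::real)"
  shows "\<forall>\<^sub>F a in at_top. 2 * a \<le> exp (\<epsilon> / 2 * a) \<and> 1 \<le> a \<and>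
    - ln (\<epsilon> / 16) / (1 - \<epsilon> / 16) \<le> \<epsilon> / 8 * a \<and>
    2 * ln ((1 + \<epsilon> / 4) / (\<epsilon> / 4)) * a \<le> exp (\<epsilon> / 4 * a) \<and>
    2 * a \<le> exp a \<and> (\<forall>L\<ge>a. 5 * L\<^sup>2 \<le> exp (\<epsilon> / 8 * L))"
proof -
  have lin: "\<forall>\<^sub>F a in at_top. C * a \<le> exp (k * a)" if "0 < k" for k C :: real
    using eventually_quadratic_le_exp[OF that, of "\<bar>C\<bar>"] eventually_ge_at_top[of 1]
  proof eventually_elim
    case (elim a)
    have "C * a \<le> \<bar>C\<bar> * a" using elim by (intro mult_right_mono) auto
    also have "\<dots> \<le> \<bar>C\<bar> * a\<^sup>2" using elim by (intro mult_left_mono) (auto simp: power2_eq_square)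
    finally show ?case using elim by simp
  qed
  have "\<forall>\<^sub>F a in at_top. X \<le> \<epsilon> / 8 * a" for X
    using eventually_ge_at_top[of "X / (\<epsilon> / 8)"]
    by eventually_elim (use assms in \<open>simp add: field_simps\<close>)
  then have "\<forall>\<^sub>F a in at_top. - ln (\<epsilon> / 16) / (1 - \<epsilon> / 16) \<le> \<epsilon> / 8 * a" .
  moreover have "\<forall>\<^sub>F a in at_top. \<forall>L\<ge>a. 5 * L\<^sup>2 \<le> exp (\<epsilon> / 8 * L)"
    using eventually_quadratic_le_exp[of "\<epsilon> / 8" 5] assms
    by (intro eventually_all_ge_at_top) auto
  ultimately show ?thesis
    using lin[of "\<epsilon> / 2" 2] lin[of "\<epsilon> / 4" "2 * ln ((1 + \<epsilon> / 4) / (\<epsilon> / 4))"] lin[of 1 2]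
      eventually_ge_at_top[of "1::real"] assms
    by (simp add: eventually_conj_iff)
qed

theorem theorem1p6:
  fixes K :: "nat \<Rightarrow> (nat \<Rightarrow> real) set"
  assumes body: "\<And>n. n \<ge> 1 \<Longrightarrow> convex_body n (K n)"
    and growth: "(\<lambda>n. expect_cramer n (uniform_on n (K n)) / of_nat n) \<longlonglongrightarrow> \<infinity>"
  shows "sharp_threshold (\<lambda>n. uniform_on n (K n))
           (\<lambda>n. enn2real (expect_cramer n (uniform_on n (K n))))"
proof -
  define T where "T n = enn2real (expect_cramer n (uniform_on n (K n)))" for n
  have B: "body n (K n)" if "1 \<le> n" for n using body[OF that] that by (simp add: body_def)
  have BT: "body.T n (K n) = T n" if "1 \<le> n" for n
    using body.T_def[OF B[OF that]] by (simp add: T_def)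
  have Tpos: "0 < T n" if "1 \<le> n" for n
    using body.T_pos[OF B[OF that]] BT[OF that] by simp
  have ratio: "filterlim (\<lambda>n. T n / n) at_top sequentially"
    unfolding filterlim_at_top
  proof
    fix Z :: real
    have "\<forall>\<^sub>F n in sequentially. ennreal (max 0 Z) < expect_cramer n (uniform_on n (K n)) / of_nat n"
      using growth by (intro order_tendstoD) auto
    then show "\<forall>\<^sub>F n in sequentially. Z \<le> T n / n"
      using eventually_ge_at_top[of 1]
    proof eventually_elim
      case (elim n)
      then have "expect_cramer n (uniform_on n (K n)) = ennreal (T n)"
        using body.expect_cramer_eq[OF B] BT by simp
      then have "ennreal (max 0 Z) < ennreal (T n / n)"
        using elim Tpos[of n] by (simp add: divide_ennreal ennreal_of_nat_eq_real_of_nat)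
      then have "max 0 Z < T n / n" by (subst (asm) ennreal_less_iff) auto
      then show ?case by simp
    qed
  qed
  have "(\<lambda>n. n / T n) \<longlonglongrightarrow> 0"
    using tendsto_inverse_0_at_top[OF ratio] by simp
  moreover have "\<exists>n0. \<forall>n\<ge>n0. rho1 (uniform_on n (K n)) (n / T n) \<ge> ereal ((1 - \<epsilon>) * T n) \<and>
      rho2 (uniform_on n (K n)) (n / T n) \<le> ereal ((1 + \<epsilon>) * T n)" if \<epsilon>: "0 < \<epsilon> \<and> \<epsilon> < 1" for \<epsilon>
  proof -
    have "\<forall>\<^sub>F n in sequentially. rho1 (uniform_on n (K n)) (n / T n) \<ge> ereal ((1 - \<epsilon>) * T n) \<and>
      rho2 (uniform_on n (K n)) (n / T n) \<le> ereal ((1 + \<epsilon>) * T n)"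
      using eventually_compose_filterlim[OF eventually_threshold_conditions[OF conjunct1[OF \<epsilon>]] ratio]
        eventually_ge_at_top[of 1]
    proof eventually_elim
      case (elim n)
      show ?case
        using body.rho1_ge[OF B, of n \<epsilon>] body.rho2_le[OF B, of n \<epsilon>] elim \<epsilon> BT[of n] by simp
    qed
    then show ?thesis by (simp add: eventually_sequentially)
  qed
  ultimately show ?thesis
    unfolding sharp_threshold_def T_def[symmetric]
    using body.borel_prob_Rn_mu[OF B] Tpos
    by (intro conjI exI[of _ "\<lambda>n. n / T n"]) auto
qed

end
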